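(* Let $T\in(1,\infty]$ ($T=\infty$: open-end procedure; $T<\infty$: closed-end procedure). Assume that $D(\Theta)$, $\mathrm{Id}(\Theta)$, $\mathrm{Var}(\Theta)$ and $A_i(\Theta)$, $i=0,1,2$, hold, the sequences in $A_i(\Theta)$ satisfying $$\alpha_j^{(i)}=O(j^{-\gamma})\quad\text{for some }\gamma>3/2,\qquad i=0,1,2,$$ and that $b$ is a boundary function satisfying Assumption B. Assume that the alternative $H_1$ holds: $\theta_0^*\ne\theta_1^*$, both in the interior of $\Theta$, there exists $T^*\in(1,T)$ such that $k^*=k^*(m)=[T^*m]$, and $$Y_t\mid\mathcal{F}_{t-1}\sim\mathrm{Poisson}(\lambda_t),\qquad \lambda_t=\begin{cases}f_{\theta_0^*}(Y_{t-1},Y_{t-2},\dots)& t\le k^*,\\ f_{\theta_1^*}(Y_{t-1},Y_{t-2},\dots)& t>k^*,\end{cases}$$ where $\mathcal{F}_t=\sigma(Y_s,\ s\le t)$ and $(Y_t)_{t\le k^*}$ is strictly stationary. Then the stopping time $\tau(m)$ of the monitoring scheme satisfies $$\lim_{m\to\infty}P\{\tau(m)<\infty\}=1.$$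
   Context: $\Theta\subset\mathbb{R}^d$ is a compact set, and $(f_\theta)_{\theta\in\Theta}$ is a family of measurable non-negative functions $f_\theta:(\mathbb{R}^+)^{\mathbb{N}}\to[0,\infty)$, with $\mathbb{N}=\{1,2,\dots\}$, such that $\theta\mapsto f_\theta$ is twice continuously differentiable on $\Theta$. The norm $\|\cdot\|$ is the sum of absolute values of the coordinates, and $\|g\|_\Theta=\sup_{\theta\in\Theta}\|g(\theta)\|$ for a function $g$ on $\Theta$. The symbol $'$ on vectors denotes transpose, and $[x]$ is the integer part of $x$. For each $m$, $Y=(Y_t)_{t\in\mathbb{Z}}$ is a $\{0,1,2,\dots\}$-valued process (depending on $m$ through $k^*(m)$). Assumption $A_i(\Theta)$, $i=0,1,2$: $\|\partial^i f_\theta(0)/\partial\theta^i\|_\Theta<\infty$ and there is a sequence of non-negative reals $(\alpha^{(i)}_k)_{k\ge1}$, with $\sum_{k\ge1}\alpha^{(0)}_k<1$ when $i=0$ and $\sum_{k\ge1}\alpha^{(i)}_k<\infty$ when $i=1,2$, such that $\big\|\frac{\partial^i f_\theta(y)}{\partial\theta^i}-\frac{\partial^i f_\theta(y')}{\partial\theta^i}\big\|_\Theta\le\sum_{k\ge1}\alpha^{(i)}_k|y_k-y'_k|$ for all $y,y'\in(\mathbb{R}^+)^{\mathbb{N}}$. Assumption $D(\Theta)$: there is $\underline{c}>0$ such that $\inf_{\theta\in\Theta}f_\theta(y)\ge\underline{c}$ for all $y\in(\mathbb{R}^+)^{\mathbb{N}}$. Assumption $\mathrm{Id}(\Theta)$: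 for all $(\theta,\theta')\in\Theta^2$, if $f_\theta(Y_{t-1},Y_{t-2},\dots)=f_{\theta'}(Y_{t-1},Y_{t-2},\dots)$ a.s. for some $t>k^*$, then $\theta=\theta'$. Assumption $\mathrm{Var}(\Theta)$: for all $\theta\in\Theta$ and $t>k^*$, the components of the vector $\frac{\partial f_\theta}{\partial\theta}(Y_{t-1},Y_{t-2},\dots)$ are a.s. linearly independent (i.e. a deterministic linear combination of the components that vanishes a.s. has all coefficients zero). Assumption B: $b:(0,\infty)\to(0,\infty)$ is non-increasing and continuous with $\inf_{0<t<\infty}b(t)>0$. Estimator: for $k\le k'$, $T_{k,k'}=\{k,k+1,\dots,k'\}$. For finite $S\subset\{1,2,\dots\}$, $\widehat L(S,\theta)=\sum_{t\in S}\big(Y_t\log\widehat f^t_\theta-\widehat f^t_\theta\big)$ with $\widehat f^t_\theta=f_\theta(Y_{t-1},\dots,Y_1,0,0,\dots)$, and $\widehat\theta(S)=\operatorname{argmax}_{\theta\in\Theta}\widehat L(S,\theta)$ (a maximizer). Monitoring scheme: $Y_1,\dots,Y_m$ are the historical observations and monitoring starts at time $m+1$. Let $$\widehat\Sigma_m=\Big(\frac1m\sum_{t=1}^m\frac{1}{\widehat f^t_\theta}\Big(\frac{\partial}{\partial\theta}\widehat f^t_\theta\Big)\Big(\frac{\partial}{\partial\theta}\widehat f^t_\theta\Big)'\Big)\Big|_{\theta=\widehat\theta(T_{1,m})},$$ which is asymptotically positive definite, so that $\widehat\Sigma_m^{-1/2}$ is well defined for $m$ large enough. Let $(v_m)$ be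 a sequence of integers with $v_m\to\infty$ and $v_m/\sqrt m\to0$, and $\Pi_{m,k}=\{m-v_m,m-v_m+1,\dots,k-v_m\}$ for $k>m$. The detector is $$\widehat C_{k,\ell}=\sqrt m\,\frac{k-\ell}{k}\,\big\|\widehat\Sigma_m^{-1/2}\big(\widehat\theta(T_{\ell,k})-\widehat\theta(T_{1,m})\big)\big\|,\qquad k>m,\ \ell\in\Pi_{m,k},$$ and the stopping time is $$\tau(m)=\inf\big\{m<k<[Tm]+1\ :\ \exists\,\ell\in\Pi_{m,k},\ \widehat C_{k,\ell}>b((k-\ell)/m)\big\},\qquad \inf\emptyset=\infty$$ (for $T=\infty$, $k$ ranges over all integers $k>m$).
   Formalization: The formal theorem additionally assumes that Y_t has finite mean for t ≤ k* (as the usual stationary solution does); without it the claim fails for some strictly stationary processes of infinite mean, where the Lipschitz bound in A_0 is void. *)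

theory Defs
  imports "HOL-Probability.Probability" "HOL-Library.Landau_Symbols"
begin

text \<open>
  Conventions.  A sequence \<open>(y_1, y_2, \<dots>)\<close> with index set \<open>{1, 2, \<dots>}\<close> is represented by
  \<open>y :: nat \<Rightarrow> real\<close> with \<open>y j\<close> standing for \<open>y_(j+1)\<close>; the same shift applies to the coefficient
  sequences \<open>\<alpha>\<close>.  Times are integers.  The parameter space is a set \<open>\<Theta>\<close> in \<open>real^'d\<close>, and
  \<open>f \<theta> y\<close> is \<open>f_\<theta>(y)\<close>.
\<close>

definition nonneg_seqs :: "(nat \<Rightarrow> real) set" where
  "nonneg_seqs = {y. \<forall>j. 0 \<le> y j}"

text \<open>Sum of the absolute values of the coordinates; on \<open>real\<close>, \<open>real^'d\<close> and \<open>real^'d^'d\<close>.\<close>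

definition norm1 :: "'a::euclidean_space \<Rightarrow> real" where
  "norm1 x = (\<Sum>b\<in>Basis. \<bar>x \<bullet> b\<bar>)"

text \<open>Extended-valued, so that no boundedness is presupposed.\<close>

definition sup_norm1 :: "'p set \<Rightarrow> ('p \<Rightarrow> 'a::euclidean_space) \<Rightarrow> ennreal" where
  "sup_norm1 \<Theta> g = (SUP \<theta>\<in>\<Theta>. ennreal (norm1 (g \<theta>)))"

definition intensity_family :: "(real^'d) set \<Rightarrow> (real^'d \<Rightarrow> (nat \<Rightarrow> real) \<Rightarrow> real) \<Rightarrow> bool" where
  "intensity_family \<Theta> f \<longleftrightarrow>
     (\<forall>\<theta>\<in>\<Theta>. f \<theta> \<in> borel_measurable (restrict_space (\<Pi>\<^sub>M j\<in>UNIV. borel) nonneg_seqs) \<and>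
             (\<forall>y\<in>nonneg_seqs. 0 \<le> f \<theta> y))"

text \<open>
  \<open>Df\<close> and \<open>D2f\<close> are the gradient and Hessian on \<open>\<Theta>\<close>.  They are carried as explicit functions and
  differentiability is relative to \<open>\<Theta>\<close>, since derivatives are also used on the boundary of the
  compact set \<open>\<Theta>\<close> and relative derivatives need not be unique there.
\<close>

definition C2_on ::
  "(real^'d) set \<Rightarrow> (real^'d \<Rightarrow> (nat \<Rightarrow> real) \<Rightarrow> real) \<Rightarrow> (real^'d \<Rightarrow> (nat \<Rightarrow> real) \<Rightarrow> real^'d)
    \<Rightarrow> (real^'d \<Rightarrow> (nat \<Rightarrow> real) \<Rightarrow> real^'d^'d) \<Rightarrow> bool" where
  "C2_on \<Theta> f Df D2f \<longleftrightarrow>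
     (\<forall>y\<in>nonneg_seqs.
        (\<forall>\<theta>\<in>\<Theta>. ((\<lambda>\<theta>. f \<theta> y) has_derivative (\<lambda>h. Df \<theta> y \<bullet> h)) (at \<theta> within \<Theta>) \<and>
                ((\<lambda>\<theta>. Df \<theta> y) has_derivative (\<lambda>h. D2f \<theta> y *v h)) (at \<theta> within \<Theta>)) \<and>
        continuous_on \<Theta> (\<lambda>\<theta>. D2f \<theta> y))"

text \<open>
  \<open>g\<close> is \<open>f\<close>, \<open>Df\<close> or \<open>D2f\<close>.  The right-hand side of the Lipschitz bound may be infinite, hence
  \<open>ennreal\<close>.  For \<open>f\<close> itself, \<open>suminf \<alpha> < 1\<close> is required in addition.
\<close>

definition assumption_A ::
  "'p set \<Rightarrow> ('p \<Rightarrow> (nat \<Rightarrow> real) \<Rightarrow> 'a::euclidean_space) \<Rightarrow> (nat \<Rightarrow> real) \<Rightarrow> bool" where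
  "assumption_A \<Theta> g \<alpha> \<longleftrightarrow>
     sup_norm1 \<Theta> (\<lambda>\<theta>. g \<theta> (\<lambda>_. 0)) < \<infinity> \<and>
     (\<forall>j. 0 \<le> \<alpha> j) \<and> summable \<alpha> \<and>
     (\<forall>y\<in>nonneg_seqs. \<forall>y'\<in>nonneg_seqs.
        sup_norm1 \<Theta> (\<lambda>\<theta>. g \<theta> y - g \<theta> y') \<le> (\<Sum>j. ennreal (\<alpha> j * \<bar>y j - y' j\<bar>)))"

definition assumption_D :: "'p set \<Rightarrow> ('p \<Rightarrow> (nat \<Rightarrow> real) \<Rightarrow> real) \<Rightarrow> bool" where
  "assumption_D \<Theta> f \<longleftrightarrow> (\<exists>c>0. \<forall>y\<in>nonneg_seqs. \<forall>\<theta>\<in>\<Theta>. c \<le> f \<theta> y)"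

text \<open>\<open>(Y_(t-1), Y_(t-2), \<dots>)\<close>, and its truncation \<open>(Y_(t-1), \<dots>, Y_1, 0, 0, \<dots>)\<close>.\<close>

definition past :: "(int \<Rightarrow> 'w \<Rightarrow> nat) \<Rightarrow> int \<Rightarrow> 'w \<Rightarrow> nat \<Rightarrow> real" where
  "past Y t \<omega> j = real (Y (t - 1 - int j) \<omega>)"

definition obs_past :: "(int \<Rightarrow> 'w \<Rightarrow> nat) \<Rightarrow> int \<Rightarrow> 'w \<Rightarrow> nat \<Rightarrow> real" where
  "obs_past Y t \<omega> j = (if 1 \<le> t - 1 - int j then real (Y (t - 1 - int j) \<omega>) else 0)"

definition assumption_Id ::
  "'p set \<Rightarrow> ('p \<Rightarrow> (nat \<Rightarrow> real) \<Rightarrow> real) \<Rightarrow> 'w measure \<Rightarrow> (int \<Rightarrow> 'w \<Rightarrow> nat) \<Rightarrow> int \<Rightarrow> bool" where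
  "assumption_Id \<Theta> f M Y k \<longleftrightarrow>
     (\<forall>\<theta>\<in>\<Theta>. \<forall>\<theta>'\<in>\<Theta>.
        (\<exists>t>k. AE \<omega> in M. f \<theta> (past Y t \<omega>) = f \<theta>' (past Y t \<omega>)) \<longrightarrow> \<theta> = \<theta>')"

definition assumption_Var ::
  "(real^'d) set \<Rightarrow> (real^'d \<Rightarrow> (nat \<Rightarrow> real) \<Rightarrow> real^'d) \<Rightarrow> 'w measure \<Rightarrow> (int \<Rightarrow> 'w \<Rightarrow> nat)
    \<Rightarrow> int \<Rightarrow> bool" where
  "assumption_Var \<Theta> Df M Y k \<longleftrightarrow>
     (\<forall>\<theta>\<in>\<Theta>. \<forall>t>k. \<forall>c :: real^'d.
        (AE \<omega> in M. (\<Sum>i\<in>UNIV. c $ i * Df \<theta> (past Y t \<omega>) $ i) = 0) \<longrightarrow> c = 0)"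

definition assumption_B :: "(real \<Rightarrow> real) \<Rightarrow> bool" where
  "assumption_B b \<longleftrightarrow>
     (\<forall>t>0. 0 < b t) \<and> antimono_on {0<..} b \<and> continuous_on {0<..} b \<and>
     0 < (INF t\<in>{0<..}. b t)"

definition history :: "'w measure \<Rightarrow> (int \<Rightarrow> 'w \<Rightarrow> nat) \<Rightarrow> int \<Rightarrow> 'w measure" where
  "history M Y t = sigma (space M) {Y s -` A \<inter> space M | s A. s \<le> t}"

definition poisson_given_past ::
  "'w measure \<Rightarrow> (int \<Rightarrow> 'w \<Rightarrow> nat) \<Rightarrow> (int \<Rightarrow> 'w \<Rightarrow> real) \<Rightarrow> bool" where
  "poisson_given_past M Y lam \<longleftrightarrow>
     (\<forall>t n. AE \<omega> in M.
        real_cond_exp M (history M Y (t - 1)) (indicator {\<omega> \<in> space M. Y t \<omega> = n}) \<omega>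
          = pmf (poisson_pmf (lam t \<omega>)) n)"

definition change_intensity ::
  "('p \<Rightarrow> (nat \<Rightarrow> real) \<Rightarrow> real) \<Rightarrow> 'p \<Rightarrow> 'p \<Rightarrow> int \<Rightarrow> (int \<Rightarrow> 'w \<Rightarrow> nat) \<Rightarrow> int \<Rightarrow> 'w \<Rightarrow> real" where
  "change_intensity f \<theta>0 \<theta>1 k Y t \<omega> =
     (if t \<le> k then f \<theta>0 (past Y t \<omega>) else f \<theta>1 (past Y t \<omega>))"

text \<open>Strict stationarity of \<open>(Y_t)\<close>, \<open>t \<le> k\<close>: its law is invariant under backward shifts.
  Strict stationarity does not imply a finite mean: the Lipschitz bounds are void between sequences
  with \<open>\<Sum>k. \<alpha> k * \<bar>y k - y' k\<bar> = \<infinity>\<close>.  The stationary solution of the model is the integrable one, and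
  integrability is therefore a hypothesis of its own.\<close>

definition stationary_upto :: "'w measure \<Rightarrow> (int \<Rightarrow> 'w \<Rightarrow> nat) \<Rightarrow> int \<Rightarrow> bool" where
  "stationary_upto M Y k \<longleftrightarrow>
     (\<forall>h\<ge>0. distr M (\<Pi>\<^sub>M t\<in>{..k}. count_space UNIV) (\<lambda>\<omega>. \<lambda>t\<in>{..k}. Y (t - h) \<omega>)
           = distr M (\<Pi>\<^sub>M t\<in>{..k}. count_space UNIV) (\<lambda>\<omega>. \<lambda>t\<in>{..k}. Y t \<omega>))"

definition log_lik ::
  "('p \<Rightarrow> (nat \<Rightarrow> real) \<Rightarrow> real) \<Rightarrow> (int \<Rightarrow> 'w \<Rightarrow> nat) \<Rightarrow> 'w \<Rightarrow> int set \<Rightarrow> 'p \<Rightarrow> real" where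
  "log_lik f Y \<omega> S \<theta> =
     (\<Sum>t\<in>S. (real (Y t \<omega>) * ln (f \<theta> (obs_past Y t \<omega>)) - f \<theta> (obs_past Y t \<omega>)))"

text \<open>\<open>est S\<close> is a (measurable) choice of maximizer of the likelihood based on \<open>S\<close>.\<close>

definition is_MLE ::
  "(real^'d) set \<Rightarrow> (real^'d \<Rightarrow> (nat \<Rightarrow> real) \<Rightarrow> real) \<Rightarrow> 'w measure \<Rightarrow> (int \<Rightarrow> 'w \<Rightarrow> nat)
    \<Rightarrow> (int set \<Rightarrow> 'w \<Rightarrow> real^'d) \<Rightarrow> bool" where
  "is_MLE \<Theta> f M Y est \<longleftrightarrow>
     (\<forall>S. finite S \<and> S \<subseteq> {1..} \<longrightarrow>
        est S \<in> borel_measurable M \<and>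
        (\<forall>\<omega>\<in>space M. is_arg_max (log_lik f Y \<omega> S) (\<lambda>\<theta>. \<theta> \<in> \<Theta>) (est S \<omega>)))"

definition pos_semidef :: "real^'d^'d \<Rightarrow> bool" where
  "pos_semidef A \<longleftrightarrow> transpose A = A \<and> (\<forall>x. 0 \<le> x \<bullet> (A *v x))"

definition matrix_sqrt :: "real^'d^'d \<Rightarrow> real^'d^'d" where
  "matrix_sqrt A = (THE B. pos_semidef B \<and> B ** B = A)"

text \<open>\<open>A\<close> to the power \<open>-1/2\<close>; meaningful for positive definite \<open>A\<close>.\<close>

definition matrix_inv_sqrt :: "real^'d^'d \<Rightarrow> real^'d^'d" where
  "matrix_inv_sqrt A = matrix_inv (matrix_sqrt A)"

definition Sigma_hat ::
  "(real^'d \<Rightarrow> (nat \<Rightarrow> real) \<Rightarrow> real) \<Rightarrow> (real^'d \<Rightarrow> (nat \<Rightarrow> real) \<Rightarrow> real^'d)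
    \<Rightarrow> (int \<Rightarrow> 'w \<Rightarrow> nat) \<Rightarrow> (int set \<Rightarrow> 'w \<Rightarrow> real^'d) \<Rightarrow> nat \<Rightarrow> 'w \<Rightarrow> real^'d^'d" where
  "Sigma_hat f Df Y est m \<omega> =
     (let \<theta> = est {1..int m} \<omega> in
      (1 / real m) *\<^sub>R
        (\<Sum>t\<in>{1..int m}. (1 / f \<theta> (obs_past Y t \<omega>)) *\<^sub>R
           (\<chi> i j. Df \<theta> (obs_past Y t \<omega>) $ i * Df \<theta> (obs_past Y t \<omega>) $ j)))"

definition detector ::
  "(real^'d \<Rightarrow> (nat \<Rightarrow> real) \<Rightarrow> real) \<Rightarrow> (real^'d \<Rightarrow> (nat \<Rightarrow> real) \<Rightarrow> real^'d)
    \<Rightarrow> (int \<Rightarrow> 'w \<Rightarrow> nat) \<Rightarrow> (int set \<Rightarrow> 'w \<Rightarrow> real^'d) \<Rightarrow> nat \<Rightarrow> int \<Rightarrow> int \<Rightarrow> 'w \<Rightarrow> real" where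
  "detector f Df Y est m k l \<omega> =
     sqrt (real m) * (of_int (k - l) / of_int k) *
     norm1 (matrix_inv_sqrt (Sigma_hat f Df Y est m \<omega>) *v (est {l..k} \<omega> - est {1..int m} \<omega>))"

definition monitor_time ::
  "(real^'d \<Rightarrow> (nat \<Rightarrow> real) \<Rightarrow> real) \<Rightarrow> (real^'d \<Rightarrow> (nat \<Rightarrow> real) \<Rightarrow> real^'d)
    \<Rightarrow> (int \<Rightarrow> 'w \<Rightarrow> nat) \<Rightarrow> (int set \<Rightarrow> 'w \<Rightarrow> real^'d) \<Rightarrow> (real \<Rightarrow> real) \<Rightarrow> (nat \<Rightarrow> int)
    \<Rightarrow> ereal \<Rightarrow> nat \<Rightarrow> 'w \<Rightarrow> ereal" where
  "monitor_time f Df Y est b v T m \<omega> =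
     (INF k \<in> {k. int m < k \<and> (T = \<infinity> \<or> k < \<lfloor>real_of_ereal T * real m\<rfloor> + 1) \<and>
                  (\<exists>l\<in>{int m - v m..k - v m}.
                     detector f Df Y est m k l \<omega> > b (of_int (k - l) / real m))}.
        ereal (of_int k))"

end

theory Submission
  imports Defs "HOL-Real_Asymp.Real_Asymp"
begin

text \<open>
  No ergodic theorem is used. The means of the stationary regime are constant, and the contraction property turns
  this into uniform bounds on first and second moments, before and after the change. Products of functions of
  \<open>Y_t\<close> and the past with conditional mean at most 1 are supermartingales of mean at most 1; Markov's inequality
  for such products controls likelihood ratios (through the Hellinger affinity of Poisson laws) and shows that every finite
  pattern followed by a negligible past recurs with positive frequency.

  By the Lipschitz condition, \<open>Id\<close> and \<open>Var\<close> are statements about finitely supported integer sequences, hence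
  about finitely many patterns by compactness, and no longer depend on the law of the process. So the likelihood
  over a long window of constant parameter is maximal near that parameter, and \<open>Sigma_hat\<close> is invertible and
  bounded. With \<open>l\<close> just after the change and \<open>k - l\<close> of order \<open>m\<close>, the two estimators in the detector differ by
  a constant, so the detector is of order \<open>sqrt m\<close> and exceeds the boundary.
\<close>

subsection \<open>Square roots of positive semidefinite matrices\<close>

text \<open>The law of the process varies with \<open>m\<close>, so a limit theorem along one
  trajectory would not suffice. Every threshold has to be chosen before \<open>M\<close> and
  \<open>Y\<close>, from \<open>\<Theta>\<close>, \<open>f\<close>, a moment bound \<open>B\<close>
  and an admissible failure probability \<open>\<delta>\<close> alone; the locale
  \<open>bounded_process\<close> isolates the class of processes over which this uniformity holds.
  The estimators see the past only from time 1 on, while the intensities depend on all of it; the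
  discrepancy is charged to tails of the Lipschitz coefficients. Finally, \<open>measure\<close> is
  0 on nonmeasurable sets, so the alarm event must be shown measurable. It involves
  \<open>matrix_inv_sqrt\<close>, which is built from description and choice operators, whence the
  theory of matrix square roots, including singular matrices.\<close>

lemma linear_term_zero:
  fixes p r :: real
  assumes "\<And>s. 0 \<le> 2 * s * p + s\<^sup>2 * r"
  shows "p = 0"
proof (rule ccontr)
  assume p: "p \<noteq> 0"
  \<comment> \<open>With \<open>r < k\<close>, the value at \<open>s = - p / k\<close> is
    \<open>(p^2 / k) * (r / k - 2)\<close>, negative unless \<open>p = 0\<close>; the absolute value
    covers either sign of \<open>r\<close>.\<close>
  define k where "k = \<bar>r\<bar> + 1"
  have k: "k > 0" "r < k" by (auto simp: k_def)
  have "0 \<le> 2 * (- p / k) * p + (- p / k)\<^sup>2 * r" by (rule assms)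
  also have "\<dots> = (p\<^sup>2 / k) * (r / k - 2)"
    using k by (simp add: field_simps power2_eq_square)
  finally have "0 \<le> r / k - 2"
    using p k by (simp add: zero_le_mult_iff zero_le_divide_iff)
  moreover have "r / k < 1" using k by simp
  ultimately show False by linarith
qed

text \<open>The equality case of Cauchy-Schwarz for a semidefinite form: expanding it at
  \<open>x + s *\<^sub>R y\<close> leaves no quadratic term in \<open>x\<close>, so the term linear
  in \<open>s\<close> must vanish. The restriction to \<open>V\<close> serves the search for
  eigenvectors in invariant subspaces.\<close>

lemma psd_form_zero:
  fixes F :: "'a::real_inner \<Rightarrow> 'a"
  assumes "linear F" and sym: "\<And>x y. x \<in> V \<Longrightarrow> y \<in> V \<Longrightarrow> F x \<bullet> y = x \<bullet> F y"
    and "subspace V" and nn: "\<And>x. x \<in> V \<Longrightarrow> 0 \<le> x \<bullet> F x"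
    and "x \<in> V" "y \<in> V" "x \<bullet> F x = 0"
  shows "F x \<bullet> y = 0"
proof (rule linear_term_zero)
  fix s :: real
  have "x + s *\<^sub>R y \<in> V" using assms by (simp add: subspace_add subspace_scale)
  from nn[OF this] have "0 \<le> (x + s *\<^sub>R y) \<bullet> F (x + s *\<^sub>R y)" .
  also have "\<dots> = 2 * s * (F x \<bullet> y) + s\<^sup>2 * (y \<bullet> F y)"
    using assms sym[of x y]
    by (simp add: linear_add linear_scale inner_add_left inner_add_right power2_eq_square inner_commute
        algebra_simps)
  finally show "0 \<le> 2 * s * (F x \<bullet> y) + s\<^sup>2 * (y \<bullet> F y)" .
qed

lemma symmetric_inner:
  fixes A :: "real^'n^'n"
  assumes "transpose A = A"
  shows "(A *v x) \<bullet> y = x \<bullet> (A *v y)"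
  using assms by (metis dot_lmul_matrix transpose_matrix_vector)

text \<open>A maximizer of the quadratic form on the unit sphere of \<open>V\<close> is an eigenvector.\<close>

lemma symmetric_eigenvector:
  fixes A :: "real^'n^'n"
  assumes sym: "transpose A = A" and V: "subspace V" "\<And>x. x \<in> V \<Longrightarrow> A *v x \<in> V" "dim V \<noteq> 0"
  obtains e \<mu> where "e \<in> V" "norm e = 1" "A *v e = \<mu> *\<^sub>R e"
proof -
  obtain w where w: "w \<in> V" "w \<noteq> 0"
    using V(3) by (metis dim_eq_0 subsetI singletonI insertCI)
  have "compact (V \<inter> sphere 0 1)"
    using V(1) by (simp add: closed_Int_compact closed_subspace)
  moreover have "(1 / norm w) *\<^sub>R w \<in> V \<inter> sphere 0 1"
    using w V(1) by (simp add: subspace_scale)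
  moreover have "continuous_on (V \<inter> sphere 0 1) (\<lambda>x. x \<bullet> (A *v x))"
    by (intro continuous_intros matrix_vector_mult_linear_continuous_on)
  ultimately obtain e where e: "e \<in> V \<inter> sphere 0 1"
    and max: "\<And>x. x \<in> V \<inter> sphere 0 1 \<Longrightarrow> x \<bullet> (A *v x) \<le> e \<bullet> (A *v e)"
    using continuous_attains_sup[of "V \<inter> sphere 0 1" "\<lambda>x. x \<bullet> (A *v x)"] by blast
  define \<mu> where "\<mu> = e \<bullet> (A *v e)"
  \<comment> \<open>Maximality of \<open>\<mu>\<close> makes \<open>F\<close> semidefinite on
    \<open>V\<close> with null vector \<open>e\<close>. So \<open>F e\<close> is orthogonal to
    \<open>V\<close>, and it lies in \<open>V\<close> by invariance.\<close>
  define F where "F x = \<mu> *\<^sub>R x - A *v x" for x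
  have ne: "norm e = 1" and eV: "e \<in> V" using e by auto
  have lin: "linear F"
    unfolding F_def by (rule linearI) (simp_all add: matrix_vector_right_distrib matrix_vector_mult_scaleR algebra_simps)
  have nn: "0 \<le> x \<bullet> F x" if "x \<in> V" for x
  proof (cases "x = 0")
    case False
    have "(1 / norm x) *\<^sub>R x \<in> V \<inter> sphere 0 1"
      using that False V(1) by (simp add: subspace_scale)
    from max[OF this] have "(x \<bullet> (A *v x)) / (norm x)\<^sup>2 \<le> \<mu>"
      by (simp add: \<mu>_def power2_eq_square matrix_vector_mult_scaleR)
    then show ?thesis using False
      by (simp add: F_def inner_diff_right field_simps dot_square_norm)
  qed (simp add: F_def)
  have FV: "F x \<in> V" if "x \<in> V" for x
    using that V by (simp add: F_def subspace_diff subspace_scale)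
  have symF: "F x \<bullet> y = x \<bullet> F y" for x y
    using symmetric_inner[OF sym, of x y] by (simp add: F_def inner_diff_left inner_diff_right)
  have "e \<bullet> F e = 0"
    using ne by (simp add: F_def \<mu>_def inner_diff_right dot_square_norm)
  then have "F e \<bullet> F e = 0"
    using psd_form_zero[OF lin symF V(1) nn eV FV[OF eV]] by simp
  then have "A *v e = \<mu> *\<^sub>R e" by (simp add: F_def)
  with eV ne show ?thesis by (rule that)
qed

text \<open>Induction on the dimension: by symmetry, the orthogonal complement within
  \<open>V\<close> of an eigenvector is again invariant.\<close>

lemma symmetric_eigenbasis_subspace:
  fixes A :: "real^'n^'n"
  assumes sym: "transpose A = A" and "subspace V" "\<And>x. x \<in> V \<Longrightarrow> A *v x \<in> V"
  shows "\<exists>E. finite E \<and> E \<subseteq> V \<and> V \<subseteq> span E \<and> pairwise orthogonal E \<and> (\<forall>e\<in>E. norm e = 1 \<and> (\<exists>\<mu>. A *v e = \<mu> *\<^sub>R e))"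
  using assms(2,3)
proof (induction "dim V" arbitrary: V rule: less_induct)
  case less
  show ?case
  proof (cases "dim V = 0")
    case True
    then show ?thesis by (intro exI[of _ "{}"]) auto
  next
    case False
    then obtain e \<mu> where e: "e \<in> V" "norm e = 1" "A *v e = \<mu> *\<^sub>R e"
      using symmetric_eigenvector[OF sym less.prems] by blast
    define W where "W = {y\<in>V. orthogonal e y}"
    have sW: "subspace W"
      using less.prems(1) unfolding W_def subspace_def by (auto simp: orthogonal_def inner_add_right)
    have "W = {y\<in>V. \<forall>x\<in>span {e}. orthogonal x y}"
      unfolding W_def by (auto simp: span_singleton orthogonal_def)
    then have "dim W + dim (span {e}) = dim V"
      using dim_subspace_orthogonal_to_vectors[of "span {e}" V] less.prems(1) e(1)
      by (simp add: span_minimal)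
    moreover have "dim (span {e}) = 1" using e(2) by (simp add: dim_singleton) (metis norm_zero zero_neq_one)
    ultimately have dW: "dim W < dim V" by simp
    have inv: "A *v x \<in> W" if "x \<in> W" for x
      using that less.prems(2)[of x] symmetric_inner[OF sym, of e x] e(3)
      by (simp add: W_def orthogonal_def)
    obtain E where E: "finite E" "E \<subseteq> W" "W \<subseteq> span E" "pairwise orthogonal E"
      "\<forall>e\<in>E. norm e = 1 \<and> (\<exists>\<mu>. A *v e = \<mu> *\<^sub>R e)"
      using less.hyps[OF dW sW inv] by blast
    have "V \<subseteq> span (insert e E)"
    proof
      fix x assume x: "x \<in> V"
      have "x - (e \<bullet> x) *\<^sub>R e \<in> W"
        using x e less.prems(1) by (simp add: W_def orthogonal_def subspace_diff subspace_scale
            inner_diff_right dot_square_norm)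
      then have "x - (e \<bullet> x) *\<^sub>R e \<in> span E" using E(3) by blast
      then show "x \<in> span (insert e E)"
        unfolding span_insert by blast
    qed
    moreover have "pairwise orthogonal (insert e E)"
      using E(2,4) by (auto simp: pairwise_insert W_def orthogonal_commute)
    ultimately show ?thesis
      using E e by (intro exI[of _ "insert e E"]) (auto simp: W_def)
  qed
qed

lemma symmetric_eigenbasis:
  fixes A :: "real^'n^'n"
  assumes "transpose A = A"
  obtains E :: "(real^'n) set" and \<mu> :: "real^'n \<Rightarrow> real"
  where "finite E" "pairwise orthogonal E" "\<And>e. e \<in> E \<Longrightarrow> norm e = 1"
    "\<And>e. e \<in> E \<Longrightarrow> A *v e = \<mu> e *\<^sub>R e" "\<And>x. (\<Sum>e\<in>E. (e \<bullet> x) *\<^sub>R e) = x"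
proof -
  obtain E where E: "finite E" "UNIV \<subseteq> span E" "pairwise orthogonal E"
    "\<forall>e\<in>E. norm e = 1 \<and> (\<exists>\<mu>. A *v e = \<mu> *\<^sub>R e)"
    using symmetric_eigenbasis_subspace[OF assms subspace_UNIV] by auto
  have "\<exists>\<mu>. \<forall>e\<in>E. A *v e = \<mu> e *\<^sub>R e"
    using E(4) by (intro bchoice) auto
  then obtain \<mu> where "\<forall>e\<in>E. A *v e = \<mu> e *\<^sub>R e" by auto
  moreover have "(\<Sum>e\<in>E. (e \<bullet> x) *\<^sub>R e) = x" for x
    using orthonormal_basis_expand[of E x] E by (auto simp: inner_commute)
  ultimately show ?thesis using that E by blast
qed

lemma pos_semidef_sqrt_exists:
  fixes A :: "real^'n^'n"
  assumes "pos_semidef A"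
  shows "\<exists>B. pos_semidef B \<and> B ** B = A"
proof -
  have sym: "transpose A = A" and nn: "\<And>x. 0 \<le> x \<bullet> (A *v x)"
    using assms by (auto simp: pos_semidef_def)
  obtain E \<mu> where E: "finite E" "pairwise orthogonal E" "\<And>e. e \<in> E \<Longrightarrow> norm e = 1"
    "\<And>e. e \<in> E \<Longrightarrow> A *v e = \<mu> e *\<^sub>R e" "\<And>x. (\<Sum>e\<in>E. (e \<bullet> x) *\<^sub>R e) = x"
    by (rule symmetric_eigenbasis[OF sym]) blast
  have \<mu>: "0 \<le> \<mu> e" if "e \<in> E" for e
    using nn[of e] E(3,4)[OF that] by (simp add: dot_square_norm)
  define S where "S x = (\<Sum>e\<in>E. (sqrt (\<mu> e) * (e \<bullet> x)) *\<^sub>R e)" for x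
  have lin: "linear S"
    unfolding S_def
    by (intro linear_compose_sum ballI linearI) (auto simp: inner_add_right algebra_simps)
  have symS: "S x \<bullet> y = x \<bullet> S y" for x y
    unfolding S_def by (simp add: inner_sum_left inner_sum_right inner_commute mult.commute mult.left_commute)
  have nnS: "0 \<le> x \<bullet> S x" for x
    unfolding S_def using \<mu>
    by (auto simp: inner_sum_right inner_commute mult.assoc power2_eq_square[symmetric] intro!: sum_nonneg)
  have inner_S: "e \<bullet> S x = sqrt (\<mu> e) * (e \<bullet> x)" if "e \<in> E" for e x
  proof -
    have "e \<bullet> S x = (\<Sum>e'\<in>E. if e' = e then sqrt (\<mu> e) * (e \<bullet> x) else 0)"
      unfolding S_def inner_sum_right
    proof (rule sum.cong[OF refl])
      fix e' assume "e' \<in> E"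
      then show "e \<bullet> (sqrt (\<mu> e') * (e' \<bullet> x)) *\<^sub>R e' = (if e' = e then sqrt (\<mu> e) * (e \<bullet> x) else 0)"
        using E(2,3) that by (auto simp: dot_square_norm pairwise_def orthogonal_def)
    qed
    then show ?thesis using that E(1) by simp
  qed
  have SS: "S (S x) = A *v x" for x
  proof -
    have "S (S x) = (\<Sum>e\<in>E. (\<mu> e * (e \<bullet> x)) *\<^sub>R e)"
      unfolding S_def[of "S x"] using inner_S \<mu> by (intro sum.cong) (auto simp: mult.assoc[symmetric])
    also have "\<dots> = (\<Sum>e\<in>E. (e \<bullet> x) *\<^sub>R (A *v e))"
      using E(4) by (intro sum.cong) (auto simp: mult.commute)
    also have "\<dots> = A *v (\<Sum>e\<in>E. (e \<bullet> x) *\<^sub>R e)"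
      by (simp add: linear_sum[OF matrix_vector_mul_linear] matrix_vector_mult_scaleR)
    finally show ?thesis by (simp add: E(5))
  qed
  have mS: "matrix S *v x = S x" for x
    using lin by (simp add: matrix_works)
  have "transpose (matrix S) = matrix S"
    using symS lin by (metis adjoint_unique matrix_adjoint)
  moreover have "matrix S ** matrix S = A"
    by (simp add: matrix_eq matrix_vector_mul_assoc[symmetric] mS SS)
  ultimately show ?thesis
    using nnS mS by (auto simp: pos_semidef_def)
qed

lemma pos_semidef_form_zero:
  assumes "pos_semidef B" "x \<bullet> (B *v x) = 0"
  shows "B *v x = 0"
proof -
  have "(B *v x) \<bullet> (B *v x) = 0"
    by (rule psd_form_zero[where V=UNIV])
      (use assms symmetric_inner[of B] in \<open>auto simp: pos_semidef_def\<close>)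
  then show ?thesis by simp
qed

text \<open>Makes visible that the trace is nonnegative when \<open>B\<close> is semidefinite, and
  that it vanishes only if every summand does.\<close>

lemma trace_conj_eq:
  fixes B D :: "real^'n^'n"
  assumes "transpose D = D"
  shows "trace (D ** B ** D) = (\<Sum>i\<in>UNIV. (D *v axis i 1) \<bullet> (B *v (D *v axis i 1)))"
proof -
  have "(D ** B ** D) $ i $ i = (D *v axis i 1) \<bullet> (B *v (D *v axis i 1))" for i
  proof -
    have "(D ** B ** D) $ i $ i = axis i 1 \<bullet> ((D ** B ** D) *v axis i 1)"
      by (simp add: inner_axis' matrix_vector_mul_component inner_axis)
    then show ?thesis
      using symmetric_inner[OF assms, of "axis i 1"] by (simp add: matrix_vector_mul_assoc[symmetric])
  qed
  then show ?thesis by (simp add: trace_def)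
qed

text \<open>For \<open>D = B - C\<close>, equality of the squares reads
  \<open>B ** D + D ** C = 0\<close>. Multiplication by \<open>D\<close> and the trace give two
  nonnegative quantities with sum 0, so \<open>B\<close> and \<open>C\<close> both vanish on the
  range of \<open>D\<close>. Then \<open>D ** D = 0\<close>, and \<open>D = 0\<close> by
  symmetry.\<close>

lemma pos_semidef_sqrt_unique:
  fixes B C :: "real^'n^'n"
  assumes B: "pos_semidef B" and C: "pos_semidef C" and eq: "B ** B = C ** C"
  shows "B = C"
proof -
  define D where "D = B - C"
  have symD: "transpose D = D"
    using B C by (simp add: D_def pos_semidef_def transpose_def vec_eq_iff)
  have "B ** D + D ** C = 0"
    using eq by (simp add: D_def matrix_eq matrix_vector_mult_add_rdistrib matrix_vector_mult_diff_rdistrib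
        matrix_vector_mult_diff_distrib flip: matrix_vector_mul_assoc)
  then have "D ** (B ** D) + D ** (D ** C) = 0"
    by (simp flip: matrix_add_ldistrib)
  then have "trace (D ** (B ** D)) + trace (D ** (D ** C)) = 0"
    by (simp flip: trace_add) (simp add: trace_def)
  then have "trace (D ** B ** D) = - trace (D ** C ** D)"
    using trace_mul_sym[of D "D ** C"] by (simp add: matrix_mul_assoc)
  then have "(\<Sum>i\<in>UNIV. (D *v axis i 1) \<bullet> (B *v (D *v axis i 1)) + (D *v axis i 1) \<bullet> (C *v (D *v axis i 1))) = 0"
    by (simp add: trace_conj_eq[OF symD] sum.distrib)
  moreover have nnB: "0 \<le> x \<bullet> (B *v x)" and nnC: "0 \<le> x \<bullet> (C *v x)" for x
    using B C by (auto simp: pos_semidef_def)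
  ultimately have z: "(D *v axis i 1) \<bullet> (B *v (D *v axis i 1)) + (D *v axis i 1) \<bullet> (C *v (D *v axis i 1)) = 0" for i
    by (subst (asm) sum_nonneg_eq_0_iff) (auto intro: add_nonneg_nonneg)
  have "D *v axis i 1 = 0" for i
  proof -
    let ?x = "D *v axis i 1"
    have "?x \<bullet> (B *v ?x) = 0" "?x \<bullet> (C *v ?x) = 0"
      using z[of i] nnB[of ?x] nnC[of ?x] by linarith+
    then have "B *v ?x = 0" "C *v ?x = 0"
      using pos_semidef_form_zero B C by blast+
    then have "D *v ?x = 0" by (simp add: D_def matrix_vector_mult_diff_rdistrib)
    then have "?x \<bullet> ?x = 0" using symmetric_inner[OF symD, of "axis i 1" ?x] by simp
    then show ?thesis by simp
  qed
  then have "D = 0"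
    by (simp add: vec_eq_iff matrix_vector_mul_component inner_axis)
  then show ?thesis by (simp add: D_def)
qed

lemma matrix_sqrt:
  assumes "pos_semidef A"
  shows "pos_semidef (matrix_sqrt A)" "matrix_sqrt A ** matrix_sqrt A = A"
proof -
  have "\<exists>!B. pos_semidef B \<and> B ** B = A"
    using pos_semidef_sqrt_exists[OF assms] pos_semidef_sqrt_unique by blast
  from theI'[OF this] show "pos_semidef (matrix_sqrt A)" "matrix_sqrt A ** matrix_sqrt A = A"
    unfolding matrix_sqrt_def by blast+
qed

section \<open>Inverses and inverse square roots, including their value at singular matrices\<close>

lemma matrix_inv_inverse:
  fixes A :: "real^'n^'n"
  assumes "invertible A"
  shows "A ** matrix_inv A = mat 1" "matrix_inv A ** A = mat 1"
  unfolding matrix_inv_def using someI_ex[OF assms[unfolded invertible_def]] by blast+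

lemma matrix_inv_eqI:
  fixes A X :: "real^'n^'n"
  assumes "A ** X = mat 1"
  shows "matrix_inv A = X"
proof -
  have XA: "X ** A = mat 1" using assms by (rule iffD1[OF matrix_left_right_inverse])
  have "invertible A" using assms XA unfolding invertible_def by blast
  then have "matrix_inv A ** A = mat 1" by (rule matrix_inv_inverse)
  then have "matrix_inv A ** (A ** X) = X" by (simp add: matrix_mul_assoc)
  then show ?thesis by (simp add: assms)
qed

text \<open>For singular \<open>A\<close> the predicate under the choice operator is identically
  false, so the default value is one constant, independent of \<open>A\<close>. Measurability on the
  singular matrices rests on this.\<close>

lemma matrix_inv_singular:
  fixes A :: "real^'n^'n"
  assumes "\<not> invertible A"
  shows "matrix_inv A = (SOME A'. False)"
proof -
  have "(\<lambda>A'. A ** A' = mat 1 \<and> A' ** A = mat 1) = (\<lambda>A'. False)"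
    using assms by (auto simp: invertible_def)
  then show ?thesis by (simp add: matrix_inv_def)
qed

lemma transpose_inverse:
  fixes B X :: "real^'n^'n"
  assumes "B ** X = mat 1" "transpose B = B"
  shows "transpose X = X"
proof -
  have "transpose X ** B = mat 1"
    using assms by (metis matrix_transpose_mul transpose_mat)
  then have "transpose X ** (B ** X) = X" by (simp add: matrix_mul_assoc)
  then show ?thesis by (simp add: assms)
qed

lemma pos_semidef_inverse:
  fixes B X :: "real^'n^'n"
  assumes BX: "B ** X = mat 1" and "pos_semidef B"
  shows "pos_semidef X"
proof -
  have "x \<bullet> (X *v x) = (X *v x) \<bullet> (B *v (X *v x))" for x
    by (simp add: matrix_vector_mul_assoc BX inner_commute)
  then show ?thesis
    using assms transpose_inverse[OF BX] by (auto simp: pos_semidef_def)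
qed

text \<open>By multiplicativity of the determinant, \<open>matrix_sqrt A\<close> is singular exactly
  when \<open>A\<close> is; the default value of \<open>matrix_inv\<close> is thus
  inherited.\<close>

lemma matrix_inv_sqrt_cases:
  fixes A :: "real^'n^'n"
  assumes A: "pos_semidef A"
  shows "(invertible A \<longrightarrow> pos_semidef (matrix_inv_sqrt A) \<and> matrix_inv_sqrt A ** matrix_inv_sqrt A ** A = mat 1
            \<and> matrix_sqrt A ** matrix_inv_sqrt A = mat 1)
    \<and> (\<not> invertible A \<longrightarrow> matrix_inv_sqrt A = (SOME A'. False))"
proof -
  let ?B = "matrix_sqrt A"
  have B: "pos_semidef ?B" "?B ** ?B = A" using matrix_sqrt[OF A] by auto
  have iff: "invertible ?B \<longleftrightarrow> invertible A"
    using B(2) by (metis det_mul invertible_det_nz mult_eq_0_iff)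
  show ?thesis
  proof (cases "invertible A")
    case True
    then have i: "invertible ?B" using iff by simp
    define X where "X = matrix_inv ?B"
    have X: "?B ** X = mat 1" "X ** ?B = mat 1"
      using matrix_inv_inverse[OF i] by (auto simp: X_def)
    have "X ** X ** A = X ** X ** (?B ** ?B)" by (simp only: B(2))
    also have "\<dots> = X ** (X ** ?B) ** ?B" by (simp only: matrix_mul_assoc)
    finally have "X ** X ** A = mat 1" by (simp add: X)
    then show ?thesis
      using True X pos_semidef_inverse[OF X(1) B(1)] by (auto simp: matrix_inv_sqrt_def X_def)
  next
    case False
    then show ?thesis using iff matrix_inv_singular[of ?B] by (auto simp: matrix_inv_sqrt_def)
  qed
qed

text \<open>Describes the power by closed conditions on the pair of \<open>A\<close> and
  \<open>X\<close>, a polynomial equation and semidefiniteness, free of description and choice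
  operators.\<close>

lemma matrix_inv_sqrt_eqI:
  fixes A X :: "real^'n^'n"
  assumes A: "pos_semidef A" and X: "pos_semidef X" "X ** X ** A = mat 1"
  shows "matrix_inv_sqrt A = X" "invertible A"
proof -
  have "A ** (X ** X) = mat 1" using X(2) by (rule iffD1[OF matrix_left_right_inverse])
  then show inv: "invertible A" using X(2) unfolding invertible_def by blast
  let ?Y = "matrix_inv_sqrt A"
  have Y: "pos_semidef ?Y" "?Y ** ?Y ** A = mat 1"
    using matrix_inv_sqrt_cases[OF A] inv by blast+
  have "X ** X = ?Y ** ?Y"
    using matrix_inv_eqI[OF iffD1[OF matrix_left_right_inverse X(2)]]
      matrix_inv_eqI[OF iffD1[OF matrix_left_right_inverse Y(2)]] by simp
  then show "?Y = X" using pos_semidef_sqrt_unique Y(1) X(1) by metis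
qed

text \<open>For \<open>z = matrix_inv_sqrt A *v x\<close> the squared norm of \<open>x\<close> is
  \<open>z \<bullet> (A *v z)\<close>, so an upper bound on the form of \<open>A\<close> bounds
  \<open>z\<close> from below. Definiteness enters only qualitatively, through
  invertibility.\<close>

lemma norm_matrix_inv_sqrt_ge:
  fixes A :: "real^'n^'n"
  assumes A: "pos_semidef A" and pd: "\<And>x. x \<noteq> 0 \<Longrightarrow> x \<bullet> (A *v x) \<noteq> 0"
    and K: "\<And>x. x \<bullet> (A *v x) \<le> K * (norm x)\<^sup>2"
  shows "(norm x)\<^sup>2 \<le> K * (norm (matrix_inv_sqrt A *v x))\<^sup>2"
proof -
  have "x = 0" if "A *v x = 0" for x using pd[of x] that by auto
  then have "invertible A"
    by (simp add: invertible_left_inverse matrix_left_invertible_ker)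
  let ?B = "matrix_sqrt A" and ?z = "matrix_inv_sqrt A *v x"
  have B: "pos_semidef ?B" "?B ** ?B = A" using matrix_sqrt[OF A] by auto
  have x: "x = ?B *v ?z"
    using matrix_inv_sqrt_cases[OF A] \<open>invertible A\<close>
    by (metis matrix_vector_mul_assoc matrix_vector_mul_lid)
  have "(norm x)\<^sup>2 = (?B *v ?z) \<bullet> (?B *v ?z)"
    by (simp flip: x add: dot_square_norm)
  also have "\<dots> = ?z \<bullet> (A *v ?z)"
    using B(1) symmetric_inner[of ?B ?z "?B *v ?z"]
    by (simp add: pos_semidef_def) (simp add: matrix_vector_mul_assoc matrix_mul_assoc B(2))
  also have "\<dots> \<le> K * (norm ?z)\<^sup>2" by (rule K)
  finally show ?thesis .
qed

section \<open>Borel measurability of the inverse square root\<close>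

lemma closed_pos_semidef: "closed {A :: real^'n^'n. pos_semidef A}"
proof -
  have "{A :: real^'n^'n. pos_semidef A} = {A. transpose A = A} \<inter> (\<Inter>x. {A. 0 \<le> x \<bullet> (A *v x)})"
    by (auto simp: pos_semidef_def)
  moreover have "closed {A :: real^'n^'n. transpose A = A}"
    unfolding transpose_def by (intro closed_Collect_eq continuous_intros)
  moreover have "closed {A :: real^'n^'n. 0 \<le> x \<bullet> (A *v x)}" for x
    unfolding matrix_vector_mult_def by (intro closed_Collect_le continuous_intros)
  ultimately show ?thesis by (simp add: closed_Int closed_INT)
qed

text \<open>A closed set is a countable union of compact sets, and projections of compact sets are
  compact.\<close>

lemma borel_fst_image_closed:
  fixes R :: "('a::euclidean_space \<times> 'b::euclidean_space) set"
  assumes "closed R"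
  shows "fst ` R \<in> sets borel"
proof -
  have "fst ` R = (\<Union>n::nat. fst ` (R \<inter> cball 0 (real n)))"
  proof (intro subset_antisym subsetI)
    fix x assume "x \<in> fst ` R"
    then obtain p where p: "p \<in> R" "x = fst p" by blast
    obtain n :: nat where "norm p \<le> real n" using real_arch_simple by blast
    with p have "x \<in> fst ` (R \<inter> cball 0 (real n))" by simp
    then show "x \<in> (\<Union>n::nat. fst ` (R \<inter> cball 0 (real n)))" by blast
  qed auto
  moreover have "fst ` (R \<inter> cball 0 (real n)) \<in> sets borel" for n
  proof (intro borel_closed compact_imp_closed)
    show "compact (fst ` (R \<inter> cball 0 (real n)))"
      using assms by (intro compact_continuous_image continuous_intros) (auto simp: closed_Int_compact)
  qed
  ultimately show ?thesis by auto
qed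

text \<open>On the closed set of positive semidefinite matrices, the graph of \<open>A\<close> to the power \<open>-1/2\<close> is closed, so that
  preimages of closed sets are projections of closed sets; singular matrices are all sent to the same junk value.\<close>

lemma matrix_inv_sqrt_measurable:
  "matrix_inv_sqrt \<in> borel_measurable (restrict_space borel {A :: real^'n^'n. pos_semidef A})"
proof (rule borel_measurableI)
  fix U :: "(real^'n^'n) set" assume "open U"
  define C where "C = - U"
  have C: "closed C" using \<open>open U\<close> by (simp add: C_def closed_def)
  define R where "R C = {(A, X). pos_semidef A \<and> pos_semidef X \<and> X \<in> C \<and> X ** X ** A = mat 1}"
    for C :: "(real^'n^'n) set"
  have cont: "continuous_on UNIV (\<lambda>p :: (real^'n^'n) \<times> (real^'n^'n). snd p ** snd p ** fst p)"
    unfolding matrix_matrix_mult_def by simp (intro continuous_intros)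
  have "closed (R C)" if "closed C" for C
  proof -
    have "R C = ({A. pos_semidef A} \<times> ({A. pos_semidef A} \<inter> C)) \<inter> {p. snd p ** snd p ** fst p = mat 1}"
      by (auto simp: R_def)
    moreover have "closed {p :: (real^'n^'n) \<times> (real^'n^'n). snd p ** snd p ** fst p = mat 1}"
      by (intro closed_Collect_eq cont continuous_intros)
    ultimately show ?thesis
      using that by (auto intro!: closed_Int closed_Times closed_pos_semidef)
  qed
  then have borel: "fst ` R C \<in> sets borel" if "closed C" for C
    using that by (auto intro: borel_fst_image_closed)
  have mem: "A \<in> fst ` R C \<longleftrightarrow> pos_semidef A \<and> invertible A \<and> matrix_inv_sqrt A \<in> C" for A C
  proof
    assume "A \<in> fst ` R C"
    then obtain X where "pos_semidef A" "pos_semidef X" "X \<in> C" "X ** X ** A = mat 1"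
      by (auto simp: R_def)
    then show "pos_semidef A \<and> invertible A \<and> matrix_inv_sqrt A \<in> C"
      using matrix_inv_sqrt_eqI by blast
  next
    assume "pos_semidef A \<and> invertible A \<and> matrix_inv_sqrt A \<in> C"
    then have "(A, matrix_inv_sqrt A) \<in> R C"
      using matrix_inv_sqrt_cases[of A] unfolding R_def by blast
    then show "A \<in> fst ` R C" by force
  qed
  let ?P = "{A :: real^'n^'n. pos_semidef A}"
  have "matrix_inv_sqrt -` C \<inter> ?P = fst ` R C \<union> (if (SOME A'. False) \<in> C then ?P - fst ` R UNIV else {})"
  proof (rule set_eqI)
    fix A :: "real^'n^'n"
    have "pos_semidef A \<Longrightarrow> \<not> invertible A \<Longrightarrow> matrix_inv_sqrt A = (SOME A'. False)"
      using matrix_inv_sqrt_cases by blast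
    then show "A \<in> matrix_inv_sqrt -` C \<inter> ?P \<longleftrightarrow>
        A \<in> fst ` R C \<union> (if (SOME A'. False) \<in> C then ?P - fst ` R UNIV else {})"
      by (cases "pos_semidef A"; cases "invertible A") (simp_all add: mem)
  qed
  moreover have "?P \<in> sets borel" by (rule borel_closed[OF closed_pos_semidef])
  ultimately have "matrix_inv_sqrt -` C \<inter> ?P \<in> sets borel"
    using borel[OF C] borel[OF closed_UNIV] by auto
  moreover have "matrix_inv_sqrt -` U \<inter> ?P = ?P - (matrix_inv_sqrt -` C \<inter> ?P)"
    by (auto simp: C_def)
  ultimately have "matrix_inv_sqrt -` U \<inter> ?P \<in> sets borel"
    using \<open>?P \<in> sets borel\<close> by auto
  then show "matrix_inv_sqrt -` U \<inter> space (restrict_space borel ?P) \<in> sets (restrict_space borel ?P)"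
    using \<open>?P \<in> sets borel\<close> by (simp add: space_restrict_space sets_restrict_space_iff)
qed

subsection \<open>Counting processes with conditional Poisson laws\<close>

lemma poisson_exp_sums:
  fixes r x :: real
  shows "(\<lambda>n. r ^ n / fact n * exp (- r) * x ^ n) sums exp (r * (x - 1))"
proof -
  have "(\<lambda>n. (r * x) ^ n /\<^sub>R fact n * exp (- r)) sums (exp (r * x) * exp (- r))"
    by (intro sums_mult2 exp_converges)
  moreover have "exp (r * x) * exp (- r) = exp (r * (x - 1))"
    by (simp add: right_diff_distrib flip: exp_add)
  ultimately show ?thesis
    by (simp add: power_mult_distrib divide_inverse mult_ac)
qed

lemma poisson_mean_sums:
  fixes r :: real
  shows "(\<lambda>n. r ^ n / fact n * exp (- r) * real n) sums r"
proof -
  let ?f = "\<lambda>n. r ^ n / fact n * exp (- r) * real n"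
  have "?f (Suc n) = r * (r ^ n / fact n * exp (- r) * 1 ^ n)" for n
    by (simp add: field_simps del: of_nat_Suc)
  then have "(\<lambda>n. ?f (Suc n)) sums (r * exp (r * (1 - 1)))"
    by (simp only: sums_mult poisson_exp_sums)
  then have "?f sums (r * exp (r * (1 - 1)) + ?f 0)" by (rule sums_Suc)
  then show ?thesis by simp
qed

lemma poisson_second_moment_sums:
  fixes r :: real
  shows "(\<lambda>n. r ^ n / fact n * exp (- r) * (real n)\<^sup>2) sums (r\<^sup>2 + r)"
proof -
  let ?f = "\<lambda>n. r ^ n / fact n * exp (- r) * (real n)\<^sup>2"
  have "?f (Suc n) = r * (r ^ n / fact n * exp (- r) * real n + r ^ n / fact n * exp (- r) * 1 ^ n)" for n
  proof -
    have "?f (Suc n) = r * (r ^ n / fact n * exp (- r) * real (Suc n))"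
      by (simp add: field_simps power2_eq_square del: of_nat_Suc)
    then show ?thesis by (simp add: algebra_simps add_divide_distrib)
  qed
  then have "(\<lambda>n. ?f (Suc n)) sums (r * (r + exp (r * (1 - 1))))"
    by (simp only: sums_mult sums_add poisson_exp_sums poisson_mean_sums)
  then have "?f sums (r * (r + exp (r * (1 - 1))) + ?f 0)" by (rule sums_Suc)
  then show ?thesis by (simp add: power2_eq_square algebra_simps)
qed

lemma suminf_poisson_pmf:
  assumes "0 < r" "(\<lambda>n. r ^ n / fact n * exp (- r) * g n) sums s" "\<And>n. 0 \<le> g n"
  shows "(\<Sum>n. ennreal (pmf (poisson_pmf r) n) * ennreal (g n)) = ennreal s"
proof -
  have "(\<Sum>n. ennreal (pmf (poisson_pmf r) n) * ennreal (g n))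
      = (\<Sum>n. ennreal (r ^ n / fact n * exp (- r) * g n))"
    using assms by (intro suminf_cong) (simp flip: ennreal_mult'')
  also have "\<dots> = ennreal s"
    using assms by (intro suminf_ennreal_eq) auto
  finally show ?thesis .
qed

text \<open>An exceptional event instead of the probability of \<open>P\<close> itself:
  \<open>P\<close> may then be nonmeasurable, as for statements about all \<open>x\<close> or about
  a maximizer, and conjunctions merely add the failure probabilities.\<close>

definition (in prob_space) whp :: "real \<Rightarrow> ('a \<Rightarrow> bool) \<Rightarrow> bool" where
  "whp \<delta> P \<longleftrightarrow> (\<exists>E\<in>events. prob E \<le> \<delta> \<and> (\<forall>\<omega>\<in>space M - E. P \<omega>))"

context prob_space
begin

lemma whp_mono:
  assumes "whp \<delta> P" "\<delta> \<le> \<delta>'" "\<And>\<omega>. \<omega> \<in> space M \<Longrightarrow> P \<omega> \<Longrightarrow> Q \<omega>"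
  shows "whp \<delta>' Q"
  using assms unfolding whp_def by (meson DiffD1 order_trans)

lemma whp_conj:
  assumes "whp \<delta> P" "whp \<delta>' Q"
  shows "whp (\<delta> + \<delta>') (\<lambda>\<omega>. P \<omega> \<and> Q \<omega>)"
proof -
  obtain E E' where E: "E \<in> events" "prob E \<le> \<delta>" "\<And>\<omega>. \<omega> \<in> space M - E \<Longrightarrow> P \<omega>"
    "E' \<in> events" "prob E' \<le> \<delta>'" "\<And>\<omega>. \<omega> \<in> space M - E' \<Longrightarrow> Q \<omega>"
    using assms unfolding whp_def by blast
  then have "prob (E \<union> E') \<le> \<delta> + \<delta>'"
    using measure_Un_le[of E M E'] by linarith
  with E show ?thesis unfolding whp_def by (intro bexI[of _ "E \<union> E'"]) auto
qed

lemma whp_ball: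
  assumes "finite I" "\<And>i. i \<in> I \<Longrightarrow> whp \<delta> (P i)"
  shows "whp (real (card I) * \<delta>) (\<lambda>\<omega>. \<forall>i\<in>I. P i \<omega>)"
  using assms
proof (induction I)
  case empty
  then show ?case unfolding whp_def by (intro bexI[of _ "{}"]) auto
next
  case (insert i I)
  then have "whp (\<delta> + real (card I) * \<delta>) (\<lambda>\<omega>. P i \<omega> \<and> (\<forall>i\<in>I. P i \<omega>))"
    by (intro whp_conj) auto
  with insert.hyps show ?case by (simp add: algebra_simps)
qed

lemma whp_markov:
  assumes [measurable]: "X \<in> borel_measurable M" and a: "(\<integral>\<^sup>+\<omega>. X \<omega> \<partial>M) \<le> ennreal a" "0 \<le> a" and K: "0 < K"
  shows "whp (a / K) (\<lambda>\<omega>. X \<omega> < ennreal K)"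
proof -
  let ?E = "{\<omega>\<in>space M. 1 \<le> ennreal (1 / K) * X \<omega>}"
  have "emeasure M ?E \<le> ennreal (1 / K) * (\<integral>\<^sup>+\<omega>. X \<omega> * indicator (space M) \<omega> \<partial>M)"
    by (rule nn_integral_Markov_inequality) auto
  also have "\<dots> \<le> ennreal (1 / K) * ennreal a"
    using a by (intro mult_left_mono) (auto cong: nn_integral_cong)
  finally have "prob ?E \<le> a / K"
    using a K by (simp add: emeasure_eq_measure ennreal_mult'[symmetric])
  moreover have "X \<omega> < ennreal K" if "\<omega> \<in> space M - ?E" for \<omega>
  proof (rule ccontr)
    assume "\<not> X \<omega> < ennreal K"
    then have "ennreal (1 / K) * ennreal K \<le> ennreal (1 / K) * X \<omega>" by (intro mult_left_mono) auto
    then show False using that K by (simp add: ennreal_mult'[symmetric])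
  qed
  ultimately show ?thesis unfolding whp_def by (intro bexI[of _ ?E]) auto
qed

end

section \<open>The filtration generated by a counting process\<close>

locale count_process = prob_space M
  for M :: "'w measure" and Y :: "int \<Rightarrow> 'w \<Rightarrow> nat" +
  assumes Y_measurable[measurable]: "\<And>t. Y t \<in> measurable M (count_space UNIV)"
begin

abbreviation F :: "int \<Rightarrow> 'w measure" where "F \<equiv> history M Y"

lemma space_history[simp]: "space (F t) = space M"
  unfolding history_def by (rule space_measure_of) auto

lemma sets_history: "sets (F t) = sigma_sets (space M) {Y s -` A \<inter> space M | s A. s \<le> t}"
  unfolding history_def by (rule sets_measure_of) auto

lemma sets_history_mono: "s \<le> t \<Longrightarrow> sets (F s) \<subseteq> sets (F t)"
  unfolding sets_history by (rule sigma_sets_mono') (blast intro: order_trans)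

lemma subalgebra_history: "subalgebra M (F t)"
proof -
  have "sets (F t) \<subseteq> sets M"
    unfolding sets_history by (rule sets.sigma_sets_subset) (auto intro: measurable_sets)
  then show ?thesis by (simp add: subalgebra_def)
qed

lemma history_measurable: "g \<in> measurable (F t) N \<Longrightarrow> g \<in> measurable M N"
  by (rule measurable_from_subalg[OF subalgebra_history])

lemma history_measurable_mono: "g \<in> measurable (F s) N \<Longrightarrow> s \<le> t \<Longrightarrow> g \<in> measurable (F t) N"
  using sets_history_mono[of s t] by (auto simp: measurable_def)

lemma Y_history: "s \<le> t \<Longrightarrow> Y s \<in> measurable (F t) (count_space UNIV)"
  by (rule measurableI) (auto simp: sets_history intro!: sigma_sets.Basic)

lemma measurable_at_Y:
  fixes \<xi> :: "'w \<Rightarrow> nat \<Rightarrow> real"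
  assumes "\<And>n. (\<lambda>\<omega>. \<xi> \<omega> n) \<in> borel_measurable (F (s - 1))" "s \<le> t"
  shows "(\<lambda>\<omega>. \<xi> \<omega> (Y s \<omega>)) \<in> borel_measurable (F t)"
proof (rule measurable_compose_countable)
  show "(\<lambda>\<omega>. \<xi> \<omega> n) \<in> borel_measurable (F t)" for n
    using assms(2) by (intro history_measurable_mono[OF assms(1)]) simp
  show "Y s \<in> measurable (F t) (count_space UNIV)"
    using assms by (intro Y_history)
qed

lemma past_measurable:
  "past Y t \<in> measurable (F (t - 1)) (restrict_space (\<Pi>\<^sub>M j\<in>UNIV. borel) nonneg_seqs)"
proof (rule measurable_restrict_space2)
  show "past Y t \<in> space (F (t - 1)) \<rightarrow> nonneg_seqs"
    by (auto simp: past_def nonneg_seqs_def)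
  have "(\<lambda>\<omega>. real (Y (t - 1 - int j) \<omega>)) \<in> borel_measurable (F (t - 1))" for j
    using Y_history[of "t - 1 - int j" "t - 1"] by simp
  then have "(\<lambda>\<omega> j. real (Y (t - 1 - int j) \<omega>)) \<in> measurable (F (t - 1)) (\<Pi>\<^sub>M j\<in>UNIV. borel)"
    by (intro measurable_PiM_single') auto
  then show "past Y t \<in> measurable (F (t - 1)) (\<Pi>\<^sub>M j\<in>UNIV. borel)"
    by (simp add: past_def[abs_def])
qed

lemma obs_past_measurable:
  "obs_past Y t \<in> measurable (F (t - 1)) (restrict_space (\<Pi>\<^sub>M j\<in>UNIV. borel) nonneg_seqs)"
proof (rule measurable_restrict_space2)
  show "obs_past Y t \<in> space (F (t - 1)) \<rightarrow> nonneg_seqs"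
    by (auto simp: obs_past_def nonneg_seqs_def)
  have "(\<lambda>\<omega>. if 1 \<le> t - 1 - int j then real (Y (t - 1 - int j) \<omega>) else 0) \<in> borel_measurable (F (t - 1))" for j
    using Y_history[of "t - 1 - int j" "t - 1"] by simp
  then have "(\<lambda>\<omega> j. if 1 \<le> t - 1 - int j then real (Y (t - 1 - int j) \<omega>) else 0)
      \<in> measurable (F (t - 1)) (\<Pi>\<^sub>M j\<in>UNIV. borel)"
    by (intro measurable_PiM_single') auto
  then show "obs_past Y t \<in> measurable (F (t - 1)) (\<Pi>\<^sub>M j\<in>UNIV. borel)"
    by (simp add: obs_past_def[abs_def])
qed

end

section \<open>Integration against the conditional Poisson law; exponential supermartingales\<close>

locale poisson_process = count_process M Y
  for M :: "'w measure" and Y :: "int \<Rightarrow> 'w \<Rightarrow> nat" +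
  fixes lam :: "int \<Rightarrow> 'w \<Rightarrow> real"
  assumes lam_measurable: "\<And>t. lam t \<in> borel_measurable (history M Y (t - 1))"
    and lam_pos: "\<And>t \<omega>. \<omega> \<in> space M \<Longrightarrow> 0 < lam t \<omega>"
    and poisson: "poisson_given_past M Y lam"
begin

text \<open>The hypothesis on the conditional law concerns \<open>real_cond_exp\<close>. Identifying
  it with \<open>nn_cond_exp\<close> admits arbitrary weights in \<open>ennreal\<close>, without any
  integrability.\<close>

lemma nn_integral_Y_eq:
  assumes [measurable]: "H \<in> borel_measurable (F (t - 1))"
  shows "(\<integral>\<^sup>+\<omega>. H \<omega> * indicator {\<omega>\<in>space M. Y t \<omega> = n} \<omega> \<partial>M)
    = (\<integral>\<^sup>+\<omega>. H \<omega> * ennreal (pmf (poisson_pmf (lam t \<omega>)) n) \<partial>M)"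
proof -
  let ?F = "F (t - 1)" and ?I = "indicator {\<omega>\<in>space M. Y t \<omega> = n} :: 'w \<Rightarrow> real"
  let ?p = "\<lambda>\<omega>. lam t \<omega> ^ n / fact n * exp (- lam t \<omega>)"
  interpret S: finite_measure_subalgebra M ?F
    by unfold_locales (rule subalgebra_history)
  have [measurable]: "H \<in> borel_measurable M" "lam t \<in> borel_measurable M"
    using assms lam_measurable history_measurable by blast+
  note lam_measurable[measurable]
  have pF[measurable]: "?p \<in> borel_measurable ?F" by measurable
  \<comment> \<open>The explicit formula stands in for \<open>pmf\<close> because its measurability
    is evident; the two agree since the rate is positive.\<close>
  have p_eq: "?p \<omega> = pmf (poisson_pmf (lam t \<omega>)) n" if "\<omega> \<in> space M" for \<omega>
    using lam_pos[OF that] by simp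
  have p_nn: "0 \<le> ?p \<omega>" "?p \<omega> \<le> 1" if "\<omega> \<in> space M" for \<omega>
    using p_eq[OF that] by (simp_all add: pmf_le_1)
  have iI: "integrable M ?I"
    by (intro integrable_real_indicator) (auto simp: less_top[symmetric] emeasure_eq_measure)
  have ip: "integrable M ?p"
  proof (rule integrable_const_bound[of _ 1])
    show "AE \<omega> in M. norm (?p \<omega>) \<le> 1"
      using p_nn by (intro AE_I2) (metis abs_of_nonneg real_norm_def)
  qed measurable
  have AE: "AE \<omega> in M. real_cond_exp M ?F ?I \<omega> = ?p \<omega>"
  proof (rule AE_mp)
    show "AE \<omega> in M. real_cond_exp M ?F ?I \<omega> = pmf (poisson_pmf (lam t \<omega>)) n"
      using poisson unfolding poisson_given_past_def by blast
    show "AE \<omega> in M. real_cond_exp M ?F ?I \<omega> = pmf (poisson_pmf (lam t \<omega>)) n \<longrightarrow>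
        real_cond_exp M ?F ?I \<omega> = ?p \<omega>"
      by (intro AE_I2 impI) (simp only: p_eq)
  qed
  have "AE \<omega> in M. ennreal (?p \<omega>) = nn_cond_exp M ?F (\<lambda>\<omega>. ennreal (?I \<omega>)) \<omega>"
  proof (rule S.nn_cond_exp_charact)
    fix A assume A: "A \<in> sets ?F"
    have [measurable]: "A \<in> sets M" using A subalgebra_history by (auto simp: subalgebra_def)
    have "(\<integral>\<omega>\<in>A. ?I \<omega> \<partial>M) = (\<integral>\<omega>\<in>A. real_cond_exp M ?F ?I \<omega> \<partial>M)"
      by (rule S.real_cond_exp_intA[OF iI A])
    also have "\<dots> = (\<integral>\<omega>\<in>A. ?p \<omega> \<partial>M)"
      unfolding set_lebesgue_integral_def using AE
      by (intro integral_cong_AE) auto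
    finally have eq: "(\<integral>\<omega>\<in>A. ?I \<omega> \<partial>M) = (\<integral>\<omega>\<in>A. ?p \<omega> \<partial>M)" .
    have "(\<integral>\<^sup>+\<omega>\<in>A. ennreal (?I \<omega>) \<partial>M) = (\<integral>\<^sup>+\<omega>. ennreal (indicator A \<omega> *\<^sub>R ?I \<omega>) \<partial>M)"
      by (intro nn_integral_cong) (auto simp: indicator_def)
    also have "\<dots> = ennreal (\<integral>\<omega>\<in>A. ?I \<omega> \<partial>M)"
      unfolding set_lebesgue_integral_def
      by (intro nn_integral_eq_integral integrable_mult_indicator iI) auto
    also have "\<dots> = ennreal (\<integral>\<omega>\<in>A. ?p \<omega> \<partial>M)" by (simp only: eq)
    also have "\<dots> = (\<integral>\<^sup>+\<omega>. ennreal (indicator A \<omega> *\<^sub>R ?p \<omega>) \<partial>M)"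
      unfolding set_lebesgue_integral_def using p_nn
      by (intro nn_integral_eq_integral[symmetric] integrable_mult_indicator ip) (auto simp: indicator_def)
    also have "\<dots> = (\<integral>\<^sup>+\<omega>\<in>A. ennreal (?p \<omega>) \<partial>M)"
      by (intro nn_integral_cong) (auto simp: indicator_def)
    finally show "(\<integral>\<^sup>+\<omega>\<in>A. ennreal (?I \<omega>) \<partial>M) = (\<integral>\<^sup>+\<omega>\<in>A. ennreal (?p \<omega>) \<partial>M)" .
  qed auto
  then have "(\<integral>\<^sup>+\<omega>. H \<omega> * ennreal (?p \<omega>) \<partial>M) = (\<integral>\<^sup>+\<omega>. H \<omega> * nn_cond_exp M ?F (\<lambda>\<omega>. ennreal (?I \<omega>)) \<omega> \<partial>M)"
    by (intro nn_integral_cong_AE) auto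
  also have "\<dots> = (\<integral>\<^sup>+\<omega>. H \<omega> * ennreal (?I \<omega>) \<partial>M)"
    by (rule S.nn_cond_exp_intg) auto
  finally show ?thesis
    using p_eq by (simp add: ennreal_indicator cong: nn_integral_cong)
qed

text \<open>Splitting according to the value of \<open>Y t\<close> integrates it out given the past.
  All conditional moments below are computed through this identity.\<close>

lemma nn_integral_kernel:
  fixes g :: "'w \<Rightarrow> nat \<Rightarrow> ennreal"
  assumes g: "\<And>n. (\<lambda>\<omega>. g \<omega> n) \<in> borel_measurable (F (t - 1))"
  shows "(\<integral>\<^sup>+\<omega>. g \<omega> (Y t \<omega>) \<partial>M)
    = (\<integral>\<^sup>+\<omega>. (\<Sum>n. ennreal (pmf (poisson_pmf (lam t \<omega>)) n) * g \<omega> n) \<partial>M)"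
proof -
  have [measurable]: "(\<lambda>\<omega>. g \<omega> n) \<in> borel_measurable M" "lam t \<in> borel_measurable M" for n
    using g lam_measurable history_measurable by blast+
  have p_eq: "pmf (poisson_pmf (lam t \<omega>)) n = lam t \<omega> ^ n / fact n * exp (- lam t \<omega>)" if "\<omega> \<in> space M" for \<omega> n
    using lam_pos[OF that] by simp
  have [measurable]: "(\<lambda>\<omega>. pmf (poisson_pmf (lam t \<omega>)) n) \<in> borel_measurable M" for n
    by (subst measurable_cong[OF p_eq]) auto
  have "(\<integral>\<^sup>+\<omega>. g \<omega> (Y t \<omega>) \<partial>M)
      = (\<integral>\<^sup>+\<omega>. (\<Sum>n. g \<omega> n * indicator {\<omega>\<in>space M. Y t \<omega> = n} \<omega>) \<partial>M)"
  proof (rule nn_integral_cong)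
    fix \<omega> assume w: "\<omega> \<in> space M"
    have "(\<Sum>n. g \<omega> n * indicator {\<omega>\<in>space M. Y t \<omega> = n} \<omega>) = (\<Sum>n\<in>{Y t \<omega>}. g \<omega> n * indicator {\<omega>\<in>space M. Y t \<omega> = n} \<omega>)"
      by (rule suminf_finite) (auto simp: indicator_def)
    then show "g \<omega> (Y t \<omega>) = (\<Sum>n. g \<omega> n * indicator {\<omega>\<in>space M. Y t \<omega> = n} \<omega>)"
      using w by simp
  qed
  also have "\<dots> = (\<Sum>n. \<integral>\<^sup>+\<omega>. g \<omega> n * indicator {\<omega>\<in>space M. Y t \<omega> = n} \<omega> \<partial>M)"
    by (rule nn_integral_suminf) measurable
  also have "\<dots> = (\<Sum>n. \<integral>\<^sup>+\<omega>. g \<omega> n * ennreal (pmf (poisson_pmf (lam t \<omega>)) n) \<partial>M)"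
    by (intro suminf_cong nn_integral_Y_eq g)
  also have "\<dots> = (\<integral>\<^sup>+\<omega>. (\<Sum>n. g \<omega> n * ennreal (pmf (poisson_pmf (lam t \<omega>)) n)) \<partial>M)"
    by (rule nn_integral_suminf[symmetric]) measurable
  finally show ?thesis by (simp add: mult.commute)
qed

lemma measurable_sum_at_Y:
  fixes \<xi> :: "int \<Rightarrow> 'w \<Rightarrow> nat \<Rightarrow> real"
  assumes "\<And>t n. t \<in> {a..b} \<Longrightarrow> (\<lambda>\<omega>. \<xi> t \<omega> n) \<in> borel_measurable (F (t - 1))"
  shows "(\<lambda>\<omega>. \<Sum>t\<in>{a..b}. \<xi> t \<omega> (Y t \<omega>)) \<in> borel_measurable (F b)"
proof (rule borel_measurable_sum)
  fix t assume "t \<in> {a..b}"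
  then show "(\<lambda>\<omega>. \<xi> t \<omega> (Y t \<omega>)) \<in> borel_measurable (F b)"
    using assms by (intro measurable_at_Y[where \<xi>="\<xi> t"]) auto
qed

text \<open>Integrating out the last observation removes a factor of conditional mean at most 1. The
  induction starts from the empty window, hence at \<open>a - 1\<close>.\<close>

lemma exp_supermartingale:
  fixes \<xi> :: "int \<Rightarrow> 'w \<Rightarrow> nat \<Rightarrow> real"
  assumes meas: "\<And>t n. t \<in> {a..b} \<Longrightarrow> (\<lambda>\<omega>. \<xi> t \<omega> n) \<in> borel_measurable (F (t - 1))"
    and le: "\<And>t \<omega>. t \<in> {a..b} \<Longrightarrow> \<omega> \<in> space M \<Longrightarrow>
        (\<Sum>n. ennreal (pmf (poisson_pmf (lam t \<omega>)) n) * ennreal (exp (\<xi> t \<omega> n))) \<le> 1"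
  shows "(\<integral>\<^sup>+\<omega>. ennreal (exp (\<Sum>t\<in>{a..b}. \<xi> t \<omega> (Y t \<omega>))) \<partial>M) \<le> 1"
proof (cases "a - 1 \<le> b")
  case True
  then show ?thesis
    using meas le
  proof (induction b rule: int_ge_induct)
    case base
    then show ?case by (simp add: emeasure_space_1)
  next
    case (step b)
    let ?s = "\<lambda>\<omega>. \<Sum>t\<in>{a..b}. \<xi> t \<omega> (Y t \<omega>)"
    have ins: "{a..b + 1} = insert (b + 1) {a..b}" using step.hyps by auto
    have [measurable]: "?s \<in> borel_measurable (F b)"
      by (rule measurable_sum_at_Y) (rule step.prems, auto)
    have [measurable]: "(\<lambda>\<omega>. \<xi> (b + 1) \<omega> n) \<in> borel_measurable (F b)" for n
      using step.prems(1)[of "b + 1" n] step.hyps by simp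
    have "(\<integral>\<^sup>+\<omega>. ennreal (exp (\<Sum>t\<in>{a..b + 1}. \<xi> t \<omega> (Y t \<omega>))) \<partial>M)
      = (\<integral>\<^sup>+\<omega>. ennreal (exp (?s \<omega>)) * ennreal (exp (\<xi> (b + 1) \<omega> (Y (b + 1) \<omega>))) \<partial>M)"
      by (intro nn_integral_cong) (simp add: ins exp_add ennreal_mult' mult.commute)
    also have "\<dots> = (\<integral>\<^sup>+\<omega>. (\<Sum>n. ennreal (pmf (poisson_pmf (lam (b + 1) \<omega>)) n) *
        (ennreal (exp (?s \<omega>)) * ennreal (exp (\<xi> (b + 1) \<omega> n)))) \<partial>M)"
      by (rule nn_integral_kernel) simp
    also have "\<dots> \<le> (\<integral>\<^sup>+\<omega>. ennreal (exp (?s \<omega>)) \<partial>M)"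
    proof (rule nn_integral_mono)
      fix \<omega> assume w: "\<omega> \<in> space M"
      have "(\<Sum>n. ennreal (pmf (poisson_pmf (lam (b + 1) \<omega>)) n) *
          (ennreal (exp (?s \<omega>)) * ennreal (exp (\<xi> (b + 1) \<omega> n))))
        = ennreal (exp (?s \<omega>)) * (\<Sum>n. ennreal (pmf (poisson_pmf (lam (b + 1) \<omega>)) n) * ennreal (exp (\<xi> (b + 1) \<omega> n)))"
        by (simp add: mult.left_commute flip: ennreal_suminf_cmult)
      also have "\<dots> \<le> ennreal (exp (?s \<omega>)) * 1"
        using step.hyps w by (intro mult_left_mono step.prems) auto
      finally show "(\<Sum>n. ennreal (pmf (poisson_pmf (lam (b + 1) \<omega>)) n) *
          (ennreal (exp (?s \<omega>)) * ennreal (exp (\<xi> (b + 1) \<omega> n)))) \<le> ennreal (exp (?s \<omega>))" by simp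
    qed
    also have "\<dots> \<le> 1"
      by (rule step.IH) (auto intro: step.prems)
    finally show ?case .
  qed
qed (simp add: emeasure_space_1)

text \<open>Markov's inequality at level \<open>exp z\<close>. With \<open>z\<close> proportional to
  the length of the window the failure probability becomes exponentially small.\<close>

lemma whp_exp_supermartingale:
  fixes \<xi> :: "int \<Rightarrow> 'w \<Rightarrow> nat \<Rightarrow> real"
  assumes meas: "\<And>t n. t \<in> {a..b} \<Longrightarrow> (\<lambda>\<omega>. \<xi> t \<omega> n) \<in> borel_measurable (F (t - 1))"
    and le: "\<And>t \<omega>. t \<in> {a..b} \<Longrightarrow> \<omega> \<in> space M \<Longrightarrow>
        (\<Sum>n. ennreal (pmf (poisson_pmf (lam t \<omega>)) n) * ennreal (exp (\<xi> t \<omega> n))) \<le> 1"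
  shows "whp (exp (- z)) (\<lambda>\<omega>. (\<Sum>t\<in>{a..b}. \<xi> t \<omega> (Y t \<omega>)) < z)"
proof -
  have "whp (1 / exp z) (\<lambda>\<omega>. ennreal (exp (\<Sum>t\<in>{a..b}. \<xi> t \<omega> (Y t \<omega>))) < ennreal (exp z))"
  proof (rule whp_markov)
    have "(\<lambda>\<omega>. \<Sum>t\<in>{a..b}. \<xi> t \<omega> (Y t \<omega>)) \<in> borel_measurable (F b)"
      by (rule measurable_sum_at_Y) (rule meas)
    then have [measurable]: "(\<lambda>\<omega>. \<Sum>t\<in>{a..b}. \<xi> t \<omega> (Y t \<omega>)) \<in> borel_measurable M"
      by (rule history_measurable)
    show "(\<lambda>\<omega>. ennreal (exp (\<Sum>t\<in>{a..b}. \<xi> t \<omega> (Y t \<omega>)))) \<in> borel_measurable M"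
      by measurable
    show "(\<integral>\<^sup>+\<omega>. ennreal (exp (\<Sum>t\<in>{a..b}. \<xi> t \<omega> (Y t \<omega>))) \<partial>M) \<le> ennreal 1"
      using exp_supermartingale[of a b \<xi>] meas le by simp
  qed auto
  then show ?thesis
    by (rule whp_mono) (auto simp: ennreal_less_iff exp_minus inverse_eq_divide)
qed

end

subsection \<open>Moment bounds\<close>

lemma norm1_real: "norm1 (x :: real) = \<bar>x\<bar>"
  by (simp add: norm1_def)

text \<open>The Huber function: the square up to \<open>K\<close>, continued by its tangent
  \<open>2 * K * x - K^2\<close>. It is convex like the square but grows linearly, so that its mean
  is finite as soon as the first moment is.\<close>

definition huber :: "real \<Rightarrow> real \<Rightarrow> real" where
  "huber K x = 2 * min x K * x - (min x K)\<^sup>2"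

text \<open>The Huber function dominates each of its tangents with contact point between 0 and
  \<open>K\<close>; this is the form in which convexity is used.\<close>

lemma huber_ge_tangent:
  assumes "0 \<le> a" "a \<le> K"
  shows "2 * a * x - a\<^sup>2 \<le> huber K x"
proof (cases "x \<le> K")
  case True
  have "0 \<le> (x - a)\<^sup>2" by simp
  with True show ?thesis by (simp add: huber_def power2_eq_square algebra_simps)
next
  case False
  have "0 \<le> (K - a) * ((x - K) + (x - a))"
    using False assms by (intro mult_nonneg_nonneg) auto
  with False show ?thesis by (simp add: huber_def power2_eq_square algebra_simps)
qed

lemma huber_nonneg: "0 \<le> K \<Longrightarrow> 0 \<le> huber K x"
  using huber_ge_tangent[of 0 K x] by simp

lemma huber_le_linear:
  assumes "0 \<le> K" "0 \<le> x"
  shows "huber K x \<le> 2 * K * x"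
proof -
  have "min x K * x \<le> K * x" using assms by (intro mult_right_mono) auto
  then show ?thesis
    using zero_le_power2[of "min x K"] unfolding huber_def by linarith
qed

lemma huber_eq: "x \<le> K \<Longrightarrow> huber K x = x\<^sup>2"
  by (simp add: huber_def power2_eq_square)

text \<open>The derivative of \<open>huber K\<close> is 2-Lipschitz, as is that of the square.\<close>

lemma huber_quadratic_bound:
  "huber K x \<le> huber K r + 2 * min r K * (x - r) + (x - r)\<^sup>2"
proof (cases "x \<le> K"; cases "r \<le> K")
  assume "x \<le> K" "\<not> r \<le> K"
  then have "(K - x) * (K - x) \<le> (r - x) * (r - x)" by (intro mult_mono) auto
  then show ?thesis using \<open>x \<le> K\<close> \<open>\<not> r \<le> K\<close> by (simp add: huber_def power2_eq_square algebra_simps)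
next
  assume "\<not> x \<le> K" "r \<le> K"
  have "0 \<le> (x - K)\<^sup>2" by simp
  then show ?thesis using \<open>\<not> x \<le> K\<close> \<open>r \<le> K\<close> by (simp add: huber_def power2_eq_square algebra_simps)
next
  assume "\<not> x \<le> K" "\<not> r \<le> K"
  have "0 \<le> (x - r)\<^sup>2" by simp
  then show ?thesis using \<open>\<not> x \<le> K\<close> \<open>\<not> r \<le> K\<close> by (simp add: huber_def power2_eq_square algebra_simps)
qed (simp add: huber_def power2_eq_square algebra_simps)

text \<open>Taking the mean in \<open>huber_quadratic_bound\<close> with \<open>r\<close> the
  Poisson mean kills the linear term, and the quadratic term becomes the variance
  \<open>r\<close>.\<close>

lemma suminf_poisson_huber:
  assumes r: "0 < r" and K: "0 \<le> K"
  shows "(\<Sum>n. ennreal (pmf (poisson_pmf r) n) * ennreal (huber K (real n))) \<le> ennreal (huber K r + r)"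
proof -
  let ?q = "\<lambda>n. huber K r + 2 * min r K * (real n - r) + (real n - r)\<^sup>2"
  let ?p = "\<lambda>n. r ^ n / fact n * exp (- r)"
  have alg: "(A - 2 * m * r + r\<^sup>2) * (p * 1 ^ n) + (2 * m - 2 * r) * (p * x) + p * x\<^sup>2
      = p * (A + 2 * m * (x - r) + (x - r)\<^sup>2)" for A m p x :: real and n :: nat
    by (simp add: algebra_simps power2_eq_square)
  have le: "huber K (real n) \<le> ?q n" for n by (rule huber_quadratic_bound)
  have nn: "0 \<le> ?q n" for n using le[of n] huber_nonneg[OF K, of "real n"] by linarith
  have "(\<lambda>n. (huber K r - 2 * min r K * r + r\<^sup>2) * (?p n * 1 ^ n) + (2 * min r K - 2 * r) * (?p n * real n)
      + ?p n * (real n)\<^sup>2) sums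
      ((huber K r - 2 * min r K * r + r\<^sup>2) * exp (r * (1 - 1)) + (2 * min r K - 2 * r) * r + (r\<^sup>2 + r))"
    by (intro sums_add sums_mult poisson_exp_sums poisson_mean_sums poisson_second_moment_sums)
  also have "(\<lambda>n. (huber K r - 2 * min r K * r + r\<^sup>2) * (?p n * 1 ^ n) + (2 * min r K - 2 * r) * (?p n * real n)
      + ?p n * (real n)\<^sup>2) = (\<lambda>n. ?p n * ?q n)"
    by (rule ext) (rule alg)
  also have "(huber K r - 2 * min r K * r + r\<^sup>2) * exp (r * (1 - 1)) + (2 * min r K - 2 * r) * r + (r\<^sup>2 + r)
      = huber K r + r"
    by (simp add: algebra_simps power2_eq_square)
  finally have "(\<Sum>n. ennreal (pmf (poisson_pmf r) n) * ennreal (?q n)) = ennreal (huber K r + r)"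
    using r nn by (intro suminf_poisson_pmf)
  moreover have "(\<Sum>n. ennreal (pmf (poisson_pmf r) n) * ennreal (huber K (real n)))
      \<le> (\<Sum>n. ennreal (pmf (poisson_pmf r) n) * ennreal (?q n))"
    by (intro suminf_le mult_left_mono ennreal_leI le) auto
  ultimately show ?thesis by simp
qed

lemma ennreal_suminf_eqI:
  fixes g :: "nat \<Rightarrow> real"
  assumes "(\<Sum>j. ennreal (g j)) < \<infinity>" "\<And>j. 0 \<le> g j"
  shows "summable g" "(\<Sum>j. ennreal (g j)) = ennreal (suminf g)"
proof -
  show "summable g" using assms by (intro summable_suminf_not_top) auto
  then show "(\<Sum>j. ennreal (g j)) = ennreal (suminf g)"
    using assms by (intro suminf_ennreal2)
qed

text \<open>Jensen's inequality with weights \<open>\<alpha> j\<close>, the missing mass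
  \<open>1 - suminf \<alpha>\<close> being placed at \<open>C / (1 - suminf \<alpha>)\<close>; this
  point contributes at most \<open>C^2 / (1 - suminf \<alpha>)\<close>.\<close>

lemma huber_weighted_sum:
  fixes \<alpha> y :: "nat \<Rightarrow> real"
  assumes \<alpha>: "\<And>j. 0 \<le> \<alpha> j" "summable \<alpha>" "suminf \<alpha> < 1" and y: "\<And>j. 0 \<le> y j" and K: "1 \<le> K"
    and x: "0 \<le> x" "0 \<le> C" "ennreal x \<le> ennreal C + (\<Sum>j. ennreal (\<alpha> j * y j))"
  shows "ennreal (huber K x) \<le> ennreal (C\<^sup>2 / (1 - suminf \<alpha>)) + (\<Sum>j. ennreal (\<alpha> j * huber K (y j)))"
proof (cases "(\<Sum>j. ennreal (\<alpha> j * huber K (y j))) < \<infinity>")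
  case True
  define \<kappa> where "\<kappa> = 1 - suminf \<alpha>"
  have \<kappa>: "\<kappa> > 0" using \<alpha> by (simp add: \<kappa>_def)
  have hn: "0 \<le> \<alpha> j * huber K (y j)" for j
    using \<alpha> K huber_nonneg[of K] by simp
  note sh = ennreal_suminf_eqI[OF True hn]
  have sy: "summable (\<lambda>j. \<alpha> j * y j)"
  proof (rule summable_comparison_test'[where N=0])
    show "summable (\<lambda>j. \<alpha> j * huber K (y j) + \<alpha> j)" by (intro summable_add sh \<alpha>)
    show "norm (\<alpha> j * y j) \<le> \<alpha> j * huber K (y j) + \<alpha> j" for j
    proof -
      have "2 * y j - 1 \<le> huber K (y j)" using huber_ge_tangent[of 1 K "y j"] K by simp
      then have "\<alpha> j * y j \<le> \<alpha> j * (huber K (y j) + 1)"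
        using \<alpha>(1)[of j] y[of j] by (intro mult_left_mono) linarith+
      then show ?thesis using \<alpha>(1)[of j] y[of j] by (simp add: algebra_simps)
    qed
  qed
  have S: "(\<Sum>j. ennreal (\<alpha> j * y j)) = ennreal (\<Sum>j. \<alpha> j * y j)"
    by (rule suminf_ennreal2) (simp_all add: \<alpha>(1) y sy)
  have nn: "0 \<le> (\<Sum>j. \<alpha> j * y j)"
    by (rule suminf_nonneg[OF sy]) (simp add: \<alpha>(1) y)
  have "ennreal x \<le> ennreal (C + (\<Sum>j. \<alpha> j * y j))"
    using x(3) unfolding S ennreal_plus[OF x(2) nn] .
  then have x': "x \<le> C + (\<Sum>j. \<alpha> j * y j)"
    by (subst (asm) ennreal_le_iff) (use nn x(2) in simp_all)
  \<comment> \<open>The tangent touching at \<open>x\<close>, for which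
    \<open>huber K x = 2 * a * x - a^2\<close>. The same tangent bounds every
    \<open>huber K (y j)\<close> from below, and the rest is completing a square.\<close>
  define a where "a = min x K"
  have a: "0 \<le> a" "a \<le> K" using x K by (auto simp: a_def)
  have "2 * a * (\<Sum>j. \<alpha> j * y j) - a\<^sup>2 * suminf \<alpha> = (\<Sum>j. 2 * a * (\<alpha> j * y j) - a\<^sup>2 * \<alpha> j)"
    by (subst suminf_diff[symmetric]) (simp_all add: suminf_mult summable_mult sy \<alpha>(2))
  also have "\<dots> \<le> (\<Sum>j. \<alpha> j * huber K (y j))"
  proof (intro suminf_le summable_diff summable_mult sy \<alpha> sh)
    fix j
    have "\<alpha> j * (2 * a * y j - a\<^sup>2) \<le> \<alpha> j * huber K (y j)"
      using \<alpha> by (intro mult_left_mono huber_ge_tangent a) auto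
    then show "2 * a * (\<alpha> j * y j) - a\<^sup>2 * \<alpha> j \<le> \<alpha> j * huber K (y j)"
      by (simp add: algebra_simps)
  qed
  finally have 1: "2 * a * (\<Sum>j. \<alpha> j * y j) - a\<^sup>2 * suminf \<alpha> \<le> (\<Sum>j. \<alpha> j * huber K (y j))" .
  have "0 \<le> (C - \<kappa> * a)\<^sup>2 / \<kappa>" using \<kappa> by simp
  also have "\<dots> = C\<^sup>2 / \<kappa> - (2 * a * C - \<kappa> * a\<^sup>2)"
    using \<kappa> by (simp add: field_simps power2_eq_square)
  finally have 2: "2 * a * C - \<kappa> * a\<^sup>2 \<le> C\<^sup>2 / \<kappa>" by simp
  have "huber K x = 2 * a * x - a\<^sup>2" by (simp add: huber_def a_def)
  also have "\<dots> \<le> 2 * a * (C + (\<Sum>j. \<alpha> j * y j)) - a\<^sup>2"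
    using x' a by (intro diff_right_mono mult_left_mono) auto
  also have "\<dots> \<le> C\<^sup>2 / \<kappa> + (\<Sum>j. \<alpha> j * huber K (y j))"
    using 1 2 by (simp add: \<kappa>_def algebra_simps)
  finally show ?thesis
    using sh \<kappa> suminf_nonneg[OF sh(1) hn] by (simp add: \<kappa>_def flip: ennreal_plus)
qed (simp add: not_less top_unique)

text \<open>Finiteness permits the subtraction: for \<open>\<rho> > 0\<close> the value infinity
  satisfies the same inequality. This is why second moments are approached through truncations with
  finite mean.\<close>

lemma ennreal_affine_bound:
  fixes s :: ennreal
  assumes "s \<le> ennreal a + ennreal \<rho> * s" "s < \<infinity>" "0 \<le> a" "0 \<le> \<rho>" "\<rho> < 1"
  shows "s \<le> ennreal (a / (1 - \<rho>))"
proof -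
  obtain r where r: "s = ennreal r" "0 \<le> r" using assms(2) by (cases s) auto
  have "0 \<le> a + \<rho> * r" using assms r by simp
  with assms r have "r \<le> a + \<rho> * r"
    by (simp flip: ennreal_plus ennreal_mult'')
  then have "r \<le> a / (1 - \<rho>)" using assms by (simp add: field_simps)
  then show ?thesis using r by (simp add: ennreal_leI)
qed

section \<open>Moments of a process with Lipschitz intensity\<close>

locale intensity =
  fixes \<Theta> :: "(real^'d) set" and f :: "real^'d \<Rightarrow> (nat \<Rightarrow> real) \<Rightarrow> real"
    and \<alpha> :: "nat \<Rightarrow> real" and c C :: real
  assumes compact_params: "compact \<Theta>"
    and f_measurable: "\<And>\<theta>. \<theta> \<in> \<Theta> \<Longrightarrow> f \<theta> \<in> borel_measurable (restrict_space (\<Pi>\<^sub>M j\<in>UNIV. borel) nonneg_seqs)"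
    and f_continuous: "\<And>y. y \<in> nonneg_seqs \<Longrightarrow> continuous_on \<Theta> (\<lambda>\<theta>. f \<theta> y)"
    and c_pos: "0 < c" and f_ge: "\<And>\<theta> y. \<theta> \<in> \<Theta> \<Longrightarrow> y \<in> nonneg_seqs \<Longrightarrow> c \<le> f \<theta> y"
    and C_nonneg: "0 \<le> C" and f_zero_le: "\<And>\<theta>. \<theta> \<in> \<Theta> \<Longrightarrow> f \<theta> (\<lambda>_. 0) \<le> C"
    and f_lipschitz: "\<And>\<theta> y y'. \<theta> \<in> \<Theta> \<Longrightarrow> y \<in> nonneg_seqs \<Longrightarrow> y' \<in> nonneg_seqs \<Longrightarrow>
      ennreal \<bar>f \<theta> y - f \<theta> y'\<bar> \<le> (\<Sum>j. ennreal (\<alpha> j * \<bar>y j - y' j\<bar>))"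
    and \<alpha>_nonneg: "\<And>j. 0 \<le> \<alpha> j" and \<alpha>_summable: "summable \<alpha>" and \<alpha>_less_1: "suminf \<alpha> < 1"
begin

lemma f_pos: "\<theta> \<in> \<Theta> \<Longrightarrow> y \<in> nonneg_seqs \<Longrightarrow> 0 < f \<theta> y"
  using f_ge c_pos by fastforce

lemma f_le:
  assumes "\<theta> \<in> \<Theta>" "y \<in> nonneg_seqs"
  shows "ennreal (f \<theta> y) \<le> ennreal C + (\<Sum>j. ennreal (\<alpha> j * y j))"
proof -
  have z: "(\<lambda>_. 0) \<in> nonneg_seqs" by (simp add: nonneg_seqs_def)
  have "f \<theta> y \<le> C + \<bar>f \<theta> y - f \<theta> (\<lambda>_. 0)\<bar>" using f_zero_le[OF assms(1)] by linarith
  then have "ennreal (f \<theta> y) \<le> ennreal C + ennreal \<bar>f \<theta> y - f \<theta> (\<lambda>_. 0)\<bar>"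
    using C_nonneg by (simp flip: ennreal_plus add: ennreal_leI)
  also have "\<dots> \<le> ennreal C + (\<Sum>j. ennreal (\<alpha> j * \<bar>y j - 0\<bar>))"
    by (intro add_left_mono f_lipschitz assms z)
  also have "(\<lambda>j. ennreal (\<alpha> j * \<bar>y j - 0\<bar>)) = (\<lambda>j. ennreal (\<alpha> j * y j))"
    using assms(2) by (auto simp: nonneg_seqs_def)
  finally show ?thesis .
qed

lemma suminf_\<alpha>_nonneg: "0 \<le> suminf \<alpha>"
  by (rule suminf_nonneg[OF \<alpha>_summable \<alpha>_nonneg])

end

lemma past_nonneg[simp]: "past Y t \<omega> \<in> nonneg_seqs"
  by (simp add: past_def nonneg_seqs_def)

lemma obs_past_nonneg[simp]: "obs_past Y t \<omega> \<in> nonneg_seqs"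
  by (simp add: obs_past_def nonneg_seqs_def)

text \<open>The parameter may vary with time in an arbitrary deterministic way; a change-point model
  is the case of a step function \<open>th\<close>, so times before and after the change need no
  separate treatment.\<close>

locale intensity_process = intensity \<Theta> f \<alpha> c C + count_process M Y
  for \<Theta> :: "(real^'d) set" and f \<alpha> c C and M :: "'w measure" and Y +
  fixes th :: "int \<Rightarrow> real^'d"
  assumes th: "\<And>t. th t \<in> \<Theta>"
    and poisson_th: "poisson_given_past M Y (\<lambda>t \<omega>. f (th t) (past Y t \<omega>))"
begin

lemma f_past_measurable:
  assumes "\<theta> \<in> \<Theta>"
  shows "(\<lambda>\<omega>. f \<theta> (past Y t \<omega>)) \<in> borel_measurable (F (t - 1))"
    and "(\<lambda>\<omega>. f \<theta> (obs_past Y t \<omega>)) \<in> borel_measurable (F (t - 1))"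
  using measurable_compose[OF past_measurable f_measurable[OF assms]]
    measurable_compose[OF obs_past_measurable f_measurable[OF assms]] by auto

sublocale poisson_process M Y "\<lambda>t \<omega>. f (th t) (past Y t \<omega>)"
  by unfold_locales (auto intro: f_past_measurable th poisson_th f_pos)

abbreviation lam :: "int \<Rightarrow> 'w \<Rightarrow> real" where "lam t \<omega> \<equiv> f (th t) (past Y t \<omega>)"

lemma lam_le: "ennreal (lam t \<omega>) \<le> ennreal C + (\<Sum>j. ennreal (\<alpha> j * real (Y (t - 1 - int j) \<omega>)))"
  using f_le[OF th past_nonneg, of t Y t \<omega>] by (simp add: past_def)

lemma lam_measurable_M[measurable]: "lam t \<in> borel_measurable M"
  by (rule history_measurable[OF lam_measurable])

lemma mean_eq: "(\<integral>\<^sup>+\<omega>. ennreal (real (Y t \<omega>)) \<partial>M) = (\<integral>\<^sup>+\<omega>. ennreal (lam t \<omega>) \<partial>M)"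
proof -
  have "(\<integral>\<^sup>+\<omega>. ennreal (real (Y t \<omega>)) \<partial>M)
      = (\<integral>\<^sup>+\<omega>. (\<Sum>n. ennreal (pmf (poisson_pmf (lam t \<omega>)) n) * ennreal (real n)) \<partial>M)"
    by (rule nn_integral_kernel) simp
  also have "\<dots> = (\<integral>\<^sup>+\<omega>. ennreal (lam t \<omega>) \<partial>M)"
    by (intro nn_integral_cong suminf_poisson_pmf lam_pos poisson_mean_sums) auto
  finally show ?thesis .
qed

lemma nn_integral_weighted_past:
  fixes \<beta> :: "nat \<Rightarrow> real" and g :: "nat \<Rightarrow> real"
  assumes \<beta>: "\<And>j. 0 \<le> \<beta> j"
  shows "(\<integral>\<^sup>+\<omega>. (\<Sum>j. ennreal (\<beta> j * g (Y (t - 1 - int j) \<omega>))) \<partial>M)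
    = (\<Sum>j. ennreal (\<beta> j) * (\<integral>\<^sup>+\<omega>. ennreal (g (Y (t - 1 - int j) \<omega>)) \<partial>M))"
proof -
  have "(\<integral>\<^sup>+\<omega>. (\<Sum>j. ennreal (\<beta> j * g (Y (t - 1 - int j) \<omega>))) \<partial>M)
    = (\<Sum>j. (\<integral>\<^sup>+\<omega>. ennreal (\<beta> j * g (Y (t - 1 - int j) \<omega>)) \<partial>M))"
    by (rule nn_integral_suminf) measurable
  also have "\<dots> = (\<Sum>j. ennreal (\<beta> j) * (\<integral>\<^sup>+\<omega>. ennreal (g (Y (t - 1 - int j) \<omega>)) \<partial>M))"
    using \<beta> by (intro suminf_cong) (simp add: ennreal_mult' nn_integral_cmult)
  finally show ?thesis .
qed

lemma nn_integral_weighted_past_le: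
  fixes \<beta> :: "nat \<Rightarrow> real" and g :: "nat \<Rightarrow> real" and s :: ennreal
  assumes \<beta>: "\<And>j. 0 \<le> \<beta> j" "summable \<beta>"
    and s: "\<And>u. u < t \<Longrightarrow> (\<integral>\<^sup>+\<omega>. ennreal (g (Y u \<omega>)) \<partial>M) \<le> s"
  shows "(\<integral>\<^sup>+\<omega>. (\<Sum>j. ennreal (\<beta> j * g (Y (t - 1 - int j) \<omega>))) \<partial>M) \<le> ennreal (suminf \<beta>) * s"
proof -
  have "(\<integral>\<^sup>+\<omega>. (\<Sum>j. ennreal (\<beta> j * g (Y (t - 1 - int j) \<omega>))) \<partial>M) \<le> (\<Sum>j. ennreal (\<beta> j) * s)"
    unfolding nn_integral_weighted_past[OF \<beta>(1), where g=g]
    by (intro suminf_le mult_left_mono s) auto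
  also have "\<dots> = ennreal (suminf \<beta>) * s"
    using \<beta> by (simp add: suminf_ennreal2)
  finally show ?thesis .
qed

lemma mean_le:
  assumes "\<And>u. u < t \<Longrightarrow> (\<integral>\<^sup>+\<omega>. ennreal (real (Y u \<omega>)) \<partial>M) \<le> s"
  shows "(\<integral>\<^sup>+\<omega>. ennreal (real (Y t \<omega>)) \<partial>M) \<le> ennreal C + ennreal (suminf \<alpha>) * s"
proof -
  have "(\<integral>\<^sup>+\<omega>. ennreal (real (Y t \<omega>)) \<partial>M)
      \<le> (\<integral>\<^sup>+\<omega>. ennreal C + (\<Sum>j. ennreal (\<alpha> j * real (Y (t - 1 - int j) \<omega>))) \<partial>M)"
    unfolding mean_eq by (intro nn_integral_mono lam_le)
  also have "\<dots> = ennreal C + (\<integral>\<^sup>+\<omega>. (\<Sum>j. ennreal (\<alpha> j * real (Y (t - 1 - int j) \<omega>))) \<partial>M)"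
    by (subst nn_integral_add) (auto simp: emeasure_space_1)
  also have "\<dots> \<le> ennreal C + ennreal (suminf \<alpha>) * s"
    by (intro add_left_mono nn_integral_weighted_past_le \<alpha>_nonneg \<alpha>_summable assms)
  finally show ?thesis .
qed

text \<open>Before the change the mean is a constant \<open>\<mu>\<close> with \<open>\<mu> \<le> C + \<rho> \<mu>\<close>, where \<open>\<rho>\<close> is the sum of \<open>\<alpha>\<close>; the bound
  \<open>C / (1 - \<rho>)\<close> then propagates.\<close>

lemma mean_bounded:
  assumes fin: "(\<integral>\<^sup>+\<omega>. ennreal (real (Y k \<omega>)) \<partial>M) < \<infinity>"
    and const: "\<And>u. u \<le> k \<Longrightarrow> (\<integral>\<^sup>+\<omega>. ennreal (real (Y u \<omega>)) \<partial>M) = (\<integral>\<^sup>+\<omega>. ennreal (real (Y k \<omega>)) \<partial>M)"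
  shows "(\<integral>\<^sup>+\<omega>. ennreal (real (Y t \<omega>)) \<partial>M) \<le> ennreal (C / (1 - suminf \<alpha>))"
proof -
  let ?m = "\<lambda>u. \<integral>\<^sup>+\<omega>. ennreal (real (Y u \<omega>)) \<partial>M" and ?B = "C / (1 - suminf \<alpha>)"
  have "?m k \<le> ennreal C + ennreal (suminf \<alpha>) * ?m k"
    by (rule mean_le, rule eq_refl, rule const) simp
  then have "?m k \<le> ennreal ?B"
    using fin C_nonneg suminf_\<alpha>_nonneg \<alpha>_less_1 by (rule ennreal_affine_bound)
  then have pre: "?m u \<le> ennreal ?B" if "u \<le> k" for u
    unfolding const[OF that] .
  have "\<forall>u\<le>t. ?m u \<le> ennreal ?B" if "k \<le> t" for t
    using that
  proof (induction t rule: int_ge_induct)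
    case base
    then show ?case using pre by auto
  next
    case (step t)
    have "?m (t + 1) \<le> ennreal C + ennreal (suminf \<alpha>) * ennreal ?B"
      by (rule mean_le) (use step in auto)
    also have "\<dots> = ennreal ?B"
      using C_nonneg suminf_\<alpha>_nonneg \<alpha>_less_1
      by (simp flip: ennreal_plus ennreal_mult'' add: field_simps)
    finally show ?case using step.IH by (metis zle_add1_eq_le order_le_less)
  qed
  from this[of "max k t"] show ?thesis by auto
qed

text \<open>The truncated second moments are finite because the mean is, and satisfy an affine inequality with
  factor \<open>suminf \<alpha> < 1\<close> that does not depend on the truncation level.\<close>

lemma second_moment_bounded:
  assumes mean: "\<And>t. (\<integral>\<^sup>+\<omega>. ennreal (real (Y t \<omega>)) \<partial>M) \<le> ennreal B" and B: "0 \<le> B"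
  shows "(\<integral>\<^sup>+\<omega>. ennreal ((real (Y t \<omega>))\<^sup>2) \<partial>M) \<le> ennreal ((C\<^sup>2 / (1 - suminf \<alpha>) + B) / (1 - suminf \<alpha>))"
proof -
  let ?B2 = "(C\<^sup>2 / (1 - suminf \<alpha>) + B) / (1 - suminf \<alpha>)"
  have trunc: "(\<integral>\<^sup>+\<omega>. ennreal (huber K (real (Y t \<omega>))) \<partial>M) \<le> ennreal ?B2" if K: "1 \<le> K" for K t
  proof -
    let ?h = "\<lambda>t. \<integral>\<^sup>+\<omega>. ennreal (huber K (real (Y t \<omega>))) \<partial>M"
    define s where "s = (SUP t. ?h t)"
    have hs: "?h t \<le> s" for t unfolding s_def by (rule SUP_upper) auto
    have [measurable]: "huber K \<in> borel_measurable borel" unfolding huber_def[abs_def] by measurable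
    have "?h t \<le> ennreal (2 * K) * ennreal B" for t
    proof -
      have "?h t \<le> (\<integral>\<^sup>+\<omega>. ennreal (2 * K) * ennreal (real (Y t \<omega>)) \<partial>M)"
        using K by (intro nn_integral_mono) (simp flip: ennreal_mult'' add: ennreal_leI huber_le_linear)
      also have "\<dots> = ennreal (2 * K) * (\<integral>\<^sup>+\<omega>. ennreal (real (Y t \<omega>)) \<partial>M)"
        by (rule nn_integral_cmult) measurable
      also have "\<dots> \<le> ennreal (2 * K) * ennreal B" by (intro mult_left_mono mean) auto
      finally show ?thesis .
    qed
    then have "s \<le> ennreal (2 * K) * ennreal B" unfolding s_def by (intro SUP_least)
    then have fin: "s < \<infinity>"
      by (metis ennreal_less_top ennreal_mult_less_top infinity_ennreal_def order_le_less_trans)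
    have "?h t \<le> ennreal (C\<^sup>2 / (1 - suminf \<alpha>) + B) + ennreal (suminf \<alpha>) * s" for t
    proof -
      have "?h t = (\<integral>\<^sup>+\<omega>. (\<Sum>n. ennreal (pmf (poisson_pmf (lam t \<omega>)) n) * ennreal (huber K (real n))) \<partial>M)"
        by (rule nn_integral_kernel) simp
      also have "\<dots> \<le> (\<integral>\<^sup>+\<omega>. ennreal (huber K (lam t \<omega>)) + ennreal (lam t \<omega>) \<partial>M)"
      proof (rule nn_integral_mono)
        fix \<omega> assume "\<omega> \<in> space M"
        then have "0 < lam t \<omega>" by (rule lam_pos)
        then show "(\<Sum>n. ennreal (pmf (poisson_pmf (lam t \<omega>)) n) * ennreal (huber K (real n)))
            \<le> ennreal (huber K (lam t \<omega>)) + ennreal (lam t \<omega>)"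
          using suminf_poisson_huber[of "lam t \<omega>" K] K huber_nonneg[of K] by (simp flip: ennreal_plus)
      qed
      also have "\<dots> = (\<integral>\<^sup>+\<omega>. ennreal (huber K (lam t \<omega>)) \<partial>M) + (\<integral>\<^sup>+\<omega>. ennreal (lam t \<omega>) \<partial>M)"
        by (rule nn_integral_add) measurable
      also have "\<dots> \<le> (\<integral>\<^sup>+\<omega>. ennreal (C\<^sup>2 / (1 - suminf \<alpha>)) +
          (\<Sum>j. ennreal (\<alpha> j * huber K (real (Y (t - 1 - int j) \<omega>)))) \<partial>M) + ennreal B"
        using mean[of t] unfolding mean_eq
        by (intro add_mono nn_integral_mono huber_weighted_sum \<alpha>_nonneg \<alpha>_summable \<alpha>_less_1 K C_nonneg lam_le
            less_imp_le[OF lam_pos]) auto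
      also have "\<dots> = ennreal (C\<^sup>2 / (1 - suminf \<alpha>)) +
          (\<integral>\<^sup>+\<omega>. (\<Sum>j. ennreal (\<alpha> j * huber K (real (Y (t - 1 - int j) \<omega>)))) \<partial>M) + ennreal B"
        by (subst nn_integral_add) (auto simp: emeasure_space_1)
      also have "\<dots> \<le> ennreal (C\<^sup>2 / (1 - suminf \<alpha>)) + ennreal (suminf \<alpha>) * s + ennreal B"
        using hs by (intro add_mono order_refl nn_integral_weighted_past_le[where g="\<lambda>n. huber K (real n)"]
            \<alpha>_nonneg \<alpha>_summable)
      also have "\<dots> = ennreal (C\<^sup>2 / (1 - suminf \<alpha>) + B) + ennreal (suminf \<alpha>) * s"
        using B \<alpha>_less_1 by (simp add: ennreal_plus add_ac)
      finally show ?thesis .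
    qed
    then have "s \<le> ennreal (C\<^sup>2 / (1 - suminf \<alpha>) + B) + ennreal (suminf \<alpha>) * s"
      unfolding s_def by (intro SUP_least) (simp add: s_def[symmetric])
    then have "s \<le> ennreal ?B2"
      using fin B suminf_\<alpha>_nonneg \<alpha>_less_1 by (intro ennreal_affine_bound) auto
    then show ?thesis using hs order_trans by blast
  qed
  \<comment> \<open>Fatou's lemma along integer truncation levels: at a fixed
    \<open>\<omega>\<close> the Huber function equals the square once the level exceeds
    \<open>Y t \<omega>\<close>.\<close>
  have "(\<integral>\<^sup>+\<omega>. ennreal ((real (Y t \<omega>))\<^sup>2) \<partial>M)
      = (\<integral>\<^sup>+\<omega>. liminf (\<lambda>n. ennreal (huber (real n) (real (Y t \<omega>)))) \<partial>M)"
  proof (intro nn_integral_cong lim_imp_Liminf[symmetric] tendsto_eventually)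
    fix \<omega>
    show "\<forall>\<^sub>F n in sequentially. ennreal (huber (real n) (real (Y t \<omega>))) = ennreal ((real (Y t \<omega>))\<^sup>2)"
      by (intro eventually_sequentiallyI[of "Y t \<omega>"]) (simp add: huber_eq)
  qed simp
  also have "\<dots> \<le> liminf (\<lambda>n. \<integral>\<^sup>+\<omega>. ennreal (huber (real n) (real (Y t \<omega>))) \<partial>M)"
    unfolding huber_def by (intro nn_integral_liminf) measurable
  also have "\<dots> \<le> limsup (\<lambda>n. \<integral>\<^sup>+\<omega>. ennreal (huber (real n) (real (Y t \<omega>))) \<partial>M)"
    by (rule Liminf_le_Limsup) simp
  also have "\<dots> \<le> ennreal ?B2"
    by (intro Limsup_bounded eventually_sequentiallyI[of 1] trunc) simp
  finally show ?thesis .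
qed

end

subsection \<open>Frequency of patterns\<close>

declare sum_of_bool_eq[simp del]

text \<open>The mean of \<open>exp (- of_bool (n = m))\<close> is 1 minus the mass at
  \<open>m\<close> times \<open>1 - exp (-1)\<close>, and \<open>1 - x \<le> exp (- x)\<close>. This
  is the origin of the factor \<open>1 - exp (-1)\<close> in the hit rates.\<close>

lemma suminf_exp_neg_of_bool:
  assumes r: "0 < r" and p: "p \<le> pmf (poisson_pmf r) m"
  shows "(\<Sum>n. ennreal (pmf (poisson_pmf r) n) *
      ennreal (exp (p * (1 - exp (-1)) - of_bool (n = m)))) \<le> 1"
proof -
  let ?p = "\<lambda>n. r ^ n / fact n * exp (- r)"
  define e :: real where "e = 1 - exp (-1)"
  have e: "0 \<le> e" by (simp add: e_def)
  have key: "exp (p * e - of_bool (n = m)) = exp (p * e) * (1 - (if n = m then e else 0))" for n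
    by (simp add: e_def exp_diff exp_minus divide_inverse)
  have "(\<lambda>n. exp (p * e) * (?p n * 1 ^ n - (if n = m then ?p n * e else 0)))
      sums (exp (p * e) * (exp (r * (1 - 1)) - ?p m * e))"
    by (intro sums_mult sums_diff poisson_exp_sums sums_single)
  also have "(\<lambda>n. exp (p * e) * (?p n * 1 ^ n - (if n = m then ?p n * e else 0)))
      = (\<lambda>n. ?p n * exp (p * e - of_bool (n = m)))"
    by (rule ext) (simp only: key, simp add: algebra_simps)
  finally have "(\<Sum>n. ennreal (pmf (poisson_pmf r) n) * ennreal (exp (p * e - of_bool (n = m))))
      = ennreal (exp (p * e) * (exp (r * (1 - 1)) - ?p m * e))"
    using r by (intro suminf_poisson_pmf) auto
  also have "\<dots> \<le> ennreal 1"
  proof (rule ennreal_leI)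
    have "p * e \<le> ?p m * e" using p r e by (intro mult_right_mono) auto
    then have "exp (r * (1 - 1)) - ?p m * e \<le> 1 + - (p * e)" by simp
    also have "\<dots> \<le> exp (- (p * e))" by (rule exp_ge_add_one_self)
    finally have "exp (p * e) * (exp (r * (1 - 1)) - ?p m * e) \<le> exp (p * e) * exp (- (p * e))"
      by (intro mult_left_mono) auto
    then show "exp (p * e) * (exp (r * (1 - 1)) - ?p m * e) \<le> 1"
      by (simp flip: exp_add)
  qed
  finally show ?thesis by (simp add: e_def)
qed

text \<open>A one-sided exponential bound: each visit to \<open>A\<close> is followed by the value
  \<open>m\<close> with conditional probability at least \<open>p\<close>. The loss \<open>z\<close>
  is additive and can be chosen independently of the random number of visits.\<close>

lemma (in poisson_process) whp_count_next:
  fixes A :: "int \<Rightarrow> 'w \<Rightarrow> bool"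
  assumes A: "\<And>t. t \<in> {a..b} \<Longrightarrow> {\<omega> \<in> space M. A t \<omega>} \<in> sets (F (t - 1))"
    and p: "\<And>t \<omega>. t \<in> {a..b} \<Longrightarrow> \<omega> \<in> space M \<Longrightarrow> A t \<omega> \<Longrightarrow> p \<le> pmf (poisson_pmf (lam t \<omega>)) m"
  shows "whp (exp (- z)) (\<lambda>\<omega>. p * (1 - exp (-1)) * (\<Sum>t\<in>{a..b}. of_bool (A t \<omega>)) - z
      \<le> (\<Sum>t\<in>{a..b}. of_bool (A t \<omega> \<and> Y t \<omega> = m)))"
proof -
  define \<xi> where "\<xi> t \<omega> n = of_bool (A t \<omega>) * (p * (1 - exp (-1)) - of_bool (n = m) :: real)" for t \<omega> n
  have "whp (exp (- z)) (\<lambda>\<omega>. (\<Sum>t\<in>{a..b}. \<xi> t \<omega> (Y t \<omega>)) < z)"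
  proof (rule whp_exp_supermartingale)
    fix t n assume "t \<in> {a..b}"
    from A[OF this] have "Measurable.pred (F (t - 1)) (A t)" by (simp add: pred_def)
    then show "(\<lambda>\<omega>. \<xi> t \<omega> n) \<in> borel_measurable (F (t - 1))"
      unfolding \<xi>_def of_bool_def by measurable
  next
    fix t \<omega> assume t: "t \<in> {a..b}" "\<omega> \<in> space M"
    note r = lam_pos[OF t(2), of t]
    show "(\<Sum>n. ennreal (pmf (poisson_pmf (lam t \<omega>)) n) * ennreal (exp (\<xi> t \<omega> n))) \<le> 1"
    proof (cases "A t \<omega>")
      case True
      then show ?thesis
        using suminf_exp_neg_of_bool[OF r p[OF t True]] by (simp add: \<xi>_def)
    next
      case False
      have "(\<Sum>n. ennreal (pmf (poisson_pmf (lam t \<omega>)) n) * ennreal (1 ^ n)) = ennreal (exp (lam t \<omega> * (1 - 1)))"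
        by (rule suminf_poisson_pmf[OF r poisson_exp_sums]) simp
      with False show ?thesis by (simp add: \<xi>_def)
    qed
  qed
  then show ?thesis
  proof (rule whp_mono)
    fix \<omega> assume "(\<Sum>t\<in>{a..b}. \<xi> t \<omega> (Y t \<omega>)) < z"
    moreover have "\<xi> t \<omega> (Y t \<omega>) = p * (1 - exp (-1)) * of_bool (A t \<omega>) - of_bool (A t \<omega> \<and> Y t \<omega> = m)" for t
      by (auto simp: \<xi>_def)
    ultimately show "p * (1 - exp (-1)) * (\<Sum>t\<in>{a..b}. of_bool (A t \<omega>)) - z
        \<le> (\<Sum>t\<in>{a..b}. of_bool (A t \<omega> \<and> Y t \<omega> = m))"
      by (simp add: sum_subtractf sum_distrib_left)
  qed simp
qed

definition weighted_past :: "(nat \<Rightarrow> real) \<Rightarrow> (int \<Rightarrow> 'w \<Rightarrow> nat) \<Rightarrow> int \<Rightarrow> 'w \<Rightarrow> ennreal" where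
  "weighted_past \<beta> Y t \<omega> = (\<Sum>j. ennreal (\<beta> j * real (Y (t - 1 - int j) \<omega>)))"

text \<open>The older past is weighed with the shifted coefficients it carries in the full past, so
  that the past lies within \<open>\<epsilon>\<close> of the pattern continued by zeros.\<close>

definition pattern_at ::
  "(nat \<Rightarrow> real) \<Rightarrow> nat \<Rightarrow> real \<Rightarrow> (nat \<Rightarrow> nat) \<Rightarrow> (int \<Rightarrow> 'w \<Rightarrow> nat) \<Rightarrow> int \<Rightarrow> 'w \<Rightarrow> bool" where
  "pattern_at \<beta> N \<epsilon> y Y t \<omega> \<longleftrightarrow> (\<forall>j<N. Y (t - 1 - int j) \<omega> = y j) \<and>
     weighted_past (\<lambda>j. \<beta> (j + N)) Y (t - int N) \<omega> \<le> ennreal \<epsilon>"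

context count_process
begin

lemma weighted_past_measurable:
  assumes "s \<le> t"
  shows "weighted_past \<beta> Y s \<in> borel_measurable (F (t - 1))"
proof -
  have [measurable]: "Y (s - 1 - int j) \<in> measurable (F (t - 1)) (count_space UNIV)" for j
    using assms by (intro Y_history) simp
  show ?thesis unfolding weighted_past_def[abs_def] by measurable
qed

end

context intensity
begin

lemma poisson_pmf_ge:
  assumes "c \<le> r" "r \<le> R" "n \<le> L"
  shows "min 1 c ^ L / fact L * exp (- R) \<le> pmf (poisson_pmf r) n"
proof -
  have r: "0 < r" using assms c_pos by simp
  have "min 1 c ^ L \<le> min 1 c ^ n" using assms c_pos by (intro power_decreasing) auto
  also have "\<dots> \<le> r ^ n" using assms c_pos by (intro power_mono) auto
  finally have "min 1 c ^ L / fact L \<le> r ^ n / fact n"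
    using assms r c_pos by (intro frac_le) (auto intro: fact_mono)
  then have "min 1 c ^ L / fact L * exp (- R) \<le> r ^ n / fact n * exp (- r)"
    using assms r c_pos by (intro mult_mono) auto
  then show ?thesis using r by simp
qed

text \<open>A lower bound for the Poisson mass of every value up to \<open>L\<close> when the rate
  lies between \<open>c\<close> and \<open>C + real L + K\<close>, times the factor from
  \<open>suminf_exp_neg_of_bool\<close>.\<close>

definition hit_rate :: "nat \<Rightarrow> real \<Rightarrow> real" where
  "hit_rate L K = min 1 c ^ L / fact L * exp (- (C + real L + K)) * (1 - exp (-1))"

lemma hit_rate_bounds: "0 \<le> K \<Longrightarrow> 0 < hit_rate L K" "0 \<le> K \<Longrightarrow> hit_rate L K \<le> 1"
proof -
  assume K: "0 \<le> K"
  show "0 < hit_rate L K" using c_pos by (simp add: hit_rate_def)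
  have "min 1 c ^ L \<le> 1" using c_pos by (intro power_le_one) auto
  also have "1 \<le> (fact L :: real)" by (rule fact_ge_1)
  finally have h1: "min 1 c ^ L / fact L \<le> 1" by (simp add: divide_le_eq)
  have h2: "exp (- (C + real L + K)) \<le> 1" using C_nonneg K by simp
  have h3: "min 1 c ^ L / fact L * exp (- (C + real L + K)) \<le> 1"
    by (rule mult_le_one[OF h1 _ h2]) simp
  show "hit_rate L K \<le> 1"
    unfolding hit_rate_def by (rule mult_le_one[OF h3]) auto
qed

end

locale bounded_process = intensity_process \<Theta> f \<alpha> c C M Y th
  for \<Theta> :: "(real^'d) set" and f \<alpha> c C and M :: "'w measure" and Y th +
  fixes B :: real
  assumes B_nonneg: "0 \<le> B"
    and second_moment: "\<And>t. (\<integral>\<^sup>+\<omega>. ennreal ((real (Y t \<omega>))\<^sup>2) \<partial>M) \<le> ennreal B"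
begin

lemma first_moment: "(\<integral>\<^sup>+\<omega>. ennreal (real (Y t \<omega>)) \<partial>M) \<le> ennreal B"
proof -
  have "(\<integral>\<^sup>+\<omega>. ennreal (real (Y t \<omega>)) \<partial>M) \<le> (\<integral>\<^sup>+\<omega>. ennreal ((real (Y t \<omega>))\<^sup>2) \<partial>M)"
  proof (intro nn_integral_mono ennreal_leI)
    fix \<omega>
    have "Y t \<omega> \<le> (Y t \<omega>)\<^sup>2" by (cases "Y t \<omega>") (simp_all add: power2_eq_square)
    then show "real (Y t \<omega>) \<le> (real (Y t \<omega>))\<^sup>2" by (simp flip: of_nat_power)
  qed
  also note second_moment
  finally show ?thesis .
qed

lemma nn_integral_weighted_past_bounded:
  assumes "\<And>j. 0 \<le> \<beta> j" "summable \<beta>"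
  shows "(\<integral>\<^sup>+\<omega>. weighted_past \<beta> Y t \<omega> \<partial>M) \<le> ennreal (suminf \<beta> * B)"
  using nn_integral_weighted_past_le[where g=real and t=t, OF assms first_moment] suminf_nonneg[OF assms(2,1)]
  unfolding weighted_past_def by (simp add: ennreal_mult')

text \<open>The level \<open>K\<close> limits what the past before \<open>s\<close> contributes to
  the intensities at the next \<open>N\<close> times, one shift \<open>i\<close> for each;
  \<open>\<epsilon>\<close> is the weight left to it once \<open>N\<close> more values have been
  observed.\<close>

definition good_start :: "(nat \<Rightarrow> real) \<Rightarrow> nat \<Rightarrow> real \<Rightarrow> real \<Rightarrow> int \<Rightarrow> 'w \<Rightarrow> bool" where
  "good_start \<beta> N K \<epsilon> s \<omega> \<longleftrightarrow> (\<forall>i<N. weighted_past (\<lambda>j. \<alpha> (j + i)) Y s \<omega> \<le> ennreal K) \<and>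
     weighted_past (\<lambda>j. \<beta> (j + N)) Y s \<omega> \<le> ennreal \<epsilon>"

text \<open>Entry 0 of a pattern is the most recent value, so in chronological order the pattern is
  read backwards, from \<open>N - 1\<close>.\<close>

definition started :: "(nat \<Rightarrow> real) \<Rightarrow> nat \<Rightarrow> real \<Rightarrow> real \<Rightarrow> (nat \<Rightarrow> nat) \<Rightarrow> nat \<Rightarrow> int \<Rightarrow> 'w \<Rightarrow> bool" where
  "started \<beta> N K \<epsilon> y i s \<omega> \<longleftrightarrow> good_start \<beta> N K \<epsilon> s \<omega> \<and> (\<forall>i'<i. Y (s + int i') \<omega> = y (N - 1 - i'))"

lemma started_imp_pattern_at:
  assumes "started \<beta> N K \<epsilon> y N s \<omega>"
  shows "pattern_at \<beta> N \<epsilon> y Y (s + int N) \<omega>"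
  unfolding pattern_at_def
proof (intro conjI allI impI)
  fix j assume "j < N"
  then have eq: "s + int (N - 1 - j) = s + int N - 1 - int j" and lt: "N - 1 - j < N" by auto
  have "Y (s + int (N - 1 - j)) \<omega> = y (N - 1 - (N - 1 - j))"
    using assms lt unfolding started_def by blast
  then show "Y (s + int N - 1 - int j) \<omega> = y j"
    unfolding eq using \<open>j < N\<close> by simp
qed (use assms in \<open>simp add: started_def good_start_def\<close>)

lemma started_measurable:
  assumes "s + int i \<le> t"
  shows "{\<omega> \<in> space M. started \<beta> N K \<epsilon> y i s \<omega>} \<in> sets (F (t - 1))"
proof -
  have st: "s \<le> t" using assms by simp
  note weighted_past_measurable[OF st, measurable]
  have "Measurable.pred (F (t - 1)) (\<lambda>\<omega>. Y (s + int i') \<omega> = y (N - 1 - i'))" if "i' \<in> {..<i}" for i'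
  proof -
    have [measurable]: "Y (s + int i') \<in> measurable (F (t - 1)) (count_space UNIV)"
      using assms that by (intro Y_history) simp
    show ?thesis by measurable
  qed
  then have "Measurable.pred (F (t - 1)) (\<lambda>\<omega>. \<forall>i'\<in>{..<i}. Y (s + int i') \<omega> = y (N - 1 - i'))"
    by (intro pred_intros_finite) auto
  moreover have "Measurable.pred (F (t - 1)) (good_start \<beta> N K \<epsilon> s)"
    unfolding good_start_def[abs_def] by measurable
  ultimately have "Measurable.pred (F (t - 1)) (\<lambda>\<omega>. good_start \<beta> N K \<epsilon> s \<omega> \<and> (\<forall>i'\<in>{..<i}. Y (s + int i') \<omega> = y (N - 1 - i')))"
    by measurable
  then show ?thesis by (simp add: pred_def started_def Ball_def)
qed

text \<open>The values since \<open>s\<close> are at most \<open>L\<close> and carry total weight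
  below 1; the older past contributes at most \<open>K\<close>. Hence the next value of the pattern
  still has a mass bounded below.\<close>

lemma lam_le_of_started:
  assumes st: "started \<beta> N K \<epsilon> y i s \<omega>" and i: "i < N" and L: "\<And>j. j < N \<Longrightarrow> y j \<le> L" and K: "0 \<le> K"
  shows "lam (s + int i) \<omega> \<le> C + real L + K"
proof -
  let ?u = "\<lambda>j. ennreal (\<alpha> j * real (Y (s + int i - 1 - int j) \<omega>))"
  have "ennreal (lam (s + int i) \<omega>) \<le> ennreal C + (\<Sum>j. ?u j)" by (rule lam_le)
  also have "(\<Sum>j. ?u j) = (\<Sum>j<i. ?u j) + (\<Sum>j. ?u (j + i))"
    by (subst add.commute) (rule suminf_offset, simp)
  also have "(\<lambda>j. ?u (j + i)) = (\<lambda>j. ennreal (\<alpha> (j + i) * real (Y (s - 1 - int j) \<omega>)))"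
    by (simp add: fun_eq_iff algebra_simps)
  also have "(\<Sum>j. ennreal (\<alpha> (j + i) * real (Y (s - 1 - int j) \<omega>))) \<le> ennreal K"
    using st i by (simp add: started_def good_start_def weighted_past_def)
  also have "(\<Sum>j<i. ?u j) \<le> ennreal (real L)"
  proof -
    have "(\<Sum>j<i. ?u j) \<le> (\<Sum>j<i. ennreal (\<alpha> j * real L))"
    proof (intro sum_mono ennreal_leI mult_left_mono \<alpha>_nonneg)
      fix j assume "j \<in> {..<i}"
      then have e: "s + int i - 1 - int j = s + int (i - 1 - j)" and lt: "i - 1 - j < i" by auto
      have "Y (s + int i - 1 - int j) \<omega> = y (N - 1 - (i - 1 - j))"
        unfolding e using st lt unfolding started_def by blast
      also have "\<dots> \<le> L" using i by (intro L) auto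
      finally show "real (Y (s + int i - 1 - int j) \<omega>) \<le> real L" by simp
    qed
    also have "\<dots> = ennreal ((\<Sum>j<i. \<alpha> j) * real L)"
      using \<alpha>_nonneg by (subst sum_ennreal) (auto simp: sum_distrib_right)
    also have "\<dots> \<le> ennreal (1 * real L)"
    proof (intro ennreal_leI mult_right_mono)
      have "(\<Sum>j<i. \<alpha> j) \<le> suminf \<alpha>" using \<alpha>_summable \<alpha>_nonneg by (intro sum_le_suminf) auto
      then show "(\<Sum>j<i. \<alpha> j) \<le> 1" using \<alpha>_less_1 by simp
    qed simp
    finally show ?thesis by simp
  qed
  finally have "ennreal (lam (s + int i) \<omega>) \<le> ennreal (C + real L + K)"
    using C_nonneg K by (simp add: ennreal_plus add.assoc)
  then show ?thesis using C_nonneg K by (subst (asm) ennreal_le_iff) auto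
qed

text \<open>Each further entry multiplies the count by the hit rate and costs another
  \<open>z\<close>. Since the rate is at most 1, earlier losses do not grow, and they add up to
  \<open>real i * z\<close>.\<close>

lemma whp_started:
  assumes L: "\<And>j. j < N \<Longrightarrow> y j \<le> L" and K: "0 \<le> K" and z: "0 \<le> z" and i: "i \<le> N"
  shows "whp (real i * exp (- z)) (\<lambda>\<omega>. hit_rate L K ^ i * (\<Sum>s\<in>{a..b}. of_bool (good_start \<beta> N K \<epsilon> s \<omega>)) - real i * z
      \<le> (\<Sum>s\<in>{a..b}. of_bool (started \<beta> N K \<epsilon> y i s \<omega>)))"
  using i
proof (induction i)
  case 0
  then show ?case unfolding whp_def by (intro bexI[of _ "{}"]) (auto simp: started_def)
next
  case (Suc i)
  let ?p = "min 1 c ^ L / fact L * exp (- (C + real L + K))" and ?q = "hit_rate L K"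
  let ?A = "\<lambda>t \<omega>. started \<beta> N K \<epsilon> y i (t - int i) \<omega>"
  have shift: "(\<Sum>t\<in>{a + int i..b + int i}. g (t - int i)) = (\<Sum>s\<in>{a..b}. g s)" for g :: "int \<Rightarrow> real"
    by (rule sum.reindex_bij_witness[of _ "\<lambda>s. s + int i" "\<lambda>t. t - int i"]) auto
  have "whp (exp (- z)) (\<lambda>\<omega>. ?p * (1 - exp (-1)) * (\<Sum>t\<in>{a + int i..b + int i}. of_bool (?A t \<omega>)) - z
      \<le> (\<Sum>t\<in>{a + int i..b + int i}. of_bool (?A t \<omega> \<and> Y t \<omega> = y (N - 1 - i))))"
  proof (rule whp_count_next)
    fix t \<omega> assume "\<omega> \<in> space M" and A: "?A t \<omega>"
    have "lam (t - int i + int i) \<omega> \<le> C + real L + K"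
      using A Suc.prems L K by (intro lam_le_of_started) auto
    then show "?p \<le> pmf (poisson_pmf (lam t \<omega>)) (y (N - 1 - i))"
      using Suc.prems by (intro poisson_pmf_ge f_ge th past_nonneg L) auto
  qed (rule started_measurable, simp)
  moreover have "(?A t \<omega> \<and> Y t \<omega> = y (N - 1 - i)) = started \<beta> N K \<epsilon> y (Suc i) (t - int i) \<omega>" for t \<omega>
    by (auto simp: started_def less_Suc_eq)
  ultimately have "whp (exp (- z)) (\<lambda>\<omega>. ?q * (\<Sum>s\<in>{a..b}. of_bool (started \<beta> N K \<epsilon> y i s \<omega>)) - z
      \<le> (\<Sum>s\<in>{a..b}. of_bool (started \<beta> N K \<epsilon> y (Suc i) s \<omega>)))"
    using shift[of "\<lambda>s. of_bool (started \<beta> N K \<epsilon> y i s \<omega>)" for \<omega>]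
      shift[of "\<lambda>s. of_bool (started \<beta> N K \<epsilon> y (Suc i) s \<omega>)" for \<omega>]
    by (simp add: hit_rate_def)
  from whp_conj[OF Suc.IH this] Suc.prems
  have "whp (real i * exp (- z) + exp (- z)) (\<lambda>\<omega>.
      ?q ^ i * (\<Sum>s\<in>{a..b}. of_bool (good_start \<beta> N K \<epsilon> s \<omega>)) - real i * z
      \<le> (\<Sum>s\<in>{a..b}. of_bool (started \<beta> N K \<epsilon> y i s \<omega>)) \<and>
      ?q * (\<Sum>s\<in>{a..b}. of_bool (started \<beta> N K \<epsilon> y i s \<omega>)) - z
      \<le> (\<Sum>s\<in>{a..b}. of_bool (started \<beta> N K \<epsilon> y (Suc i) s \<omega>)))"
    by simp
  then show ?case
  proof (rule whp_mono)
    show "real i * exp (- z) + exp (- z) \<le> real (Suc i) * exp (- z)" by (simp add: algebra_simps)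
    fix \<omega>
    let ?g = "\<Sum>s\<in>{a..b}. of_bool (good_start \<beta> N K \<epsilon> s \<omega>) :: real"
    let ?c = "\<lambda>i. \<Sum>s\<in>{a..b}. of_bool (started \<beta> N K \<epsilon> y i s \<omega>) :: real"
    assume h: "?q ^ i * ?g - real i * z \<le> ?c i \<and> ?q * ?c i - z \<le> ?c (Suc i)"
    have "?q * (?q ^ i * ?g - real i * z) \<le> ?q * ?c i"
      using h hit_rate_bounds[OF K, of L] by (intro mult_left_mono) auto
    moreover have "?q * (real i * z) \<le> 1 * (real i * z)"
      using hit_rate_bounds[OF K, of L] z by (intro mult_right_mono) auto
    ultimately have "?q ^ Suc i * ?g - real i * z \<le> ?q * ?c i"
      by (simp add: algebra_simps)
    with h show "?q ^ Suc i * ?g - real (Suc i) * z \<le> ?c (Suc i)"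
      by (simp add: algebra_simps)
  qed
qed

lemma whp_good_start:
  assumes \<beta>: "\<And>j. 0 \<le> \<beta> j" "summable \<beta>" and K: "0 < K" and \<epsilon>: "0 < \<epsilon>" and \<delta>: "0 \<le> \<delta>"
    and small: "real N * B / K \<le> \<delta> / 4" "(\<Sum>j. \<beta> (j + N)) * B / \<epsilon> \<le> \<delta> / 4" and ab: "a \<le> b"
  shows "whp \<delta> (\<lambda>\<omega>. real_of_int (b - a + 1) / 2 \<le> (\<Sum>s\<in>{a..b}. of_bool (good_start \<beta> N K \<epsilon> s \<omega>)))"
proof -
  let ?n = "real_of_int (b - a + 1)"
  have n: "0 < ?n" using ab by simp
  have card: "real (card {a..b}) = ?n" using ab by simp
  \<comment> \<open>\<open>X s\<close> is at least 1 whenever \<open>s\<close> is not a good start,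
    and its mean is at most \<open>\<delta> / 2\<close>: one quarter of \<open>\<delta>\<close> for
    the levels \<open>K\<close>, another for \<open>\<epsilon>\<close>. Markov's inequality then
    limits the bad times to half of the window.\<close>
  define X where "X s \<omega> = (\<Sum>i<N. ennreal (1 / K) * weighted_past (\<lambda>j. \<alpha> (j + i)) Y s \<omega>)
      + ennreal (1 / \<epsilon>) * weighted_past (\<lambda>j. \<beta> (j + N)) Y s \<omega>" for s \<omega>
  have [measurable]: "weighted_past w Y s \<in> borel_measurable M" for w s
    using weighted_past_measurable[of s s w] by (intro history_measurable[of _ "s - 1"]) simp
  have Xm[measurable]: "X s \<in> borel_measurable M" for s unfolding X_def[abs_def] by measurable
  have "(\<integral>\<^sup>+\<omega>. X s \<omega> \<partial>M) \<le> ennreal (\<delta> / 2)" for s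
  proof -
    have 1: "(\<integral>\<^sup>+\<omega>. ennreal (1 / K) * weighted_past (\<lambda>j. \<alpha> (j + i)) Y s \<omega> \<partial>M) \<le> ennreal (B / K)" for i
    proof -
      have s: "summable (\<lambda>j. \<alpha> (j + i))" using \<alpha>_summable by (rule summable_ignore_initial_segment)
      have "(\<Sum>j. \<alpha> (j + i)) \<le> suminf \<alpha>"
        using suminf_split_initial_segment[OF \<alpha>_summable, of i] sum_nonneg[of "{..<i}" \<alpha>] \<alpha>_nonneg by simp
      then have "(\<Sum>j. \<alpha> (j + i)) * B \<le> 1 * B" using \<alpha>_less_1 B_nonneg by (intro mult_right_mono) auto
      then have "(\<integral>\<^sup>+\<omega>. weighted_past (\<lambda>j. \<alpha> (j + i)) Y s \<omega> \<partial>M) \<le> ennreal B"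
        by (intro order_trans[OF nn_integral_weighted_past_bounded[OF \<alpha>_nonneg s]] ennreal_leI) simp
      then have "ennreal (1 / K) * (\<integral>\<^sup>+\<omega>. weighted_past (\<lambda>j. \<alpha> (j + i)) Y s \<omega> \<partial>M) \<le> ennreal (1 / K) * ennreal B"
        by (intro mult_left_mono) auto
      then show ?thesis using K by (simp add: nn_integral_cmult flip: ennreal_mult')
    qed
    have s: "summable (\<lambda>j. \<beta> (j + N))" using \<beta>(2) by (rule summable_ignore_initial_segment)
    have 2: "(\<integral>\<^sup>+\<omega>. ennreal (1 / \<epsilon>) * weighted_past (\<lambda>j. \<beta> (j + N)) Y s \<omega> \<partial>M) \<le> ennreal (\<delta> / 4)"
    proof -
      have "(\<integral>\<^sup>+\<omega>. ennreal (1 / \<epsilon>) * weighted_past (\<lambda>j. \<beta> (j + N)) Y s \<omega> \<partial>M)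
          = ennreal (1 / \<epsilon>) * (\<integral>\<^sup>+\<omega>. weighted_past (\<lambda>j. \<beta> (j + N)) Y s \<omega> \<partial>M)"
        by (rule nn_integral_cmult) measurable
      also have "\<dots> \<le> ennreal (1 / \<epsilon>) * ennreal ((\<Sum>j. \<beta> (j + N)) * B)"
        using \<beta>(1) by (intro mult_left_mono nn_integral_weighted_past_bounded s) auto
      also have "\<dots> = ennreal ((\<Sum>j. \<beta> (j + N)) * B / \<epsilon>)"
        using \<epsilon> by (simp flip: ennreal_mult')
      also have "\<dots> \<le> ennreal (\<delta> / 4)" using small by (intro ennreal_leI)
      finally show ?thesis .
    qed
    have "(\<integral>\<^sup>+\<omega>. X s \<omega> \<partial>M) = (\<Sum>i<N. \<integral>\<^sup>+\<omega>. ennreal (1 / K) * weighted_past (\<lambda>j. \<alpha> (j + i)) Y s \<omega> \<partial>M)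
        + (\<integral>\<^sup>+\<omega>. ennreal (1 / \<epsilon>) * weighted_past (\<lambda>j. \<beta> (j + N)) Y s \<omega> \<partial>M)"
      unfolding X_def by (simp add: nn_integral_add nn_integral_sum)
    also have "\<dots> \<le> (\<Sum>i<N. ennreal (B / K)) + ennreal (\<delta> / 4)"
      by (intro add_mono sum_mono 1 2)
    also have "\<dots> = ennreal (real N * B / K) + ennreal (\<delta> / 4)"
      using K B_nonneg by (simp add: ennreal_of_nat_eq_real_of_nat flip: ennreal_mult')
    also have "\<dots> \<le> ennreal (\<delta> / 4) + ennreal (\<delta> / 4)" using small by (intro add_right_mono ennreal_leI)
    also have "\<dots> = ennreal (\<delta> / 2)" using \<delta> by (simp flip: ennreal_plus)
    finally show ?thesis .
  qed
  then have "(\<Sum>s\<in>{a..b}. \<integral>\<^sup>+\<omega>. X s \<omega> \<partial>M) \<le> of_nat (card {a..b}) * ennreal (\<delta> / 2)"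
    by (intro sum_bounded_above)
  also have "\<dots> = ennreal (?n * (\<delta> / 2))"
    using \<delta> n by (simp only: card ennreal_of_nat_eq_real_of_nat ennreal_mult')
  finally have "(\<integral>\<^sup>+\<omega>. (\<Sum>s\<in>{a..b}. X s \<omega>) \<partial>M) \<le> ennreal (?n * (\<delta> / 2))"
    by (simp add: nn_integral_sum)
  then have "whp (?n * (\<delta> / 2) / (?n / 2)) (\<lambda>\<omega>. (\<Sum>s\<in>{a..b}. X s \<omega>) < ennreal (?n / 2))"
    using n \<delta> by (intro whp_markov) auto
  then show ?thesis
  proof (rule whp_mono)
    show "?n * (\<delta> / 2) / (?n / 2) \<le> \<delta>" using n by (simp add: field_simps)
    fix \<omega> assume lt: "(\<Sum>s\<in>{a..b}. X s \<omega>) < ennreal (?n / 2)"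
    have X1: "of_bool (\<not> good_start \<beta> N K \<epsilon> s \<omega>) \<le> X s \<omega>" for s
    proof (cases "good_start \<beta> N K \<epsilon> s \<omega>")
      case False
      have scaled: "1 \<le> ennreal (1 / k) * x" if "\<not> x \<le> ennreal k" "0 < k" for k x
      proof -
        have "ennreal (1 / k) * ennreal k \<le> ennreal (1 / k) * x" using that by (intro mult_left_mono) auto
        then show ?thesis using that by (simp flip: ennreal_mult')
      qed
      have "1 \<le> X s \<omega>"
      proof (cases "weighted_past (\<lambda>j. \<beta> (j + N)) Y s \<omega> \<le> ennreal \<epsilon>")
        case True
        then obtain i where i: "i < N" "\<not> weighted_past (\<lambda>j. \<alpha> (j + i)) Y s \<omega> \<le> ennreal K"
          using False by (auto simp: good_start_def)
        have "1 \<le> ennreal (1 / K) * weighted_past (\<lambda>j. \<alpha> (j + i)) Y s \<omega>" by (rule scaled[OF i(2) K])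
        also have "\<dots> \<le> (\<Sum>i<N. ennreal (1 / K) * weighted_past (\<lambda>j. \<alpha> (j + i)) Y s \<omega>)"
          using i by (intro member_le_sum) auto
        also have "\<dots> \<le> X s \<omega>" unfolding X_def by (rule add_increasing2) simp_all
        finally show ?thesis .
      next
        case False
        then have "1 \<le> ennreal (1 / \<epsilon>) * weighted_past (\<lambda>j. \<beta> (j + N)) Y s \<omega>" using \<epsilon> by (rule scaled)
        also have "\<dots> \<le> X s \<omega>" unfolding X_def by (rule add_increasing) simp_all
        finally show ?thesis .
      qed
      with False show ?thesis by simp
    qed simp
    have "ennreal (\<Sum>s\<in>{a..b}. of_bool (\<not> good_start \<beta> N K \<epsilon> s \<omega>)) = (\<Sum>s\<in>{a..b}. of_bool (\<not> good_start \<beta> N K \<epsilon> s \<omega>))"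
      by (subst sum_ennreal[symmetric], simp) (rule sum.cong, auto simp: of_bool_def)
    also have "\<dots> \<le> (\<Sum>s\<in>{a..b}. X s \<omega>)" by (intro sum_mono X1)
    also note lt
    finally have bad: "(\<Sum>s\<in>{a..b}. of_bool (\<not> good_start \<beta> N K \<epsilon> s \<omega>)) < ?n / 2"
      by (subst (asm) ennreal_less_iff) (auto intro: sum_nonneg)
    have "(\<Sum>s\<in>{a..b}. of_bool (\<not> good_start \<beta> N K \<epsilon> s \<omega>)) + (\<Sum>s\<in>{a..b}. of_bool (good_start \<beta> N K \<epsilon> s \<omega>))
        = ?n"
      unfolding sum.distrib[symmetric] using card by (simp add: of_bool_def if_distrib cong: if_cong)
    with bad show "?n / 2 \<le> (\<Sum>s\<in>{a..b}. of_bool (good_start \<beta> N K \<epsilon> s \<omega>))" by simp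
  qed
qed

end

lemma exp_decay_threshold:
  fixes r d D :: real
  assumes "0 < r" "0 < d" "0 \<le> D"
  obtains n0 where "0 < n0" "\<And>n. n0 \<le> n \<Longrightarrow> D * exp (- (r * n)) \<le> d"
proof
  show "0 < D / (r * d) + 1" using assms by (simp add: add_nonneg_pos)
  fix n assume n: "D / (r * d) + 1 \<le> n"
  have n_pos: "0 < n" using n assms by (smt (verit) divide_nonneg_pos mult_pos_pos)
  have "r * n \<le> exp (r * n)" using exp_ge_add_one_self[of "r * n"] by linarith
  then have "exp (- (r * n)) \<le> 1 / (r * n)"
    using assms n_pos by (simp add: exp_minus field_simps)
  then have "D * exp (- (r * n)) \<le> D * (1 / (r * n))" using assms by (intro mult_left_mono) auto
  also have "\<dots> \<le> d"
  proof -
    have "D / (r * d) \<le> n" using n by simp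
    then show ?thesis using assms n_pos by (simp add: field_simps)
  qed
  finally show "D * exp (- (r * n)) \<le> d" .
qed

text \<open>Since only moments of order one and two are controlled, the constants have to depend on the probability \<open>\<delta>\<close>
  of the exceptional event; they are uniform over all processes and time windows.\<close>

lemma (in intensity) pattern_frequency:
  fixes \<beta> :: "nat \<Rightarrow> real" and P :: "(nat \<Rightarrow> nat) set"
  assumes \<beta>: "\<And>j. 0 \<le> \<beta> j" "summable \<beta>" and P: "finite P" and \<epsilon>: "0 < \<epsilon>" and \<delta>: "0 < \<delta>" and B: "0 \<le> B"
  obtains N \<eta> n0 where "Nmin \<le> N" "0 < \<eta>" "0 < n0"
    "\<And>(M :: 'w measure) Y th a b. bounded_process \<Theta> f \<alpha> c C M Y th B \<Longrightarrow> n0 \<le> real_of_int (b - a + 1) \<Longrightarrow>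
      prob_space.whp M \<delta> (\<lambda>\<omega>. \<forall>y\<in>P. \<eta> * real_of_int (b - a + 1) \<le> (\<Sum>t\<in>{a..b}. of_bool (pattern_at \<beta> N \<epsilon> y Y t \<omega>)))"
proof -
  have "0 < \<delta> * \<epsilon> / (8 * (B + 1))" using \<delta> \<epsilon> B by simp
  from suminf_exist_split[OF this \<beta>(2)] obtain N1 where
    N1: "\<And>n. N1 \<le> n \<Longrightarrow> norm (\<Sum>i. \<beta> (i + n)) < \<delta> * \<epsilon> / (8 * (B + 1))" by blast
  define N where "N = max Nmin N1"
  have tail: "(\<Sum>j. \<beta> (j + N)) * B / \<epsilon> \<le> \<delta> / 2 / 4"
  proof -
    have "(\<Sum>j. \<beta> (j + N)) * B \<le> \<delta> * \<epsilon> / (8 * (B + 1)) * B"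
      using N1[of N] B by (intro mult_right_mono) (auto simp: N_def)
    also have "\<dots> \<le> \<delta> * \<epsilon> / 8"
      using \<delta> \<epsilon> B by (simp add: field_simps)
    finally show ?thesis using \<epsilon> by (simp add: field_simps)
  qed
  \<comment> \<open>Chosen, like the tail above, so that \<open>whp_good_start\<close> applies with
    \<open>\<delta> / 2\<close> in place of \<open>\<delta>\<close>; adding 1 keeps \<open>K\<close>
    positive when \<open>N\<close> or \<open>B\<close> is 0.\<close>
  define K where "K = 8 * real N * B / \<delta> + 1"
  have K: "0 < K" using \<delta> B by (simp add: K_def add_nonneg_pos)
  have NK: "real N * B / K \<le> \<delta> / 2 / 4"
  proof -
    have "8 * (real N * B) \<le> \<delta> * K" using \<delta> by (simp add: K_def field_simps)
    then show ?thesis using K by (simp add: field_simps)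
  qed
  define L where "L = (\<Sum>y\<in>P. \<Sum>j<N. y j)"
  have L: "y j \<le> L" if "y \<in> P" "j < N" for y j
  proof -
    have "y j \<le> (\<Sum>j<N. y j)" using that by (intro member_le_sum) auto
    also have "\<dots> \<le> L" unfolding L_def using that P by (intro member_le_sum) auto
    finally show ?thesis .
  qed
  define q where "q = hit_rate L K"
  have q: "0 < q" using hit_rate_bounds K by (simp add: q_def)
  \<comment> \<open>With \<open>z = r * n\<close> the \<open>N\<close> losses amount to at most
    \<open>q ^ N * n / 4\<close>, half of what \<open>n / 2\<close> good starts provide.\<close>
  define r where "r = q ^ N / (4 * (real N + 1))"
  have r: "0 < r" using q by (simp add: r_def)
  obtain n0 where n0: "0 < n0" "\<And>n. n0 \<le> n \<Longrightarrow> (real (card P) * real N) * exp (- (r * n)) \<le> \<delta> / 2"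
    using exp_decay_threshold[of r "\<delta> / 2" "real (card P) * real N"] r \<delta> by auto
  show thesis
  proof (rule that)
    show "Nmin \<le> N" by (simp add: N_def)
    show "0 < q ^ N / 4" using q by simp
    show "0 < n0" by (rule n0)
    fix M :: "'w measure" and Y th and a b :: int
    assume bp: "bounded_process \<Theta> f \<alpha> c C M Y th B" and n: "n0 \<le> real_of_int (b - a + 1)"
    interpret bounded_process \<Theta> f \<alpha> c C M Y th B by (rule bp)
    let ?n = "real_of_int (b - a + 1)"
    let ?a = "a - int N" and ?b = "b - int N"
    let ?g = "\<lambda>\<omega>. \<Sum>s\<in>{?a..?b}. of_bool (good_start \<beta> N K \<epsilon> s \<omega>) :: real"
    let ?c = "\<lambda>y \<omega>. \<Sum>s\<in>{?a..?b}. of_bool (started \<beta> N K \<epsilon> y N s \<omega>) :: real"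
    have n_pos: "0 < ?n" using n n0(1) by linarith
    have "whp (\<delta> / 2) (\<lambda>\<omega>. real_of_int (?b - ?a + 1) / 2 \<le> ?g \<omega>)"
      using \<delta> n_pos by (intro whp_good_start \<beta> K \<epsilon> NK tail) auto
    then have 1: "whp (\<delta> / 2) (\<lambda>\<omega>. ?n / 2 \<le> ?g \<omega>)" by simp
    have "whp (real (card P) * (real N * exp (- (r * ?n)))) (\<lambda>\<omega>. \<forall>y\<in>P. q ^ N * ?g \<omega> - real N * (r * ?n) \<le> ?c y \<omega>)"
      unfolding q_def using K r n_pos by (intro whp_ball P whp_started L) auto
    from whp_conj[OF 1 this] show "whp \<delta> (\<lambda>\<omega>. \<forall>y\<in>P. q ^ N / 4 * ?n \<le> (\<Sum>t\<in>{a..b}. of_bool (pattern_at \<beta> N \<epsilon> y Y t \<omega>)))"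
    proof (rule whp_mono)
      show "\<delta> / 2 + real (card P) * (real N * exp (- (r * ?n))) \<le> \<delta>"
        using n0(2)[OF n] by (simp add: mult.assoc)
      fix \<omega> assume h: "?n / 2 \<le> ?g \<omega> \<and> (\<forall>y\<in>P. q ^ N * ?g \<omega> - real N * (r * ?n) \<le> ?c y \<omega>)"
      show "\<forall>y\<in>P. q ^ N / 4 * ?n \<le> (\<Sum>t\<in>{a..b}. of_bool (pattern_at \<beta> N \<epsilon> y Y t \<omega>))"
      proof
        fix y assume y: "y \<in> P"
        have "real N * r \<le> q ^ N / 4" using q by (simp add: r_def field_simps)
        then have "real N * r * ?n \<le> q ^ N / 4 * ?n" using n_pos by (intro mult_right_mono) auto
        moreover have "q ^ N * (?n / 2) \<le> q ^ N * ?g \<omega>" using h q by (intro mult_left_mono) auto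
        moreover have "q ^ N * ?g \<omega> - real N * (r * ?n) \<le> ?c y \<omega>" using h y by blast
        ultimately have "q ^ N / 4 * ?n \<le> ?c y \<omega>" unfolding mult.assoc[symmetric] by linarith
        also have "\<dots> \<le> (\<Sum>s\<in>{?a..?b}. of_bool (pattern_at \<beta> N \<epsilon> y Y (s + int N) \<omega>))"
          by (intro sum_mono) (use started_imp_pattern_at in \<open>auto simp: of_bool_def\<close>)
        also have "\<dots> = (\<Sum>t\<in>{a..b}. of_bool (pattern_at \<beta> N \<epsilon> y Y t \<omega>))"
          by (rule sum.reindex_bij_witness[of _ "\<lambda>t. t - int N" "\<lambda>s. s + int N"]) auto
        finally show "q ^ N / 4 * ?n \<le> (\<Sum>t\<in>{a..b}. of_bool (pattern_at \<beta> N \<epsilon> y Y t \<omega>))" .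
      qed
    qed
  qed
qed

subsection \<open>Consistency of the maximum likelihood estimator\<close>

lemma suminf_poisson_exp_affine:
  assumes "0 < r"
  shows "(\<Sum>n. ennreal (pmf (poisson_pmf r) n) * ennreal (exp (u * real n + v))) = ennreal (exp (r * (exp u - 1) + v))"
proof -
  have "(\<lambda>n. (r ^ n / fact n * exp (- r) * exp u ^ n) * exp v) sums (exp (r * (exp u - 1)) * exp v)"
    by (intro sums_mult2 poisson_exp_sums)
  then have "(\<lambda>n. r ^ n / fact n * exp (- r) * exp (u * real n + v)) sums exp (r * (exp u - 1) + v)"
    by (simp add: exp_add exp_of_nat_mult[symmetric] mult_ac)
  then show ?thesis using assms by (intro suminf_poisson_pmf) auto
qed

text \<open>Factor \<open>x - y\<close> through the square roots; the squared sum of the roots is at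
  most \<open>4 * R\<close>. A gap between intensities thus yields a Hellinger gap where the
  intensities are bounded.\<close>

lemma sqrt_diff_ge:
  fixes x y :: real
  assumes "0 < x" "0 < y" "x \<le> R" "y \<le> R" "d \<le> \<bar>x - y\<bar>" "0 \<le> d"
  shows "d\<^sup>2 / (4 * R) \<le> (sqrt x - sqrt y)\<^sup>2"
proof -
  have "(sqrt x - sqrt y) * (sqrt x + sqrt y) = x - y"
    using assms by (simp add: algebra_simps)
  then have eq: "(sqrt x - sqrt y)\<^sup>2 * (sqrt x + sqrt y)\<^sup>2 = (x - y)\<^sup>2"
    by (simp flip: power_mult_distrib)
  have "0 \<le> (sqrt x - sqrt y)\<^sup>2" by simp
  then have "(sqrt x + sqrt y)\<^sup>2 \<le> 4 * R"
    using assms by (simp add: power2_sum power2_diff)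
  then have "(x - y)\<^sup>2 \<le> (sqrt x - sqrt y)\<^sup>2 * (4 * R)"
    unfolding eq[symmetric] by (intro mult_left_mono) auto
  moreover have "d\<^sup>2 \<le> (x - y)\<^sup>2"
    using assms by (simp add: abs_le_square_iff[symmetric])
  ultimately show ?thesis using assms by (simp add: field_simps)
qed

text \<open>The Hellinger affinity of two Poisson laws; no moments of the intensities are needed.\<close>

lemma suminf_poisson_hellinger:
  assumes r: "0 < r" and F: "0 < F"
  shows "(\<Sum>n. ennreal (pmf (poisson_pmf r) n) *
      ennreal (exp (1 / 2 * (real n * ln (F / r) - (F - r)) + v)))
    = ennreal (exp (v - 1 / 2 * (sqrt F - sqrt r)\<^sup>2))"
proof -
  have e: "exp (1 / 2 * ln (F / r)) = sqrt F / sqrt r"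
  proof -
    have "1 / 2 * ln (F / r) = ln (sqrt (F / r))" using r F by (simp add: ln_sqrt)
    then show ?thesis using r F by (simp add: real_sqrt_divide)
  qed
  have "r * (sqrt F / sqrt r) = (r / sqrt r) * sqrt F" by simp
  also have "\<dots> = sqrt r * sqrt F" using r by (subst real_div_sqrt) auto
  finally have rF: "r * (sqrt F / sqrt r) = sqrt r * sqrt F" .
  have "r * (exp (1 / 2 * ln (F / r)) - 1) + (v - 1 / 2 * (F - r)) = v - 1 / 2 * (sqrt F - sqrt r)\<^sup>2"
    unfolding e right_diff_distrib rF using r F by (simp add: power2_diff field_simps)
  moreover have "1 / 2 * (real n * ln (F / r) - (F - r)) + v = 1 / 2 * ln (F / r) * real n + (v - 1 / 2 * (F - r))" for n
    by (simp add: field_simps)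
  ultimately show ?thesis
    by (simp only: suminf_poisson_exp_affine[OF r])
qed

text \<open>The mean of the likelihood ratio of the true law against rate \<open>F\<close> is
  \<open>exp ((r - F)^2 / F)\<close>, so this compensator is exact. It prices the replacement of the
  true intensity by the one computed from the observed past.\<close>

lemma suminf_poisson_chi_square:
  assumes r: "0 < r" and F: "0 < F"
  shows "(\<Sum>n. ennreal (pmf (poisson_pmf r) n) *
      ennreal (exp (real n * ln (r / F) - (r - F) - (r - F)\<^sup>2 / F))) = 1"
proof -
  have "r * (exp (ln (r / F)) - 1) + (- (r - F) - (r - F)\<^sup>2 / F) = 0"
    using r F by (simp add: field_simps power2_eq_square)
  then show ?thesis
    using suminf_poisson_exp_affine[OF r, of "ln (r / F)" "- (r - F) - (r - F)\<^sup>2 / F"]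
    by (simp add: algebra_simps)
qed

text \<open>The sets where some \<open>g i\<close> exceeds some \<open>1 / real (Suc n)\<close> form
  a relatively open cover; a finite subcover leaves finitely many indices and a common
  margin.\<close>

lemma compact_finite_separation:
  fixes g :: "'i \<Rightarrow> 'a::metric_space \<Rightarrow> real"
  assumes "compact K" and cont: "\<And>i. i \<in> I \<Longrightarrow> continuous_on K (g i)"
    and pos: "\<And>x. x \<in> K \<Longrightarrow> \<exists>i\<in>I. 0 < g i x"
  obtains P \<kappa> where "finite P" "P \<subseteq> I" "0 < \<kappa>" "\<And>x. x \<in> K \<Longrightarrow> \<exists>i\<in>P. \<kappa> \<le> g i x"
proof -
  define U where "U p = K \<inter> g (fst p) -` {1 / real (Suc (snd p))<..}" for p :: "'i \<times> nat"
  have "openin (top_of_set K) u" if "u \<in> U ` (I \<times> UNIV)" for u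
    using that cont unfolding U_def by (auto intro!: continuous_openin_preimage_gen)
  moreover have "K \<subseteq> \<Union>(U ` (I \<times> UNIV))"
  proof
    fix x assume x: "x \<in> K"
    then obtain i where i: "i \<in> I" "0 < g i x" using pos by blast
    then obtain n where "1 / real (Suc n) < g i x" using nat_approx_posE by blast
    with x i have "x \<in> U (i, n)" by (simp add: U_def)
    with i show "x \<in> \<Union>(U ` (I \<times> UNIV))" by blast
  qed
  ultimately obtain D where D: "D \<subseteq> U ` (I \<times> UNIV)" "finite D" "K \<subseteq> \<Union>D"
    using assms(1) unfolding compact_eq_openin_cover by metis
  obtain Q where Q: "Q \<subseteq> I \<times> UNIV" "finite Q" "D = U ` Q"
    using finite_subset_image[OF D(2,1)] by blast
  define k where "k = (\<Sum>p\<in>Q. snd p)"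
  show thesis
  proof (rule that)
    show "finite (fst ` Q)" "fst ` Q \<subseteq> I" using Q by auto
    show "0 < 1 / real (Suc k)" by simp
    fix x assume "x \<in> K"
    then obtain p where p: "p \<in> Q" "x \<in> U p" using D Q by blast
    have "snd p \<le> k" unfolding k_def using p Q by (intro member_le_sum) auto
    then have "1 / real (Suc k) \<le> 1 / real (Suc (snd p))" by (intro divide_left_mono) auto
    also have "\<dots> \<le> g (fst p) x" using p by (simp add: U_def less_imp_le)
    finally show "\<exists>i\<in>fst ` Q. 1 / real (Suc k) \<le> g i x" using p by blast
  qed
qed

lemma finite_supports_bounded:
  fixes P :: "(nat \<Rightarrow> nat) set"
  assumes "finite P" "\<And>y. y \<in> P \<Longrightarrow> finite {j. y j \<noteq> 0}"
  obtains k where "\<And>y j. y \<in> P \<Longrightarrow> k \<le> j \<Longrightarrow> y j = 0"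
proof
  fix y j assume y: "y \<in> P" "Suc (Max (insert 0 (\<Union>y\<in>P. {j. y j \<noteq> 0}))) \<le> j"
  show "y j = 0"
  proof (rule ccontr)
    assume "y j \<noteq> 0"
    then have "j \<le> Max (insert 0 (\<Union>y\<in>P. {j. y j \<noteq> 0}))" using assms y(1) by (intro Max_ge) auto
    with y(2) show False by simp
  qed
qed

lemma sum_of_bool_initial_le:
  assumes "1 \<le> a"
  shows "(\<Sum>t\<in>{a..b}. of_bool (t \<le> int N)) \<le> real N"
proof -
  have "(\<Sum>t\<in>{a..b}. of_bool (t \<le> int N)) = real (card ({a..b} \<inter> {t. t \<le> int N}))"
    by (simp add: sum_of_bool_eq)
  also have "card ({a..b} \<inter> {t. t \<le> int N}) \<le> card {1..int N}"
    using assms by (intro card_mono) auto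
  finally show ?thesis by simp
qed

section \<open>Weighted distance from the past to patterns and to truncated sequences\<close>

lemma suminf_tail_ennreal:
  fixes g :: "nat \<Rightarrow> ennreal"
  assumes "\<And>j. j < N \<Longrightarrow> g j = 0"
  shows "(\<Sum>j. g j) = (\<Sum>j. g (j + N))"
  using suminf_offset[of g N] assms by simp

lemma suminf_tail_le_ennreal:
  fixes g :: "nat \<Rightarrow> ennreal"
  shows "(\<Sum>j. g (j + N)) \<le> (\<Sum>j. g j)"
  using suminf_offset[of g N] by (simp add: add_increasing2)

lemma weighted_past_shift:
  "weighted_past (\<lambda>j. \<beta> (j + N)) Y (t - int N) \<omega> = (\<Sum>j. ennreal (\<beta> (j + N) * real (Y (t - 1 - int (j + N)) \<omega>)))"
  unfolding weighted_past_def by (simp add: algebra_simps)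

text \<open>The truncated past \<open>obs_past\<close> agrees with the pattern as well, but only once \<open>N\<close> observations are available.\<close>

lemma pattern_at_close:
  assumes pat: "pattern_at \<beta> N \<epsilon> y Y t \<omega>" and y: "\<And>j. N \<le> j \<Longrightarrow> y j = 0" and \<beta>: "\<And>j. 0 \<le> \<beta> j"
  shows "(\<Sum>j. ennreal (\<beta> j * \<bar>past Y t \<omega> j - real (y j)\<bar>)) \<le> ennreal \<epsilon>"
    and "int N < t \<Longrightarrow> (\<Sum>j. ennreal (\<beta> j * \<bar>obs_past Y t \<omega> j - real (y j)\<bar>)) \<le> ennreal \<epsilon>"
proof -
  have tail: "(\<Sum>j. ennreal (\<beta> (j + N) * real (Y (t - 1 - int (j + N)) \<omega>))) \<le> ennreal \<epsilon>"
    using pat by (simp only: pattern_at_def weighted_past_shift)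
  have match: "Y (t - 1 - int j) \<omega> = y j" if "j < N" for j
    using pat that by (simp add: pattern_at_def)
  have "(\<Sum>j. ennreal (\<beta> j * \<bar>past Y t \<omega> j - real (y j)\<bar>))
      = (\<Sum>j. ennreal (\<beta> (j + N) * \<bar>past Y t \<omega> (j + N) - real (y (j + N))\<bar>))"
    by (rule suminf_tail_ennreal) (simp add: past_def match)
  also have "\<dots> = (\<Sum>j. ennreal (\<beta> (j + N) * real (Y (t - 1 - int (j + N)) \<omega>)))"
    using y by (simp add: past_def)
  finally show "(\<Sum>j. ennreal (\<beta> j * \<bar>past Y t \<omega> j - real (y j)\<bar>)) \<le> ennreal \<epsilon>"
    using tail by simp
  assume t: "int N < t"
  have "(\<Sum>j. ennreal (\<beta> j * \<bar>obs_past Y t \<omega> j - real (y j)\<bar>))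
      = (\<Sum>j. ennreal (\<beta> (j + N) * \<bar>obs_past Y t \<omega> (j + N) - real (y (j + N))\<bar>))"
    using t by (intro suminf_tail_ennreal) (simp add: obs_past_def match)
  also have "\<dots> \<le> (\<Sum>j. ennreal (\<beta> (j + N) * real (Y (t - 1 - int (j + N)) \<omega>)))"
    using y \<beta> by (intro suminf_le ennreal_leI mult_left_mono) (auto simp: obs_past_def)
  finally show "(\<Sum>j. ennreal (\<beta> j * \<bar>obs_past Y t \<omega> j - real (y j)\<bar>)) \<le> ennreal \<epsilon>"
    using tail by simp
qed

text \<open>Cuts both the length and the values, so that only finitely many sequences arise; over
  these, continuity in the parameter has a common modulus.\<close>

definition truncate_seq :: "nat \<Rightarrow> (nat \<Rightarrow> nat) \<Rightarrow> nat \<Rightarrow> nat" where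
  "truncate_seq n y j = (if j < n then min (y j) n else 0)"

lemma finite_range_truncate_seq: "finite (range (truncate_seq n))"
proof (rule finite_subset)
  show "range (truncate_seq n) \<subseteq> {p. \<forall>j. (j \<in> {..<n} \<longrightarrow> p j \<in> {..n}) \<and> (j \<notin> {..<n} \<longrightarrow> p j = 0)}"
    by (auto simp: truncate_seq_def)
  show "finite {p. \<forall>j. (j \<in> {..<n} \<longrightarrow> p j \<in> {..n}) \<and> (j \<notin> {..<n} \<longrightarrow> p j = (0::nat))}"
    by (rule finite_set_of_finite_funs) auto
qed

text \<open>Dominates the weighted distance between the observed past and its truncation at level \<open>n\<close>.\<close>

definition excess :: "(nat \<Rightarrow> real) \<Rightarrow> nat \<Rightarrow> (int \<Rightarrow> 'w \<Rightarrow> nat) \<Rightarrow> int \<Rightarrow> 'w \<Rightarrow> ennreal" where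
  "excess \<beta> n Y t \<omega> = (\<Sum>j. ennreal (\<beta> j * real (Y (t - 1 - int j) \<omega> - n)))
     + weighted_past (\<lambda>j. \<beta> (j + n)) Y (t - int n) \<omega>"

text \<open>A level \<open>n\<close> beyond the length and the entries of the pattern leaves only
  terms behind the pattern in either part of \<open>excess\<close>, and each part is at most
  \<open>\<epsilon>\<close>.\<close>

lemma excess_le_of_pattern:
  assumes pat: "pattern_at \<beta> N \<epsilon> y Y t \<omega>" and \<beta>: "\<And>j. 0 \<le> \<beta> j"
    and n: "N \<le> n" "\<And>j. j < N \<Longrightarrow> y j \<le> n" and \<epsilon>: "0 \<le> \<epsilon>"
  shows "excess \<beta> n Y t \<omega> \<le> ennreal (2 * \<epsilon>)"
proof -
  let ?w = "\<lambda>j. ennreal (\<beta> j * real (Y (t - 1 - int j) \<omega>))"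
  have tail: "(\<Sum>j. ?w (j + N)) \<le> ennreal \<epsilon>"
    using pat by (simp only: pattern_at_def weighted_past_shift)
  have "(\<Sum>j. ennreal (\<beta> j * real (Y (t - 1 - int j) \<omega> - n)))
      = (\<Sum>j. ennreal (\<beta> (j + N) * real (Y (t - 1 - int (j + N)) \<omega> - n)))"
    by (rule suminf_tail_ennreal) (use pat n in \<open>simp add: pattern_at_def\<close>)
  also have "\<dots> \<le> (\<Sum>j. ?w (j + N))"
    using \<beta> by (intro suminf_le ennreal_leI mult_left_mono) auto
  finally have 1: "(\<Sum>j. ennreal (\<beta> j * real (Y (t - 1 - int j) \<omega> - n))) \<le> ennreal \<epsilon>"
    using tail by simp
  have "weighted_past (\<lambda>j. \<beta> (j + n)) Y (t - int n) \<omega> = (\<Sum>j. ?w (j + (n - N) + N))"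
    unfolding weighted_past_shift using n(1) by simp
  also have "\<dots> \<le> (\<Sum>j. ?w (j + N))" by (rule suminf_tail_le_ennreal[of "\<lambda>j. ?w (j + N)"])
  also note tail
  finally have "excess \<beta> n Y t \<omega> \<le> ennreal \<epsilon> + ennreal \<epsilon>"
    unfolding excess_def using 1 by (intro add_mono)
  then show ?thesis using \<epsilon> by (simp flip: ennreal_plus)
qed

lemma (in count_process) excess_measurable: "excess \<beta> n Y t \<in> borel_measurable (F (t - 1))"
proof -
  have [measurable]: "Y (t - 1 - int j) \<in> measurable (F (t - 1)) (count_space UNIV)" for j
    by (intro Y_history) simp
  have [measurable]: "weighted_past (\<lambda>j. \<beta> (j + n)) Y (t - int n) \<in> borel_measurable (F (t - 1))"
    by (rule weighted_past_measurable) simp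
  show ?thesis unfolding excess_def[abs_def] by measurable
qed

lemma (in count_process) pattern_at_measurable:
  "{\<omega> \<in> space M. pattern_at \<beta> N \<epsilon> y Y t \<omega>} \<in> sets (F (t - 1))"
proof -
  have [measurable]: "Y (t - 1 - int j) \<in> measurable (F (t - 1)) (count_space UNIV)" for j
    by (intro Y_history) simp
  have [measurable]: "weighted_past (\<lambda>j. \<beta> (j + N)) Y (t - int N) \<in> borel_measurable (F (t - 1))"
    by (rule weighted_past_measurable) simp
  have "Measurable.pred (F (t - 1)) (pattern_at \<beta> N \<epsilon> y Y t)"
    unfolding pattern_at_def[abs_def] by measurable
  then show ?thesis by (simp add: pred_def)
qed

text \<open>The case \<open>C = 0\<close> of \<open>huber_weighted_sum\<close>: for
  \<open>K \<ge> q\<close> the left side is already the square, and the Huber function never exceeds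
  it.\<close>

lemma weighted_square_le:
  fixes \<beta> x :: "nat \<Rightarrow> real"
  assumes \<beta>: "\<And>j. 0 \<le> \<beta> j" "summable \<beta>" "suminf \<beta> < 1" and x: "\<And>j. 0 \<le> x j" and q: "0 \<le> q"
    and le: "ennreal q \<le> (\<Sum>j. ennreal (\<beta> j * x j))"
  shows "ennreal (q\<^sup>2) \<le> (\<Sum>j. ennreal (\<beta> j * (x j)\<^sup>2))"
proof -
  define K where "K = max 1 q"
  have K: "1 \<le> K" "q \<le> K" by (auto simp: K_def)
  have "ennreal (huber K q) \<le> ennreal (0\<^sup>2 / (1 - suminf \<beta>)) + (\<Sum>j. ennreal (\<beta> j * huber K (x j)))"
    by (intro huber_weighted_sum \<beta> x q K(1)) (use le in auto)
  then have "ennreal (q\<^sup>2) \<le> (\<Sum>j. ennreal (\<beta> j * huber K (x j)))"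
    using K by (simp add: huber_eq)
  also have "\<dots> \<le> (\<Sum>j. ennreal (\<beta> j * (x j)\<^sup>2))"
  proof (intro suminf_le ennreal_leI mult_left_mono \<beta>)
    fix j
    have "0 \<le> (x j - min (x j) K)\<^sup>2" by simp
    then show "huber K (x j) \<le> (x j)\<^sup>2" unfolding huber_def by (simp add: power2_diff algebra_simps)
  qed auto
  finally show ?thesis .
qed

context bounded_process
begin

text \<open>Subtraction of naturals yields the positive part, which is at most
  \<open>x^2 / n\<close>. The second moment therefore makes the mean excess tend to 0 with growing
  \<open>n\<close>.\<close>

lemma nn_integral_excess_le:
  assumes "0 < n"
  shows "(\<integral>\<^sup>+\<omega>. excess \<alpha> n Y t \<omega> \<partial>M) \<le> ennreal (B / real n + (\<Sum>j. \<alpha> (j + n)) * B)"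
proof -
  have s: "summable (\<lambda>j. \<alpha> (j + n))" using \<alpha>_summable by (rule summable_ignore_initial_segment)
  have Yn: "(\<integral>\<^sup>+\<omega>. ennreal (real (Y u \<omega> - n)) \<partial>M) \<le> ennreal (B / real n)" for u
  proof -
    have le: "real (x - n) \<le> (real x)\<^sup>2 / real n" for x
    proof (cases "x \<le> n")
      case False
      then have "(real x - real n) * real n \<le> real x * real x" by (intro mult_mono) auto
      then show ?thesis using assms False by (simp add: field_simps power2_eq_square of_nat_diff)
    qed simp
    have "(\<integral>\<^sup>+\<omega>. ennreal (real (Y u \<omega> - n)) \<partial>M) \<le> (\<integral>\<^sup>+\<omega>. ennreal (1 / real n) * ennreal ((real (Y u \<omega>))\<^sup>2) \<partial>M)"
      using le by (intro nn_integral_mono) (simp add: ennreal_leI le flip: ennreal_mult'')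
    also have "\<dots> = ennreal (1 / real n) * (\<integral>\<^sup>+\<omega>. ennreal ((real (Y u \<omega>))\<^sup>2) \<partial>M)"
      by (rule nn_integral_cmult) measurable
    also have "\<dots> \<le> ennreal (1 / real n) * ennreal B" by (intro mult_left_mono second_moment) auto
    finally show ?thesis by (simp flip: ennreal_mult')
  qed
  have "(\<integral>\<^sup>+\<omega>. (\<Sum>j. ennreal (\<alpha> j * real (Y (t - 1 - int j) \<omega> - n))) \<partial>M) \<le> ennreal (suminf \<alpha>) * ennreal (B / real n)"
    by (rule nn_integral_weighted_past_le[where g="\<lambda>x. real (x - n)", OF \<alpha>_nonneg \<alpha>_summable Yn])
  also have "\<dots> \<le> ennreal 1 * ennreal (B / real n)"
    using \<alpha>_less_1 by (intro mult_right_mono ennreal_leI) auto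
  finally have 1: "(\<integral>\<^sup>+\<omega>. (\<Sum>j. ennreal (\<alpha> j * real (Y (t - 1 - int j) \<omega> - n))) \<partial>M) \<le> ennreal (B / real n)"
    by simp
  have [measurable]: "weighted_past (\<lambda>j. \<alpha> (j + n)) Y (t - int n) \<in> borel_measurable M"
    by (rule history_measurable[OF weighted_past_measurable[OF order_refl]])
  have "(\<integral>\<^sup>+\<omega>. excess \<alpha> n Y t \<omega> \<partial>M) = (\<integral>\<^sup>+\<omega>. (\<Sum>j. ennreal (\<alpha> j * real (Y (t - 1 - int j) \<omega> - n))) \<partial>M)
      + (\<integral>\<^sup>+\<omega>. weighted_past (\<lambda>j. \<alpha> (j + n)) Y (t - int n) \<omega> \<partial>M)"
    unfolding excess_def by (rule nn_integral_add) measurable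
  also have "\<dots> \<le> ennreal (B / real n) + ennreal ((\<Sum>j. \<alpha> (j + n)) * B)"
    by (intro add_mono 1 nn_integral_weighted_past_bounded \<alpha>_nonneg s)
  also have "\<dots> = ennreal (B / real n + (\<Sum>j. \<alpha> (j + n)) * B)"
    using B_nonneg \<alpha>_nonneg s by (intro ennreal_plus[symmetric] mult_nonneg_nonneg suminf_nonneg) auto
  finally show ?thesis .
qed

text \<open>Compare at the truncated sequence, where \<open>close\<close> applies; passing to it
  from the observed past costs one \<open>excess\<close> for each of the two parameters.\<close>

lemma truncation_close:
  assumes \<theta>: "\<theta> \<in> \<Theta>" "\<theta>' \<in> \<Theta>"
    and close: "\<And>x. \<bar>f \<theta>' (\<lambda>j. real (truncate_seq n x j)) - f \<theta> (\<lambda>j. real (truncate_seq n x j))\<bar> \<le> \<epsilon>"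
    and \<epsilon>: "0 \<le> \<epsilon>" and fin: "excess \<alpha> n Y t \<omega> < \<infinity>"
  shows "\<bar>f \<theta>' (obs_past Y t \<omega>) - f \<theta> (obs_past Y t \<omega>)\<bar> \<le> \<epsilon> + 2 * enn2real (excess \<alpha> n Y t \<omega>)"
proof -
  define x where "x j = (if 1 \<le> t - 1 - int j then Y (t - 1 - int j) \<omega> else 0)" for j
  let ?o = "obs_past Y t \<omega>" and ?t = "\<lambda>j. real (truncate_seq n x j)"
  have tr: "?t \<in> nonneg_seqs" by (simp add: nonneg_seqs_def)
  have "(\<Sum>j. ennreal (\<alpha> j * \<bar>?o j - ?t j\<bar>)) \<le> (\<Sum>j. ennreal (\<alpha> j * real (Y (t - 1 - int j) \<omega> - n))
      + (if j < n then 0 else ennreal (\<alpha> j * real (Y (t - 1 - int j) \<omega>))))"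
  proof (rule suminf_le)
    fix j
    show "ennreal (\<alpha> j * \<bar>?o j - ?t j\<bar>) \<le> ennreal (\<alpha> j * real (Y (t - 1 - int j) \<omega> - n))
      + (if j < n then 0 else ennreal (\<alpha> j * real (Y (t - 1 - int j) \<omega>)))"
    proof (cases "j < n")
      case True
      then have "\<bar>?o j - ?t j\<bar> \<le> real (Y (t - 1 - int j) \<omega> - n)"
        by (auto simp: obs_past_def truncate_seq_def x_def)
      with True show ?thesis using \<alpha>_nonneg by (simp add: ennreal_leI mult_left_mono)
    next
      case False
      then have "\<bar>?o j - ?t j\<bar> \<le> real (Y (t - 1 - int j) \<omega>)"
        by (auto simp: obs_past_def truncate_seq_def)
      with False show ?thesis using \<alpha>_nonneg by (simp add: add_increasing ennreal_leI mult_left_mono)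
    qed
  qed auto
  also have "\<dots> = (\<Sum>j. ennreal (\<alpha> j * real (Y (t - 1 - int j) \<omega> - n)))
      + (\<Sum>j. if j < n then 0 else ennreal (\<alpha> j * real (Y (t - 1 - int j) \<omega>)))"
    by (rule suminf_add[symmetric]) auto
  also have "(\<Sum>j. if j < n then 0 else ennreal (\<alpha> j * real (Y (t - 1 - int j) \<omega>)))
      = weighted_past (\<lambda>j. \<alpha> (j + n)) Y (t - int n) \<omega>"
    unfolding weighted_past_shift by (subst suminf_tail_ennreal[of n]) auto
  finally have le: "(\<Sum>j. ennreal (\<alpha> j * \<bar>?o j - ?t j\<bar>)) \<le> excess \<alpha> n Y t \<omega>"
    unfolding excess_def .
  have "\<bar>f u ?o - f u ?t\<bar> \<le> enn2real (excess \<alpha> n Y t \<omega>)" if "u \<in> \<Theta>" for u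
  proof -
    have "ennreal \<bar>f u ?o - f u ?t\<bar> \<le> excess \<alpha> n Y t \<omega>"
      using f_lipschitz[OF that obs_past_nonneg tr] le by (rule order_trans)
    also have "\<dots> = ennreal (enn2real (excess \<alpha> n Y t \<omega>))" using fin by simp
    finally show ?thesis by (simp add: ennreal_le_iff)
  qed
  from this[OF \<theta>(1)] this[OF \<theta>(2)] close[of x] show ?thesis by linarith
qed

text \<open>The shifted index runs through the times 0 and earlier, which \<open>obs_past\<close>
  replaces by zeros. Squares appear because the compensator in the likelihood comparison is
  quadratic in the intensity error.\<close>

definition start_effect :: "int \<Rightarrow> 'w \<Rightarrow> ennreal" where
  "start_effect t \<omega> = (\<Sum>j. ennreal (\<alpha> (j + nat (t - 1)) * (real (Y (t - 1 - int (j + nat (t - 1))) \<omega>))\<^sup>2))"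

lemma start_effect:
  assumes \<theta>: "\<theta> \<in> \<Theta>" and t: "1 \<le> t"
  shows "ennreal ((f \<theta> (past Y t \<omega>) - f \<theta> (obs_past Y t \<omega>))\<^sup>2) \<le> start_effect t \<omega>"
proof -
  let ?q = "\<bar>f \<theta> (past Y t \<omega>) - f \<theta> (obs_past Y t \<omega>)\<bar>" and ?k = "nat (t - 1)"
  let ?x = "\<lambda>j. \<bar>past Y t \<omega> j - obs_past Y t \<omega> j\<bar>"
  have x: "?x j = (if j < ?k then 0 else real (Y (t - 1 - int j) \<omega>))" for j
    using t by (auto simp: past_def obs_past_def)
  have "ennreal (?q\<^sup>2) \<le> (\<Sum>j. ennreal (\<alpha> j * (?x j)\<^sup>2))"
    by (intro weighted_square_le \<alpha>_nonneg \<alpha>_summable \<alpha>_less_1 f_lipschitz[OF \<theta> past_nonneg obs_past_nonneg]) auto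
  also have "\<dots> = (\<Sum>j. ennreal (\<alpha> (j + ?k) * (?x (j + ?k))\<^sup>2))"
    by (rule suminf_tail_ennreal) (simp add: x)
  also have "\<dots> = start_effect t \<omega>"
    unfolding start_effect_def by (simp only: x) simp
  finally show ?thesis by simp
qed

lemma start_effect_measurable: "start_effect t \<in> borel_measurable M"
  unfolding start_effect_def[abs_def] by measurable

lemma nn_integral_start_effect_le:
  "(\<integral>\<^sup>+\<omega>. start_effect t \<omega> \<partial>M) \<le> ennreal ((\<Sum>j. \<alpha> (j + nat (t - 1))) * B)"
proof -
  let ?k = "nat (t - 1)"
  have s: "summable (\<lambda>j. \<alpha> (j + ?k))" using \<alpha>_summable by (rule summable_ignore_initial_segment)
  have "(\<integral>\<^sup>+\<omega>. start_effect t \<omega> \<partial>M)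
      = (\<integral>\<^sup>+\<omega>. (\<Sum>j. ennreal (\<alpha> (j + ?k) * (real (Y (t - int ?k - 1 - int j) \<omega>))\<^sup>2)) \<partial>M)"
    unfolding start_effect_def by (simp add: algebra_simps)
  also have "\<dots> \<le> ennreal (\<Sum>j. \<alpha> (j + ?k)) * ennreal B"
    by (rule nn_integral_weighted_past_le[where g="\<lambda>x. (real x)\<^sup>2", OF \<alpha>_nonneg s second_moment])
  finally show ?thesis
    using s \<alpha>_nonneg by (simp add: ennreal_mult' suminf_nonneg)
qed

end

section \<open>Tails of the Lipschitz coefficients and uniform continuity in the parameter\<close>

context intensity
begin

lemma tail_sum_eventually_small:
  assumes "0 < \<tau>" "0 \<le> B"
  obtains N1 where "\<And>n. N1 \<le> n \<Longrightarrow> (\<Sum>j. \<alpha> (j + n)) * B \<le> \<tau>"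
proof -
  have "0 < \<tau> / (B + 1)" using assms by simp
  from suminf_exist_split[OF this \<alpha>_summable] obtain N1 where
    N1: "\<And>n. N1 \<le> n \<Longrightarrow> norm (\<Sum>i. \<alpha> (i + n)) < \<tau> / (B + 1)" by blast
  show thesis
  proof (rule that)
    fix n assume "N1 \<le> n"
    then have "(\<Sum>j. \<alpha> (j + n)) * B \<le> \<tau> / (B + 1) * B"
      using N1[of n] assms by (intro mult_right_mono) auto
    also have "\<dots> \<le> \<tau>" using assms by (simp add: field_simps)
    finally show "(\<Sum>j. \<alpha> (j + n)) * B \<le> \<tau>" .
  qed
qed

lemma tail_sum_mono: "m \<le> n \<Longrightarrow> (\<Sum>j. \<alpha> (j + n)) \<le> (\<Sum>j. \<alpha> (j + m))"
proof -
  assume "m \<le> n"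
  have s: "summable (\<lambda>j. \<alpha> (j + m))" using \<alpha>_summable by (rule summable_ignore_initial_segment)
  show ?thesis
    using suminf_split_initial_segment[OF s, of "n - m"] \<open>m \<le> n\<close> sum_nonneg[of "{..<n - m}" "\<lambda>j. \<alpha> (j + m)"] \<alpha>_nonneg
    by simp
qed

lemma tail_sum_bounds: "0 \<le> (\<Sum>j. \<alpha> (j + n))" "(\<Sum>j. \<alpha> (j + n)) \<le> 1"
proof -
  have s: "summable (\<lambda>j. \<alpha> (j + n))" using \<alpha>_summable by (rule summable_ignore_initial_segment)
  show "0 \<le> (\<Sum>j. \<alpha> (j + n))" by (rule suminf_nonneg[OF s \<alpha>_nonneg])
  show "(\<Sum>j. \<alpha> (j + n)) \<le> 1" using tail_sum_mono[of 0 n] \<alpha>_less_1 by simp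
qed

lemma uniform_modulus:
  assumes Q: "finite Q" "Q \<subseteq> nonneg_seqs" and \<epsilon>: "0 < \<epsilon>"
  obtains r where "0 < r" "\<And>y \<theta> \<theta>'. y \<in> Q \<Longrightarrow> \<theta> \<in> \<Theta> \<Longrightarrow> \<theta>' \<in> \<Theta> \<Longrightarrow> dist \<theta>' \<theta> < r \<Longrightarrow> \<bar>f \<theta>' y - f \<theta> y\<bar> \<le> \<epsilon>"
proof -
  have "\<forall>y\<in>Q. \<exists>r>0. \<forall>\<theta>\<in>\<Theta>. \<forall>\<theta>'\<in>\<Theta>. dist \<theta>' \<theta> < r \<longrightarrow> dist (f \<theta>' y) (f \<theta> y) < \<epsilon>"
  proof
    fix y assume "y \<in> Q"
    then have "uniformly_continuous_on \<Theta> (\<lambda>\<theta>. f \<theta> y)"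
      using Q f_continuous compact_params by (intro compact_uniformly_continuous) auto
    then show "\<exists>r>0. \<forall>\<theta>\<in>\<Theta>. \<forall>\<theta>'\<in>\<Theta>. dist \<theta>' \<theta> < r \<longrightarrow> dist (f \<theta>' y) (f \<theta> y) < \<epsilon>"
      unfolding uniformly_continuous_on_def using \<epsilon> by blast
  qed
  then obtain r where r: "\<And>y. y \<in> Q \<Longrightarrow> 0 < r y"
    "\<And>y \<theta> \<theta>'. y \<in> Q \<Longrightarrow> \<theta> \<in> \<Theta> \<Longrightarrow> \<theta>' \<in> \<Theta> \<Longrightarrow> dist \<theta>' \<theta> < r y \<Longrightarrow> dist (f \<theta>' y) (f \<theta> y) < \<epsilon>"
    unfolding bchoice_iff by blast
  show thesis
  proof (rule that)
    let ?r = "Min (insert 1 (r ` Q))"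
    show "0 < ?r" using Q r by auto
    fix y \<theta> \<theta>' assume h: "y \<in> Q" "\<theta> \<in> \<Theta>" "\<theta>' \<in> \<Theta>" "dist \<theta>' \<theta> < ?r"
    have "?r \<le> r y" using h Q by (intro Min_le) auto
    then have "dist (f \<theta>' y) (f \<theta> y) < \<epsilon>" using r(2) h by (meson order_less_le_trans)
    then show "\<bar>f \<theta>' y - f \<theta> y\<bar> \<le> \<epsilon>" by (simp add: dist_real_def)
  qed
qed

end

section \<open>Likelihood ratios along the observed past\<close>

context bounded_process
begin

text \<open>The exponent is half a log-likelihood ratio; by \<open>suminf_poisson_hellinger\<close>
  its mean carries a factor of at most \<open>exp (- \<kappa>)\<close> on \<open>G\<close>. The
  linear term uses the lower envelope instead of the upper one, which costs \<open>2 * g\<close>, so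
  that one bound covers all intensities between the envelopes.\<close>

lemma whp_log_lik_gap:
  fixes g :: "int \<Rightarrow> 'w \<Rightarrow> real" and G :: "int \<Rightarrow> 'w \<Rightarrow> bool"
  assumes \<theta>: "\<theta> \<in> \<Theta>"
    and g: "\<And>t. g t \<in> borel_measurable (F (t - 1))" "\<And>t \<omega>. 0 \<le> g t \<omega>"
    and G: "\<And>t. {\<omega> \<in> space M. G t \<omega>} \<in> sets (F (t - 1))"
    and gap: "\<And>t \<omega>. t \<in> {a..b} \<Longrightarrow> \<omega> \<in> space M \<Longrightarrow> G t \<omega> \<Longrightarrow>
      \<kappa> \<le> 1 / 2 * (sqrt (f \<theta> (obs_past Y t \<omega>) + g t \<omega>) - sqrt (lam t \<omega>))\<^sup>2"
  shows "whp (exp (- z)) (\<lambda>\<omega>. (\<Sum>t\<in>{a..b}. real (Y t \<omega>) * ln ((f \<theta> (obs_past Y t \<omega>) + g t \<omega>) / lam t \<omega>)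
      - (f \<theta> (obs_past Y t \<omega>) - g t \<omega> - lam t \<omega>))
      \<le> 2 * z + 2 * (\<Sum>t\<in>{a..b}. g t \<omega>) - 2 * \<kappa> * (\<Sum>t\<in>{a..b}. of_bool (G t \<omega>)))"
proof -
  let ?o = "\<lambda>t \<omega>. f \<theta> (obs_past Y t \<omega>)" and ?F = "\<lambda>t \<omega>. f \<theta> (obs_past Y t \<omega>) + g t \<omega>"
  define \<xi> where "\<xi> t \<omega> n = 1 / 2 * (real n * ln (?F t \<omega> / lam t \<omega>) - (?F t \<omega> - lam t \<omega>)) + \<kappa> * of_bool (G t \<omega>)"
    for t \<omega> n
  have "whp (exp (- z)) (\<lambda>\<omega>. (\<Sum>t\<in>{a..b}. \<xi> t \<omega> (Y t \<omega>)) < z)"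
  proof (rule whp_exp_supermartingale)
    fix t n
    have [measurable]: "Measurable.pred (F (t - 1)) (G t)" using G by (simp add: pred_def)
    note g(1)[measurable] f_past_measurable(2)[OF \<theta>, measurable] lam_measurable[measurable]
    show "(\<lambda>\<omega>. \<xi> t \<omega> n) \<in> borel_measurable (F (t - 1))"
      unfolding \<xi>_def of_bool_def by measurable
  next
    fix t \<omega> assume t: "t \<in> {a..b}" "\<omega> \<in> space M"
    have "0 < ?F t \<omega>" using f_pos[OF \<theta> obs_past_nonneg] g(2) by (rule add_pos_nonneg)
    then have "(\<Sum>n. ennreal (pmf (poisson_pmf (lam t \<omega>)) n) * ennreal (exp (\<xi> t \<omega> n)))
        = ennreal (exp (\<kappa> * of_bool (G t \<omega>) - 1 / 2 * (sqrt (?F t \<omega>) - sqrt (lam t \<omega>))\<^sup>2))"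
      unfolding \<xi>_def using lam_pos[OF t(2)] by (intro suminf_poisson_hellinger)
    also have "\<dots> \<le> ennreal 1"
      using gap[OF t] by (intro ennreal_leI) auto
    finally show "(\<Sum>n. ennreal (pmf (poisson_pmf (lam t \<omega>)) n) * ennreal (exp (\<xi> t \<omega> n))) \<le> 1" by simp
  qed
  then show ?thesis
  proof (rule whp_mono)
    fix \<omega> assume lt: "(\<Sum>t\<in>{a..b}. \<xi> t \<omega> (Y t \<omega>)) < z"
    have "(\<Sum>t\<in>{a..b}. real (Y t \<omega>) * ln (?F t \<omega> / lam t \<omega>) - (?o t \<omega> - g t \<omega> - lam t \<omega>))
        = (\<Sum>t\<in>{a..b}. 2 * \<xi> t \<omega> (Y t \<omega>) + 2 * g t \<omega> - 2 * \<kappa> * of_bool (G t \<omega>))"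
      by (rule sum.cong) (simp_all add: \<xi>_def field_simps)
    also have "\<dots> = 2 * (\<Sum>t\<in>{a..b}. \<xi> t \<omega> (Y t \<omega>)) + 2 * (\<Sum>t\<in>{a..b}. g t \<omega>) - 2 * \<kappa> * (\<Sum>t\<in>{a..b}. of_bool (G t \<omega>))"
      by (simp add: sum.distrib sum_subtractf sum_distrib_left)
    finally show "(\<Sum>t\<in>{a..b}. real (Y t \<omega>) * ln (?F t \<omega> / lam t \<omega>) - (?o t \<omega> - g t \<omega> - lam t \<omega>))
        \<le> 2 * z + 2 * (\<Sum>t\<in>{a..b}. g t \<omega>) - 2 * \<kappa> * (\<Sum>t\<in>{a..b}. of_bool (G t \<omega>))"
      using lt by linarith
  qed simp
qed

text \<open>The reverse comparison: the observed-past likelihood at \<open>\<theta>\<close> falls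
  short of the true one by little more than the compensator of
  \<open>suminf_poisson_chi_square\<close>.\<close>

lemma whp_log_lik_start:
  assumes \<theta>: "\<theta> \<in> \<Theta>"
  shows "whp (exp (- z)) (\<lambda>\<omega>. (\<Sum>t\<in>{a..b}. real (Y t \<omega>) * ln (lam t \<omega> / f \<theta> (obs_past Y t \<omega>))
      - (lam t \<omega> - f \<theta> (obs_past Y t \<omega>)))
      \<le> z + (\<Sum>t\<in>{a..b}. (lam t \<omega> - f \<theta> (obs_past Y t \<omega>))\<^sup>2 / f \<theta> (obs_past Y t \<omega>)))"
proof -
  let ?o = "\<lambda>t \<omega>. f \<theta> (obs_past Y t \<omega>)"
  define \<xi> where "\<xi> t \<omega> n = real n * ln (lam t \<omega> / ?o t \<omega>) - (lam t \<omega> - ?o t \<omega>) - (lam t \<omega> - ?o t \<omega>)\<^sup>2 / ?o t \<omega>"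
    for t \<omega> n
  have "whp (exp (- z)) (\<lambda>\<omega>. (\<Sum>t\<in>{a..b}. \<xi> t \<omega> (Y t \<omega>)) < z)"
  proof (rule whp_exp_supermartingale)
    fix t n
    note f_past_measurable(2)[OF \<theta>, measurable] lam_measurable[measurable]
    show "(\<lambda>\<omega>. \<xi> t \<omega> n) \<in> borel_measurable (F (t - 1))"
      unfolding \<xi>_def by measurable
  next
    fix t \<omega> assume t: "t \<in> {a..b}" "\<omega> \<in> space M"
    show "(\<Sum>n. ennreal (pmf (poisson_pmf (lam t \<omega>)) n) * ennreal (exp (\<xi> t \<omega> n))) \<le> 1"
      unfolding \<xi>_def using lam_pos[OF t(2)] f_pos[OF \<theta> obs_past_nonneg]
      by (intro eq_refl suminf_poisson_chi_square)
  qed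
  then show ?thesis
    by (rule whp_mono) (auto simp: \<xi>_def sum_subtractf)
qed

text \<open>Each of the first \<open>N\<close> times costs at most \<open>B\<close> in the mean,
  each later one at most \<open>\<tau>\<close>; a long window absorbs the former.\<close>

lemma whp_start_effect:
  assumes a: "1 \<le> a" "a \<le> b" and K: "0 < K" and \<tau>: "(\<Sum>j. \<alpha> (j + N)) * B \<le> \<tau>" "real N * B \<le> \<tau> * real_of_int (b - a + 1)"
  shows "whp (2 * \<tau> * real_of_int (b - a + 1) / K) (\<lambda>\<omega>. (\<Sum>t\<in>{a..b}. start_effect t \<omega>) < ennreal K)"
proof (rule whp_markov)
  let ?n = "real_of_int (b - a + 1)" and ?A = "\<lambda>k. \<Sum>j. \<alpha> (j + k)"
  note start_effect_measurable[measurable]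
  show "(\<lambda>\<omega>. \<Sum>t\<in>{a..b}. start_effect t \<omega>) \<in> borel_measurable M" by measurable
  have card: "real (card {a..b}) = ?n" using a by simp
  have "0 \<le> \<tau>" using \<tau>(1) B_nonneg tail_sum_bounds(1)[of N] by (meson mult_nonneg_nonneg order_trans)
  then show "0 \<le> 2 * \<tau> * ?n" using a by simp
  have "(\<integral>\<^sup>+\<omega>. (\<Sum>t\<in>{a..b}. start_effect t \<omega>) \<partial>M) = (\<Sum>t\<in>{a..b}. \<integral>\<^sup>+\<omega>. start_effect t \<omega> \<partial>M)"
    by (rule nn_integral_sum) measurable
  also have "\<dots> \<le> (\<Sum>t\<in>{a..b}. ennreal (?A (nat (t - 1)) * B))"
    by (intro sum_mono nn_integral_start_effect_le)
  also have "\<dots> = ennreal (\<Sum>t\<in>{a..b}. ?A (nat (t - 1)) * B)"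
    using tail_sum_bounds B_nonneg by (intro sum_ennreal) auto
  also have "\<dots> \<le> ennreal (2 * \<tau> * ?n)"
  proof (rule ennreal_leI)
    have "(\<Sum>t\<in>{a..b}. ?A (nat (t - 1)) * B) \<le> (\<Sum>t\<in>{a..b}. of_bool (t \<le> int N) * B + \<tau>)"
    proof (rule sum_mono)
      fix t assume t: "t \<in> {a..b}"
      show "?A (nat (t - 1)) * B \<le> of_bool (t \<le> int N) * B + \<tau>"
      proof (cases "t \<le> int N")
        case True
        have "?A (nat (t - 1)) * B \<le> 1 * B" using tail_sum_bounds B_nonneg by (intro mult_right_mono)
        then show ?thesis using True \<open>0 \<le> \<tau>\<close> by simp
      next
        case False
        then have "N \<le> nat (t - 1)" by simp
        then have "?A (nat (t - 1)) * B \<le> ?A N * B" using B_nonneg by (intro mult_right_mono tail_sum_mono)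
        then show ?thesis using False \<tau>(1) by simp
      qed
    qed
    also have "\<dots> = (\<Sum>t\<in>{a..b}. of_bool (t \<le> int N)) * B + ?n * \<tau>"
      using card by (simp only: sum.distrib sum_constant sum_distrib_right)
    also have "(\<Sum>t\<in>{a..b}. of_bool (t \<le> int N)) * B \<le> real N * B"
      by (intro mult_right_mono B_nonneg sum_of_bool_initial_le a)
    also note \<tau>(2)
    finally show "(\<Sum>t\<in>{a..b}. ?A (nat (t - 1)) * B) \<le> 2 * \<tau> * ?n" by (simp add: algebra_simps)
  qed
  finally show "(\<integral>\<^sup>+\<omega>. (\<Sum>t\<in>{a..b}. start_effect t \<omega>) \<partial>M) \<le> ennreal (2 * \<tau> * ?n)" .
qed (rule K)

lemma whp_excess:
  assumes ab: "a \<le> b" and n: "0 < n" and K: "0 < K" and \<tau>: "B / real n + (\<Sum>j. \<alpha> (j + n)) * B \<le> \<tau>"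
  shows "whp (\<tau> * real_of_int (b - a + 1) / K) (\<lambda>\<omega>. (\<Sum>t\<in>{a..b}. excess \<alpha> n Y t \<omega>) < ennreal K)"
proof (rule whp_markov)
  have [measurable]: "excess \<alpha> n Y t \<in> borel_measurable M" for t
    by (rule history_measurable[OF excess_measurable])
  show "(\<lambda>\<omega>. \<Sum>t\<in>{a..b}. excess \<alpha> n Y t \<omega>) \<in> borel_measurable M" by measurable
  have card: "real (card {a..b}) = real_of_int (b - a + 1)" using ab by simp
  have "0 \<le> B / real n + (\<Sum>j. \<alpha> (j + n)) * B"
    using B_nonneg tail_sum_bounds by (intro add_nonneg_nonneg) auto
  then have "0 \<le> \<tau>" using \<tau> by linarith
  then show "0 \<le> \<tau> * real_of_int (b - a + 1)" using ab by simp
  have "(\<integral>\<^sup>+\<omega>. (\<Sum>t\<in>{a..b}. excess \<alpha> n Y t \<omega>) \<partial>M) = (\<Sum>t\<in>{a..b}. \<integral>\<^sup>+\<omega>. excess \<alpha> n Y t \<omega> \<partial>M)"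
    by (rule nn_integral_sum) measurable
  also have "\<dots> \<le> of_nat (card {a..b}) * ennreal \<tau>"
    using \<tau> by (intro sum_bounded_above order_trans[OF nn_integral_excess_le[OF n]] ennreal_leI)
  also have "\<dots> = ennreal (real_of_int (b - a + 1) * \<tau>)"
    using \<open>0 \<le> \<tau>\<close> by (simp only: ennreal_of_nat_eq_real_of_nat ennreal_mult''[symmetric] card)
  finally show "(\<integral>\<^sup>+\<omega>. (\<Sum>t\<in>{a..b}. excess \<alpha> n Y t \<omega>) \<partial>M) \<le> ennreal (\<tau> * real_of_int (b - a + 1))"
    by (simp add: mult.commute)
qed (rule K)

end

lemma (in bounded_process) pattern_gap:
  assumes y: "\<And>j. N \<le> j \<Longrightarrow> y j = 0" and L: "\<And>j. y j \<le> L" "L \<le> n" "N \<le> n"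
    and \<theta>: "\<theta> \<in> \<Theta>" "\<theta>' \<in> \<Theta>" "th t = \<theta>'" and gap: "16 * \<epsilon> \<le> \<bar>f \<theta> (\<lambda>j. real (y j)) - f \<theta>' (\<lambda>j. real (y j))\<bar>"
    and \<epsilon>: "0 < \<epsilon>" "0 \<le> \<epsilon>'" "\<epsilon>' \<le> \<epsilon>" and pat: "pattern_at \<alpha> N \<epsilon> y Y t \<omega>" and t: "int N < t"
  shows "8 * \<epsilon>\<^sup>2 / (C + real L + 6 * \<epsilon>) \<le> 1 / 2 * (sqrt (f \<theta> (obs_past Y t \<omega>) + (\<epsilon>' + 2 * enn2real (excess \<alpha> n Y t \<omega>))) - sqrt (lam t \<omega>))\<^sup>2"
proof -
  let ?y = "\<lambda>j. real (y j)" and ?F = "f \<theta> (obs_past Y t \<omega>) + (\<epsilon>' + 2 * enn2real (excess \<alpha> n Y t \<omega>))"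
  have yn: "?y \<in> nonneg_seqs" by (simp add: nonneg_seqs_def)
  have "excess \<alpha> n Y t \<omega> \<le> ennreal (2 * \<epsilon>)"
    using L \<epsilon> by (intro excess_le_of_pattern[OF pat \<alpha>_nonneg]) (auto intro: order_trans)
  then have ex: "enn2real (excess \<alpha> n Y t \<omega>) \<le> 2 * \<epsilon>" using \<epsilon> by (simp add: enn2real_leI)
  have "ennreal \<bar>f \<theta>' (past Y t \<omega>) - f \<theta>' ?y\<bar> \<le> ennreal \<epsilon>"
    using f_lipschitz[OF \<theta>(2) past_nonneg yn] pattern_at_close(1)[OF pat y \<alpha>_nonneg] by (rule order_trans)
  then have 1: "\<bar>lam t \<omega> - f \<theta>' ?y\<bar> \<le> \<epsilon>" using \<epsilon> \<theta>(3) by (simp add: ennreal_le_iff)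
  have "ennreal \<bar>f \<theta> (obs_past Y t \<omega>) - f \<theta> ?y\<bar> \<le> ennreal \<epsilon>"
    using f_lipschitz[OF \<theta>(1) obs_past_nonneg yn] pattern_at_close(2)[OF pat y \<alpha>_nonneg t] by (rule order_trans)
  then have 2: "\<bar>f \<theta> (obs_past Y t \<omega>) - f \<theta> ?y\<bar> \<le> \<epsilon>" using \<epsilon> by (simp add: ennreal_le_iff)
  have V: "f u ?y \<le> C + real L" if "u \<in> \<Theta>" for u
  proof -
    have "ennreal (f u ?y) \<le> ennreal C + (\<Sum>j. ennreal (\<alpha> j * ?y j))" by (rule f_le[OF that yn])
    also have "\<dots> \<le> ennreal C + (\<Sum>j. ennreal (\<alpha> j * real L))"
      using L \<alpha>_nonneg by (intro add_left_mono suminf_le ennreal_leI mult_left_mono) auto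
    also have "(\<Sum>j. ennreal (\<alpha> j * real L)) = ennreal (suminf \<alpha> * real L)"
      using \<alpha>_nonneg \<alpha>_summable by (subst suminf_ennreal2) (auto simp: suminf_mult2 summable_mult2)
    also have "\<dots> \<le> ennreal (1 * real L)" using \<alpha>_less_1 by (intro ennreal_leI mult_right_mono) auto
    finally have "ennreal (f u ?y) \<le> ennreal (C + real L)" using C_nonneg by simp
    then show ?thesis using C_nonneg by (subst (asm) ennreal_le_iff) auto
  qed
  have ex0: "0 \<le> enn2real (excess \<alpha> n Y t \<omega>)" by simp
  \<comment> \<open>Replacing either past by the pattern uses up \<open>\<epsilon>\<close>, and the
    envelope at most \<open>\<epsilon>' + 4 * \<epsilon>\<close>. Of the gap
    \<open>16 * \<epsilon>\<close> at least \<open>9 * \<epsilon>\<close> remains, and both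
    arguments stay below \<open>C + real L + 6 * \<epsilon>\<close>.\<close>
  have half: "(8 * \<epsilon>)\<^sup>2 / (4 * (C + real L + 6 * \<epsilon>)) \<le> (sqrt ?F - sqrt (lam t \<omega>))\<^sup>2"
  proof (rule sqrt_diff_ge)
    show "0 < ?F" using f_pos[OF \<theta>(1) obs_past_nonneg, of Y t \<omega>] \<epsilon>(2) ex0 by linarith
    show "0 < lam t \<omega>" by (rule f_pos[OF th past_nonneg])
    show "?F \<le> C + real L + 6 * \<epsilon>" using 2 V[OF \<theta>(1)] ex \<epsilon> by linarith
    show "lam t \<omega> \<le> C + real L + 6 * \<epsilon>" using 1 V[OF \<theta>(2)] \<epsilon> by linarith
    show "8 * \<epsilon> \<le> \<bar>?F - lam t \<omega>\<bar>" using 1 2 gap ex ex0 \<epsilon> by linarith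
  qed (use \<epsilon> in simp)
  have eq: "8 * \<epsilon>\<^sup>2 / R = 1 / 2 * ((8 * \<epsilon>)\<^sup>2 / (4 * R))" for R
    by (simp add: power_mult_distrib)
  show ?thesis unfolding eq using half by (intro mult_left_mono) auto
qed

text \<open>Parameters in a ball of a finite cover are dealt with together, by replacing the intensity at the center \<open>u\<close> by
  the upper and lower envelopes \<open>f u \<plusminus> g\<close>.\<close>

lemma (in intensity) mle_consistent:
  assumes id: "\<And>\<theta>. \<theta> \<in> \<Theta> \<Longrightarrow> \<theta> \<noteq> \<theta>s \<Longrightarrow> \<exists>y. finite {j. y j \<noteq> 0} \<and> f \<theta> (\<lambda>j. real (y j)) \<noteq> f \<theta>s (\<lambda>j. real (y j :: nat))"
    and \<theta>s: "\<theta>s \<in> \<Theta>" and e: "0 < e" and \<delta>: "0 < \<delta>" and B: "0 \<le> B"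
  shows "\<exists>n0>0. \<forall>(M :: 'w measure) Y th a b est. bounded_process \<Theta> f \<alpha> c C M Y th B \<longrightarrow> (\<forall>t\<in>{a..b}. th t = \<theta>s) \<longrightarrow> 1 \<le> a \<longrightarrow>
      n0 \<le> real_of_int (b - a + 1) \<longrightarrow> (\<forall>\<omega>\<in>space M. is_arg_max (log_lik f Y \<omega> {a..b}) (\<lambda>\<theta>. \<theta> \<in> \<Theta>) (est \<omega>)) \<longrightarrow>
      prob_space.whp M \<delta> (\<lambda>\<omega>. dist (est \<omega>) \<theta>s < e)"
proof -
  define K0 where "K0 = \<Theta> - ball \<theta>s e"
  have K0: "compact K0" unfolding K0_def using compact_params by (intro compact_diff) auto
  have rs: "(\<lambda>j. real (y j)) \<in> nonneg_seqs" for y :: "nat \<Rightarrow> nat" by (simp add: nonneg_seqs_def)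
  let ?d = "\<lambda>y \<theta>. \<bar>f \<theta> (\<lambda>j. real (y j)) - f \<theta>s (\<lambda>j. real (y j))\<bar>"
  have cont: "continuous_on K0 (?d y)" for y :: "nat \<Rightarrow> nat"
    by (intro continuous_intros continuous_on_subset[OF f_continuous[OF rs]]) (auto simp: K0_def)
  have pos: "\<exists>y\<in>{y. finite {j. y j \<noteq> (0::nat)}}. 0 < ?d y \<theta>" if "\<theta> \<in> K0" for \<theta>
  proof -
    have "\<theta> \<in> \<Theta>" "\<theta> \<noteq> \<theta>s" using that e by (auto simp: K0_def)
    from id[OF this] show ?thesis by auto
  qed
  obtain P \<kappa> where P: "finite P" "P \<subseteq> {y. finite {j. y j \<noteq> (0::nat)}}" "0 < \<kappa>"
    "\<And>\<theta>. \<theta> \<in> K0 \<Longrightarrow> \<exists>y\<in>P. \<kappa> \<le> ?d y \<theta>"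
    by (rule compact_finite_separation[OF K0 cont pos]) blast+
  then obtain yp where yp: "\<And>\<theta>. \<theta> \<in> K0 \<Longrightarrow> yp \<theta> \<in> P" "\<And>\<theta>. \<theta> \<in> K0 \<Longrightarrow> \<kappa> \<le> ?d (yp \<theta>) \<theta>"
    by metis
  define \<epsilon> where "\<epsilon> = \<kappa> / 16"
  have \<epsilon>: "0 < \<epsilon>" using P by (simp add: \<epsilon>_def)
  obtain N0 where N0: "\<And>y j. y \<in> P \<Longrightarrow> N0 \<le> j \<Longrightarrow> y j = 0"
    using finite_supports_bounded[OF P(1)] P(2) by blast
  obtain N \<eta> n1 where N: "N0 \<le> N" and \<eta>: "0 < \<eta>" and n1: "0 < n1"
    and freq: "\<And>(M :: 'w measure) Y th a b. bounded_process \<Theta> f \<alpha> c C M Y th B \<Longrightarrow> n1 \<le> real_of_int (b - a + 1) \<Longrightarrow>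
      prob_space.whp M (\<delta> / 4) (\<lambda>\<omega>. \<forall>y\<in>P. \<eta> * real_of_int (b - a + 1) \<le> (\<Sum>t\<in>{a..b}. of_bool (pattern_at \<alpha> N \<epsilon> y Y t \<omega>)))"
    using pattern_frequency[where Nmin=N0 and \<beta>=\<alpha> and \<delta>="\<delta> / 4", OF \<alpha>_nonneg \<alpha>_summable P(1) \<epsilon> _ B] \<delta> by auto
  have yN: "y j = 0" if "y \<in> P" "N \<le> j" for y j using N0 N that by auto
  define L where "L = (\<Sum>y\<in>P. \<Sum>j<N. y j)"
  have L: "y j \<le> L" if "y \<in> P" for y j
  proof (cases "j < N")
    case True
    then have "y j \<le> (\<Sum>j<N. y j)" by (intro member_le_sum) auto
    also have "\<dots> \<le> L" unfolding L_def using that P by (intro member_le_sum) auto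
    finally show ?thesis .
  qed (simp add: yN that)
  define \<kappa>' where "\<kappa>' = 8 * \<epsilon>\<^sup>2 / (C + real L + 6 * \<epsilon>)"
  have \<kappa>': "0 < \<kappa>'" using \<epsilon> C_nonneg by (simp add: \<kappa>'_def add_nonneg_pos)
  \<comment> \<open>The balance in multiples of \<open>h * m\<close>: separating patterns contribute
    at least 15/8, namely 2 less 1/8 for the first \<open>N\<close> times. Against this stand 3/8
    from the deviations \<open>2 * z + z\<close>, 3/8 from the envelopes and 1/8 from the unobserved
    past.\<close>
  define h where "h = \<kappa>' * \<eta>"
  have h: "0 < h" using \<kappa>' \<eta> by (simp add: h_def)
  define \<epsilon>' where "\<epsilon>' = min \<epsilon> (h / 16)"
  have \<epsilon>': "0 < \<epsilon>'" "\<epsilon>' \<le> \<epsilon>" "\<epsilon>' \<le> h / 16" using \<epsilon> h by (auto simp: \<epsilon>'_def)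
  \<comment> \<open>Markov's inequality at level \<open>h / 16 * m\<close> then fails with
    probability \<open>\<delta> / 8\<close>. The constant \<open>\<tau>'\<close> is tuned in the
    same way to the level \<open>h * c / 8 * m\<close>.\<close>
  define \<tau> where "\<tau> = h / 16 * (\<delta> / 8)"
  have \<tau>: "0 < \<tau>" using h \<delta> by (simp add: \<tau>_def)
  obtain n2 where n2: "\<And>n. n2 \<le> n \<Longrightarrow> (\<Sum>j. \<alpha> (j + n)) * B \<le> \<tau> / 2"
    using tail_sum_eventually_small[of "\<tau> / 2" B] \<tau> B by auto
  \<comment> \<open>Beyond \<open>N\<close> and \<open>L\<close> for
    \<open>excess_le_of_pattern\<close>, and so large that both parts of the mean excess are at most
    \<open>\<tau> / 2\<close>.\<close>
  define n where "n = n2 + N + L + nat \<lceil>2 * B / \<tau>\<rceil> + 1"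
  have n: "0 < n" "N \<le> n" "L \<le> n" "B / real n + (\<Sum>j. \<alpha> (j + n)) * B \<le> \<tau>"
  proof -
    show "0 < n" "N \<le> n" "L \<le> n" by (auto simp: n_def)
    have "2 * B / \<tau> \<le> real (nat \<lceil>2 * B / \<tau>\<rceil>)" by (rule real_nat_ceiling_ge)
    also have "\<dots> \<le> real n" by (simp add: n_def)
    finally have "B / real n \<le> \<tau> / 2" using \<tau> \<open>0 < n\<close> by (simp add: field_simps)
    moreover have "(\<Sum>j. \<alpha> (j + n)) * B \<le> \<tau> / 2" by (rule n2) (simp add: n_def)
    ultimately show "B / real n + (\<Sum>j. \<alpha> (j + n)) * B \<le> \<tau>" by linarith
  qed
  define \<tau>' where "\<tau>' = h * c * \<delta> / 128"
  have \<tau>': "0 < \<tau>'" using h c_pos \<delta> by (simp add: \<tau>'_def)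
  obtain N2 where N2: "\<And>n. N2 \<le> n \<Longrightarrow> (\<Sum>j. \<alpha> (j + n)) * B \<le> \<tau>'"
    using tail_sum_eventually_small[OF \<tau>' B] by auto
  let ?Q = "(\<lambda>p j. real (p j)) ` range (truncate_seq n)"
  have Q: "finite ?Q" "?Q \<subseteq> nonneg_seqs"
    using finite_range_truncate_seq rs by auto
  obtain r where r: "0 < r" "\<And>y \<theta> \<theta>'. y \<in> ?Q \<Longrightarrow> \<theta> \<in> \<Theta> \<Longrightarrow> \<theta>' \<in> \<Theta> \<Longrightarrow> dist \<theta>' \<theta> < r \<Longrightarrow> \<bar>f \<theta>' y - f \<theta> y\<bar> \<le> \<epsilon>'"
    using uniform_modulus[OF Q \<epsilon>'(1)] by blast
  obtain J where J: "finite J" "J \<subseteq> K0" "K0 \<subseteq> (\<Union>u\<in>J. ball u r)"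
    using compactE_image[OF K0, of K0 "\<lambda>u. ball u r"] r(1) by (metis UN_I centre_in_ball open_ball subsetI)
  obtain n3 where n3: "0 < n3" "\<And>n. n3 \<le> n \<Longrightarrow> (real (card J) + 1) * exp (- (h / 8 * n)) \<le> \<delta> / 2"
    using exp_decay_threshold[of "h / 8" "\<delta> / 2" "real (card J) + 1"] h \<delta> by auto
  \<comment> \<open>The last two terms make the first \<open>N2\<close> times negligible in the
    start effect and the first \<open>N\<close> times negligible in the pattern count.\<close>
  define n0 where "n0 = n1 + n3 + real N2 * B / \<tau>' + 16 * real N / \<eta>"
  have n0_nn: "0 \<le> real N2 * B / \<tau>'" "0 \<le> 16 * real N / \<eta>" using \<tau>' B \<eta> by auto
  show ?thesis
  proof (intro exI[of _ n0] conjI allI impI)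
    show "0 < n0" using n0_nn n1 n3 by (simp add: n0_def)
    fix M :: "'w measure" and Y th and a b :: int and est
    assume bp: "bounded_process \<Theta> f \<alpha> c C M Y th B" and true: "\<forall>t\<in>{a..b}. th t = \<theta>s" and a: "1 \<le> a"
      and n0: "n0 \<le> real_of_int (b - a + 1)"
      and est: "\<forall>\<omega>\<in>space M. is_arg_max (log_lik f Y \<omega> {a..b}) (\<lambda>\<theta>. \<theta> \<in> \<Theta>) (est \<omega>)"
    interpret bounded_process \<Theta> f \<alpha> c C M Y th B by (rule bp)
    define m where "m = real_of_int (b - a + 1)"
    have m: "n1 \<le> m" "n3 \<le> m" "real N2 * B / \<tau>' \<le> m" "16 * real N / \<eta> \<le> m"
      using n0 n0_nn n1 n3 unfolding n0_def m_def by linarith+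
    have m_pos: "0 < m" using m n1 by linarith
    then have ab: "a \<le> b" by (simp add: m_def)
    define z where "z = h / 8 * m"
    let ?o = "\<lambda>\<theta> t \<omega>. f \<theta> (obs_past Y t \<omega>)"
    define g where "g t \<omega> = \<epsilon>' + 2 * enn2real (excess \<alpha> n Y t \<omega>)" for t \<omega>
    \<comment> \<open>Only for \<open>int N < t\<close> does the observed past contain all
      \<open>N\<close> entries of the pattern; the excluded times reappear as the loss of
      \<open>real N\<close> in \<open>count\<close>.\<close>
    define G where "G u t \<omega> \<longleftrightarrow> int N < t \<and> pattern_at \<alpha> N \<epsilon> (yp u) Y t \<omega>" for u t \<omega>
    have E1: "whp (\<delta> / 4) (\<lambda>\<omega>. \<forall>y\<in>P. \<eta> * m \<le> (\<Sum>t\<in>{a..b}. of_bool (pattern_at \<alpha> N \<epsilon> y Y t \<omega>)))"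
      using freq[OF bp, of b a] m by (simp add: m_def)
    have "whp (\<tau> * m / (h / 16 * m)) (\<lambda>\<omega>. (\<Sum>t\<in>{a..b}. excess \<alpha> n Y t \<omega>) < ennreal (h / 16 * m))"
      using m_pos h n ab unfolding m_def by (intro whp_excess) auto
    then have E2: "whp (\<delta> / 8) (\<lambda>\<omega>. (\<Sum>t\<in>{a..b}. excess \<alpha> n Y t \<omega>) < ennreal (h / 16 * m))"
      using h m_pos by (simp add: \<tau>_def)
    have "whp (2 * \<tau>' * m / (h * c / 8 * m)) (\<lambda>\<omega>. (\<Sum>t\<in>{a..b}. start_effect t \<omega>) < ennreal (h * c / 8 * m))"
    proof -
      have k0: "0 < h * c / 8 * m" using h c_pos m_pos by simp
      have k1: "real N2 * B \<le> \<tau>' * m" using m(3) \<tau>' by (simp add: field_simps)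
      show ?thesis
        using whp_start_effect[OF a ab k0 N2[OF order_refl] k1[unfolded m_def]] by (simp add: m_def)
    qed
    then have E3: "whp (\<delta> / 8) (\<lambda>\<omega>. (\<Sum>t\<in>{a..b}. start_effect t \<omega>) < ennreal (h * c / 8 * m))"
      using h m_pos c_pos by (simp add: \<tau>'_def)
    have E4: "whp (real (card J) * exp (- z)) (\<lambda>\<omega>. \<forall>u\<in>J.
      (\<Sum>t\<in>{a..b}. real (Y t \<omega>) * ln ((?o u t \<omega> + g t \<omega>) / lam t \<omega>) - (?o u t \<omega> - g t \<omega> - lam t \<omega>))
      \<le> 2 * z + 2 * (\<Sum>t\<in>{a..b}. g t \<omega>) - 2 * \<kappa>' * (\<Sum>t\<in>{a..b}. of_bool (G u t \<omega>)))"
    proof (intro whp_ball J whp_log_lik_gap)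
      fix u assume u: "u \<in> J"
      then have u': "u \<in> K0" "u \<in> \<Theta>" using J by (auto simp: K0_def)
      show "u \<in> \<Theta>" by (rule u')
      show "g t \<in> borel_measurable (F (t - 1))" for t
      proof -
        note excess_measurable[measurable]
        show ?thesis unfolding g_def[abs_def] by measurable
      qed
      show "0 \<le> g t \<omega>" for t \<omega> using \<epsilon>' by (simp add: g_def)
      show "{\<omega> \<in> space M. G u t \<omega>} \<in> sets (F (t - 1))" for t
        using pattern_at_measurable[of \<alpha> N \<epsilon> "yp u" t] sets.empty_sets[of "F (t - 1)"]
        by (cases "int N < t") (simp_all add: G_def)
      fix t \<omega> assume t: "t \<in> {a..b}" "G u t \<omega>"
      show "\<kappa>' \<le> 1 / 2 * (sqrt (?o u t \<omega> + g t \<omega>) - sqrt (lam t \<omega>))\<^sup>2"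
        unfolding \<kappa>'_def g_def
        by (rule pattern_gap[where \<theta>'=\<theta>s and N=N and y="yp u"])
          (use t u' yp yN L n \<theta>s true \<epsilon> \<epsilon>' in \<open>auto simp: G_def \<epsilon>_def\<close>)
    qed
    have E5: "whp (exp (- z)) (\<lambda>\<omega>. (\<Sum>t\<in>{a..b}. real (Y t \<omega>) * ln (lam t \<omega> / ?o \<theta>s t \<omega>) - (lam t \<omega> - ?o \<theta>s t \<omega>))
      \<le> z + (\<Sum>t\<in>{a..b}. (lam t \<omega> - ?o \<theta>s t \<omega>)\<^sup>2 / ?o \<theta>s t \<omega>))"
      by (rule whp_log_lik_start[OF \<theta>s])
    show "whp \<delta> (\<lambda>\<omega>. dist (est \<omega>) \<theta>s < e)"
    proof (rule whp_mono[OF whp_conj[OF E1 whp_conj[OF E2 whp_conj[OF E3 whp_conj[OF E4 E5]]]]])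
      show "\<delta> / 4 + (\<delta> / 8 + (\<delta> / 8 + (real (card J) * exp (- z) + exp (- z)))) \<le> \<delta>"
        using n3(2)[OF m(2)] by (simp add: z_def algebra_simps)
      fix \<omega> assume \<omega>: "\<omega> \<in> space M"
      assume ev: "(\<forall>y\<in>P. \<eta> * m \<le> (\<Sum>t\<in>{a..b}. of_bool (pattern_at \<alpha> N \<epsilon> y Y t \<omega>))) \<and>
        (\<Sum>t\<in>{a..b}. excess \<alpha> n Y t \<omega>) < ennreal (h / 16 * m) \<and>
        (\<Sum>t\<in>{a..b}. start_effect t \<omega>) < ennreal (h * c / 8 * m) \<and>
        (\<forall>u\<in>J. (\<Sum>t\<in>{a..b}. real (Y t \<omega>) * ln ((?o u t \<omega> + g t \<omega>) / lam t \<omega>) - (?o u t \<omega> - g t \<omega> - lam t \<omega>))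
          \<le> 2 * z + 2 * (\<Sum>t\<in>{a..b}. g t \<omega>) - 2 * \<kappa>' * (\<Sum>t\<in>{a..b}. of_bool (G u t \<omega>))) \<and>
        (\<Sum>t\<in>{a..b}. real (Y t \<omega>) * ln (lam t \<omega> / ?o \<theta>s t \<omega>) - (lam t \<omega> - ?o \<theta>s t \<omega>))
          \<le> z + (\<Sum>t\<in>{a..b}. (lam t \<omega> - ?o \<theta>s t \<omega>)\<^sup>2 / ?o \<theta>s t \<omega>)"
      show "dist (est \<omega>) \<theta>s < e"
      proof (rule ccontr)
        define \<theta>' where "\<theta>' = est \<omega>"
        assume "\<not> dist (est \<omega>) \<theta>s < e"
        moreover have \<theta>'\<Theta>: "\<theta>' \<in> \<Theta>" and max: "\<not> log_lik f Y \<omega> {a..b} \<theta>' < log_lik f Y \<omega> {a..b} \<theta>s"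
          using bspec[OF est \<omega>] \<theta>s by (auto simp: is_arg_max_def \<theta>'_def)
        ultimately have "\<theta>' \<in> K0" by (simp add: K0_def \<theta>'_def dist_commute)
        then obtain u where u: "u \<in> J" "dist \<theta>' u < r" using J by (auto simp: dist_commute)
        then have u': "u \<in> K0" "u \<in> \<Theta>" using J by (auto simp: K0_def)
        have fin: "excess \<alpha> n Y t \<omega> < \<infinity>" if "t \<in> {a..b}" for t
        proof -
          have "excess \<alpha> n Y t \<omega> \<le> (\<Sum>t\<in>{a..b}. excess \<alpha> n Y t \<omega>)"
            using that by (intro member_le_sum) auto
          also have "\<dots> < \<infinity>" using ev by (metis ennreal_less_top infinity_ennreal_def less_trans)
          finally show ?thesis .
        qed
        have "ennreal (\<Sum>t\<in>{a..b}. enn2real (excess \<alpha> n Y t \<omega>)) = (\<Sum>t\<in>{a..b}. excess \<alpha> n Y t \<omega>)"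
          using fin by (subst sum_ennreal[symmetric]) (auto intro!: sum.cong)
        then have "ennreal (\<Sum>t\<in>{a..b}. enn2real (excess \<alpha> n Y t \<omega>)) < ennreal (h / 16 * m)" using ev by simp
        then have "(\<Sum>t\<in>{a..b}. enn2real (excess \<alpha> n Y t \<omega>)) < h / 16 * m"
          by (subst (asm) ennreal_less_iff) (auto intro: sum_nonneg)
        moreover have "(\<Sum>t\<in>{a..b}. g t \<omega>) = m * \<epsilon>' + 2 * (\<Sum>t\<in>{a..b}. enn2real (excess \<alpha> n Y t \<omega>))"
          using ab by (simp add: g_def sum.distrib sum_distrib_left m_def)
        moreover have "m * \<epsilon>' \<le> m * (h / 16)" using \<epsilon>' m_pos by (intro mult_left_mono) auto
        ultimately have g_sum: "(\<Sum>t\<in>{a..b}. g t \<omega>) \<le> 3 / 16 * (h * m)" by (simp add: mult.commute)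
        have start: "(\<Sum>t\<in>{a..b}. (lam t \<omega> - ?o \<theta>s t \<omega>)\<^sup>2 / ?o \<theta>s t \<omega>) \<le> h / 8 * m"
        proof -
          have "ennreal (\<Sum>t\<in>{a..b}. (lam t \<omega> - ?o \<theta>s t \<omega>)\<^sup>2) = (\<Sum>t\<in>{a..b}. ennreal ((lam t \<omega> - ?o \<theta>s t \<omega>)\<^sup>2))"
            by (rule sum_ennreal[symmetric]) simp
          also have "\<dots> \<le> (\<Sum>t\<in>{a..b}. start_effect t \<omega>)"
            using a true start_effect[OF \<theta>s] by (intro sum_mono) auto
          also have "\<dots> < ennreal (h * c / 8 * m)" using ev by blast
          finally have le: "(\<Sum>t\<in>{a..b}. (lam t \<omega> - ?o \<theta>s t \<omega>)\<^sup>2) < h * c / 8 * m"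
            by (subst (asm) ennreal_less_iff) (auto intro: sum_nonneg)
          have "(\<Sum>t\<in>{a..b}. (lam t \<omega> - ?o \<theta>s t \<omega>)\<^sup>2 / ?o \<theta>s t \<omega>) \<le> (\<Sum>t\<in>{a..b}. (lam t \<omega> - ?o \<theta>s t \<omega>)\<^sup>2 / c)"
            using c_pos f_ge[OF \<theta>s obs_past_nonneg] by (intro sum_mono divide_left_mono) (auto intro!: mult_pos_pos f_pos[OF \<theta>s])
          also have "\<dots> = (\<Sum>t\<in>{a..b}. (lam t \<omega> - ?o \<theta>s t \<omega>)\<^sup>2) / c" by (rule sum_divide_distrib[symmetric])
          also have "\<dots> \<le> h / 8 * m" using le c_pos by (simp add: field_simps)
          finally show ?thesis .
        qed
        have count: "\<eta> * m - real N \<le> (\<Sum>t\<in>{a..b}. of_bool (G u t \<omega>))"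
        proof -
          have "\<eta> * m \<le> (\<Sum>t\<in>{a..b}. of_bool (pattern_at \<alpha> N \<epsilon> (yp u) Y t \<omega>))"
            using ev yp(1)[OF u'(1)] by blast
          also have "\<dots> \<le> (\<Sum>t\<in>{a..b}. of_bool (G u t \<omega>) + of_bool (t \<le> int N))"
            by (intro sum_mono) (auto simp: G_def)
          also have "\<dots> = (\<Sum>t\<in>{a..b}. of_bool (G u t \<omega>)) + (\<Sum>t\<in>{a..b}. of_bool (t \<le> int N))"
            by (rule sum.distrib)
          finally show ?thesis using sum_of_bool_initial_le[OF a, where b=b and N=N] by linarith
        qed
        have "2 * \<kappa>' * (\<eta> * m - real N) \<le> 2 * \<kappa>' * (\<Sum>t\<in>{a..b}. of_bool (G u t \<omega>))"
          using count \<kappa>' by (intro mult_left_mono) auto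
        moreover have "2 * \<kappa>' * real N \<le> h * m / 8"
        proof -
          have "16 * real N \<le> \<eta> * m" using m(4) \<eta> by (simp add: field_simps)
          then have "\<kappa>' * (16 * real N) \<le> \<kappa>' * (\<eta> * m)" using \<kappa>' by (intro mult_left_mono) auto
          then show ?thesis by (simp add: h_def)
        qed
        moreover have "2 * \<kappa>' * (\<eta> * m - real N) = 2 * (h * m) - 2 * \<kappa>' * real N"
          by (simp add: h_def algebra_simps)
        ultimately have cnt: "15 / 8 * (h * m) \<le> 2 * \<kappa>' * (\<Sum>t\<in>{a..b}. of_bool (G u t \<omega>))" by linarith
        \<comment> \<open>The true intensity is inserted between the two parameters: the maximizer
          is compared with it through the envelopes at the center \<open>u\<close>, and it is
          compared with \<open>\<theta>s\<close> on the observed past.\<close>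
        have "log_lik f Y \<omega> {a..b} \<theta>' - log_lik f Y \<omega> {a..b} \<theta>s
            \<le> (\<Sum>t\<in>{a..b}. (real (Y t \<omega>) * ln ((?o u t \<omega> + g t \<omega>) / lam t \<omega>) - (?o u t \<omega> - g t \<omega> - lam t \<omega>))
                + (real (Y t \<omega>) * ln (lam t \<omega> / ?o \<theta>s t \<omega>) - (lam t \<omega> - ?o \<theta>s t \<omega>)))"
          unfolding log_lik_def sum_subtractf[symmetric]
        proof (rule sum_mono)
          fix t assume t: "t \<in> {a..b}"
          have "\<bar>?o \<theta>' t \<omega> - ?o u t \<omega>\<bar> \<le> g t \<omega>"
            unfolding g_def using r(2) u(2) u'(2) \<theta>'\<Theta> \<epsilon>' fin[OF t] by (intro truncation_close) auto
          then have b1: "?o \<theta>' t \<omega> \<le> ?o u t \<omega> + g t \<omega>" "?o u t \<omega> - g t \<omega> \<le> ?o \<theta>' t \<omega>" by linarith+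
          have p: "0 < ?o \<theta>' t \<omega>" "0 < ?o \<theta>s t \<omega>" "0 < lam t \<omega>"
            using f_pos \<theta>'\<Theta> \<theta>s lam_pos[OF \<omega>] by auto
          then have p': "0 < ?o u t \<omega> + g t \<omega>" using b1 by linarith
          have "real (Y t \<omega>) * ln (?o \<theta>' t \<omega>) \<le> real (Y t \<omega>) * ln (?o u t \<omega> + g t \<omega>)"
            using b1 p by (intro mult_left_mono) (auto simp: ln_le_cancel_iff)
          moreover have "real (Y t \<omega>) * ln ((?o u t \<omega> + g t \<omega>) / lam t \<omega>) + real (Y t \<omega>) * ln (lam t \<omega> / ?o \<theta>s t \<omega>)
              = real (Y t \<omega>) * ln (?o u t \<omega> + g t \<omega>) - real (Y t \<omega>) * ln (?o \<theta>s t \<omega>)"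
            using p p' by (simp add: ln_div algebra_simps)
          ultimately show "real (Y t \<omega>) * ln (?o \<theta>' t \<omega>) - ?o \<theta>' t \<omega> - (real (Y t \<omega>) * ln (?o \<theta>s t \<omega>) - ?o \<theta>s t \<omega>)
            \<le> (real (Y t \<omega>) * ln ((?o u t \<omega> + g t \<omega>) / lam t \<omega>) - (?o u t \<omega> - g t \<omega> - lam t \<omega>))
                + (real (Y t \<omega>) * ln (lam t \<omega> / ?o \<theta>s t \<omega>) - (lam t \<omega> - ?o \<theta>s t \<omega>))"
            using b1 by linarith
        qed
        also have "\<dots> = (\<Sum>t\<in>{a..b}. real (Y t \<omega>) * ln ((?o u t \<omega> + g t \<omega>) / lam t \<omega>) - (?o u t \<omega> - g t \<omega> - lam t \<omega>))
            + (\<Sum>t\<in>{a..b}. real (Y t \<omega>) * ln (lam t \<omega> / ?o \<theta>s t \<omega>) - (lam t \<omega> - ?o \<theta>s t \<omega>))"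
          by (rule sum.distrib)
        also have "\<dots> \<le> (2 * z + 2 * (\<Sum>t\<in>{a..b}. g t \<omega>) - 2 * \<kappa>' * (\<Sum>t\<in>{a..b}. of_bool (G u t \<omega>)))
            + (z + (\<Sum>t\<in>{a..b}. (lam t \<omega> - ?o \<theta>s t \<omega>)\<^sup>2 / ?o \<theta>s t \<omega>))"
          using ev u(1) by (intro add_mono) blast+
        also have "\<dots> < 0"
        proof -
          have "0 < h * m" using h m_pos by simp
          then show ?thesis using g_sum start cnt unfolding z_def by (simp add: field_simps)
        qed
        finally show False using max by simp
      qed
    qed
  qed
qed

subsection \<open>The matrix in the detector\<close>

lemma norm1_nonneg: "0 \<le> norm1 x"
  by (simp add: norm1_def sum_nonneg)

lemma norm_le_norm1: "norm x \<le> norm1 x"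
  unfolding norm1_def by (rule norm_le_l1)

definition outer :: "real^'d \<Rightarrow> real^'d^'d" where
  "outer d = (\<chi> i j. d $ i * d $ j)"

lemma outer_mult_vec: "outer d *v x = (d \<bullet> x) *\<^sub>R d"
  by (simp add: outer_def matrix_vector_mult_def vec_eq_iff inner_vec_def sum_distrib_left sum_distrib_right mult_ac)

lemma transpose_outer: "transpose (outer d) = outer d"
  by (simp add: outer_def transpose_def vec_eq_iff mult.commute)

lemma Sigma_hat_eq:
  "Sigma_hat f Df Y est m \<omega> = (1 / real m) *\<^sub>R (\<Sum>t\<in>{1..int m}. (1 / f (est {1..int m} \<omega>) (obs_past Y t \<omega>)) *\<^sub>R
     outer (Df (est {1..int m} \<omega>) (obs_past Y t \<omega>)))"
  by (simp add: Sigma_hat_def outer_def Let_def)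

lemma Sigma_hat_form:
  fixes x :: "real^'d"
  shows "x \<bullet> (Sigma_hat f Df Y est m \<omega> *v x) = (1 / real m) * (\<Sum>t\<in>{1..int m}.
     (Df (est {1..int m} \<omega>) (obs_past Y t \<omega>) \<bullet> x)\<^sup>2 / f (est {1..int m} \<omega>) (obs_past Y t \<omega>))"
proof -
  have "(\<Sum>t\<in>S. A t) *v x = (\<Sum>t\<in>S. A t *v x)" for A :: "int \<Rightarrow> real^'d^'d" and S
    by (induction S rule: infinite_finite_induct) (simp_all add: matrix_vector_mult_add_rdistrib)
  then show ?thesis
    unfolding Sigma_hat_eq
    by (simp add: scaleR_matrix_vector_assoc[symmetric] inner_sum_right outer_mult_vec power2_eq_square
        inner_commute[of x] mult_ac)
qed

lemma transpose_Sigma_hat: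
  fixes Df :: "real^'d \<Rightarrow> (nat \<Rightarrow> real) \<Rightarrow> real^'d"
  shows "transpose (Sigma_hat f Df Y est m \<omega>) = Sigma_hat f Df Y est m \<omega>"
proof -
  have "transpose (\<Sum>t\<in>S. A t) = (\<Sum>t\<in>S. transpose (A t))" for A :: "int \<Rightarrow> real^'d^'d" and S
    by (simp add: transpose_def vec_eq_iff)
  then show ?thesis
    unfolding Sigma_hat_eq by (simp add: transpose_scalar transpose_outer)
qed

locale intensity_gradient = intensity \<Theta> f \<alpha> c C
  for \<Theta> :: "(real^'d) set" and f \<alpha> c C +
  fixes Df :: "real^'d \<Rightarrow> (nat \<Rightarrow> real) \<Rightarrow> real^'d" and \<beta> :: "nat \<Rightarrow> real" and D0 :: real
  assumes Df_continuous: "\<And>y. y \<in> nonneg_seqs \<Longrightarrow> continuous_on \<Theta> (\<lambda>\<theta>. Df \<theta> y)"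
    and D0_nonneg: "0 \<le> D0" and Df_zero_le: "\<And>\<theta>. \<theta> \<in> \<Theta> \<Longrightarrow> norm1 (Df \<theta> (\<lambda>_. 0)) \<le> D0"
    and Df_lipschitz: "\<And>\<theta> y y'. \<theta> \<in> \<Theta> \<Longrightarrow> y \<in> nonneg_seqs \<Longrightarrow> y' \<in> nonneg_seqs \<Longrightarrow>
      ennreal (norm1 (Df \<theta> y - Df \<theta> y')) \<le> (\<Sum>j. ennreal (\<beta> j * \<bar>y j - y' j\<bar>))"
    and \<beta>_nonneg: "\<And>j. 0 \<le> \<beta> j" and \<beta>_summable: "summable \<beta>"
begin

lemma suminf_\<beta>_nonneg: "0 \<le> suminf \<beta>"
  by (rule suminf_nonneg[OF \<beta>_summable \<beta>_nonneg])

text \<open>The coefficients \<open>\<beta>\<close> may sum to more than 1, so they are divided by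
  \<open>suminf \<beta> + 1\<close> before \<open>weighted_square_le\<close> is applied and the
  factor is restored afterwards.\<close>

lemma norm_Df_square_le:
  assumes \<theta>: "\<theta> \<in> \<Theta>" and y: "y \<in> nonneg_seqs"
  shows "ennreal ((norm (Df \<theta> y))\<^sup>2) \<le> ennreal (2 * D0\<^sup>2) + ennreal (2 * (suminf \<beta> + 1)) * (\<Sum>j. ennreal (\<beta> j * (y j)\<^sup>2))"
proof -
  let ?b = "suminf \<beta> + 1"
  have b: "0 < ?b" using suminf_\<beta>_nonneg by simp
  have z: "(\<lambda>_. 0) \<in> nonneg_seqs" by (simp add: nonneg_seqs_def)
  define q where "q = norm1 (Df \<theta> y - Df \<theta> (\<lambda>_. 0))"
  have q: "0 \<le> q" by (simp add: q_def norm1_nonneg)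
  have scale: "(\<Sum>j. ennreal (\<beta> j / ?b * x j)) = ennreal (1 / ?b) * (\<Sum>j. ennreal (\<beta> j * x j))" if "\<And>j. 0 \<le> x j" for x
    using that \<beta>_nonneg b by (subst ennreal_suminf_cmult[symmetric]) (simp flip: ennreal_mult')
  have y0: "0 \<le> y j" for j using y by (simp add: nonneg_seqs_def)
  have "ennreal q \<le> (\<Sum>j. ennreal (\<beta> j * y j))"
    using Df_lipschitz[OF \<theta> y z] y0 by (simp add: q_def)
  then have "ennreal (1 / ?b) * ennreal q \<le> (\<Sum>j. ennreal (\<beta> j / ?b * y j))"
    unfolding scale[OF y0] by (intro mult_left_mono) auto
  then have "ennreal (q / ?b) \<le> (\<Sum>j. ennreal (\<beta> j / ?b * y j))"
    using b q by (simp flip: ennreal_mult')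
  then have "ennreal ((q / ?b)\<^sup>2) \<le> (\<Sum>j. ennreal (\<beta> j / ?b * (y j)\<^sup>2))"
    using b q \<beta>_nonneg \<beta>_summable y0
    by (intro weighted_square_le) (auto simp: suminf_divide summable_divide divide_less_eq)
  then have "ennreal (?b\<^sup>2) * ennreal ((q / ?b)\<^sup>2) \<le> ennreal (?b\<^sup>2) * (ennreal (1 / ?b) * (\<Sum>j. ennreal (\<beta> j * (y j)\<^sup>2)))"
    unfolding scale[OF zero_le_power2] by (intro mult_left_mono) auto
  also have "\<dots> = ennreal ?b * (\<Sum>j. ennreal (\<beta> j * (y j)\<^sup>2))"
    using b by (simp add: mult.assoc[symmetric] power2_eq_square flip: ennreal_mult')
  also have "ennreal (?b\<^sup>2) * ennreal ((q / ?b)\<^sup>2) = ennreal (q\<^sup>2)"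
    using b by (simp add: power_divide flip: ennreal_mult')
  finally have q2: "ennreal (q\<^sup>2) \<le> ennreal ?b * (\<Sum>j. ennreal (\<beta> j * (y j)\<^sup>2))" .
  have "norm (Df \<theta> y) \<le> norm (Df \<theta> (\<lambda>_. 0)) + norm (Df \<theta> y - Df \<theta> (\<lambda>_. 0))"
    by (metis add.commute diff_add_cancel norm_triangle_ineq)
  also have "\<dots> \<le> D0 + q"
    using norm_le_norm1 Df_zero_le[OF \<theta>] unfolding q_def by (intro add_mono) (auto intro: order_trans)
  finally have "(norm (Df \<theta> y))\<^sup>2 \<le> (D0 + q)\<^sup>2" by (intro power_mono) auto
  also have "\<dots> \<le> 2 * D0\<^sup>2 + 2 * q\<^sup>2"
    using zero_le_power2[of "D0 - q"] by (simp add: power2_sum power2_diff)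
  finally have "ennreal ((norm (Df \<theta> y))\<^sup>2) \<le> ennreal (2 * D0\<^sup>2 + 2 * q\<^sup>2)" by (rule ennreal_leI)
  also have "\<dots> = ennreal (2 * D0\<^sup>2) + ennreal 2 * ennreal (q\<^sup>2)"
    by (subst ennreal_plus) (simp_all add: ennreal_mult')
  also have "\<dots> \<le> ennreal (2 * D0\<^sup>2) + ennreal 2 * (ennreal ?b * (\<Sum>j. ennreal (\<beta> j * (y j)\<^sup>2)))"
    by (intro add_left_mono mult_left_mono q2) auto
  also have "ennreal 2 * (ennreal ?b * (\<Sum>j. ennreal (\<beta> j * (y j)\<^sup>2))) = ennreal (2 * ?b) * (\<Sum>j. ennreal (\<beta> j * (y j)\<^sup>2))"
    by (simp only: mult.assoc[symmetric] ennreal_mult'[symmetric] zero_le_numeral)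
  finally show ?thesis .
qed

text \<open>The dominating \<open>V t\<close> does not involve the parameter, so Markov's inequality
  applies although the estimator depends on the whole sample. The weights \<open>1 / f\<close> are
  at most \<open>1 / c\<close>.\<close>

lemma whp_Sigma_hat_bounded:
  assumes bp: "bounded_process \<Theta> f \<alpha> c C M Y th B" and \<delta>: "0 < \<delta>" and m: "0 < m"
    and est: "\<And>\<omega>. \<omega> \<in> space M \<Longrightarrow> est {1..int m} \<omega> \<in> \<Theta>"
  shows "prob_space.whp M \<delta> (\<lambda>\<omega>. \<forall>x. x \<bullet> (Sigma_hat f Df Y est m \<omega> *v x)
    \<le> (2 * D0\<^sup>2 + 2 * (suminf \<beta> + 1) * suminf \<beta> * B + 1) / (\<delta> * c) * (norm x)\<^sup>2)"
proof -
  interpret bounded_process \<Theta> f \<alpha> c C M Y th B by (rule bp)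
  let ?E = "2 * D0\<^sup>2 + 2 * (suminf \<beta> + 1) * suminf \<beta> * B + 1"
  have b: "0 \<le> suminf \<beta>" by (rule suminf_\<beta>_nonneg)
  have E: "0 < ?E" using b B_nonneg by (intro add_nonneg_pos add_nonneg_nonneg mult_nonneg_nonneg) auto
  define V where "V t \<omega> = ennreal (2 * D0\<^sup>2) + ennreal (2 * (suminf \<beta> + 1)) * (\<Sum>j. ennreal (\<beta> j * (real (Y (t - 1 - int j) \<omega>))\<^sup>2))"
    for t \<omega>
  have [measurable]: "V t \<in> borel_measurable M" for t unfolding V_def[abs_def] by measurable
  have "(\<integral>\<^sup>+\<omega>. V t \<omega> \<partial>M) \<le> ennreal ?E" for t
  proof -
    have "(\<integral>\<^sup>+\<omega>. V t \<omega> \<partial>M) = ennreal (2 * D0\<^sup>2) + ennreal (2 * (suminf \<beta> + 1)) *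
        (\<integral>\<^sup>+\<omega>. (\<Sum>j. ennreal (\<beta> j * (real (Y (t - 1 - int j) \<omega>))\<^sup>2)) \<partial>M)"
      unfolding V_def by (subst nn_integral_add) (auto simp: emeasure_space_1 nn_integral_cmult)
    also have "\<dots> \<le> ennreal (2 * D0\<^sup>2) + ennreal (2 * (suminf \<beta> + 1)) * (ennreal (suminf \<beta>) * ennreal B)"
      by (intro add_left_mono mult_left_mono
          nn_integral_weighted_past_le[where g="\<lambda>x. (real x)\<^sup>2", OF \<beta>_nonneg \<beta>_summable second_moment]) auto
    also have "\<dots> = ennreal (2 * D0\<^sup>2 + 2 * (suminf \<beta> + 1) * (suminf \<beta> * B))"
      using b B_nonneg by (simp flip: ennreal_plus ennreal_mult')
    also have "\<dots> \<le> ennreal ?E" by (intro ennreal_leI) simp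
    finally show ?thesis .
  qed
  then have "(\<Sum>t\<in>{1..int m}. \<integral>\<^sup>+\<omega>. V t \<omega> \<partial>M) \<le> of_nat (card {1..int m}) * ennreal ?E"
    by (intro sum_bounded_above)
  also have "\<dots> = ennreal (real m * ?E)"
    using E by (simp add: ennreal_of_nat_eq_real_of_nat ennreal_mult')
  finally have "(\<integral>\<^sup>+\<omega>. (\<Sum>t\<in>{1..int m}. V t \<omega>) \<partial>M) \<le> ennreal (real m * ?E)"
    by (simp add: nn_integral_sum)
  then have "whp (real m * ?E / (real m * ?E / \<delta>)) (\<lambda>\<omega>. (\<Sum>t\<in>{1..int m}. V t \<omega>) < ennreal (real m * ?E / \<delta>))"
    using E m \<delta> by (intro whp_markov) auto
  then show ?thesis
  proof (rule whp_mono)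
    show "real m * ?E / (real m * ?E / \<delta>) \<le> \<delta>" using E m \<delta> by simp
    fix \<omega> assume \<omega>: "\<omega> \<in> space M" and lt: "(\<Sum>t\<in>{1..int m}. V t \<omega>) < ennreal (real m * ?E / \<delta>)"
    let ?\<theta> = "est {1..int m} \<omega>"
    let ?d = "\<lambda>t. Df ?\<theta> (obs_past Y t \<omega>)"
    have \<theta>: "?\<theta> \<in> \<Theta>" by (rule est[OF \<omega>])
    have "ennreal ((norm (?d t))\<^sup>2) \<le> V t \<omega>" for t
    proof -
      have "(\<Sum>j. ennreal (\<beta> j * (obs_past Y t \<omega> j)\<^sup>2)) \<le> (\<Sum>j. ennreal (\<beta> j * (real (Y (t - 1 - int j) \<omega>))\<^sup>2))"
        by (intro suminf_le ennreal_leI mult_left_mono \<beta>_nonneg) (auto simp: obs_past_def)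
      then have "ennreal (2 * D0\<^sup>2) + ennreal (2 * (suminf \<beta> + 1)) * (\<Sum>j. ennreal (\<beta> j * (obs_past Y t \<omega> j)\<^sup>2)) \<le> V t \<omega>"
        unfolding V_def by (intro add_left_mono mult_left_mono) auto
      with norm_Df_square_le[OF \<theta> obs_past_nonneg] show ?thesis by (rule order_trans)
    qed
    then have "(\<Sum>t\<in>{1..int m}. ennreal ((norm (?d t))\<^sup>2)) \<le> (\<Sum>t\<in>{1..int m}. V t \<omega>)" by (intro sum_mono)
    also note lt
    finally have S: "(\<Sum>t\<in>{1..int m}. (norm (?d t))\<^sup>2) < real m * ?E / \<delta>"
      by (subst (asm) sum_ennreal) (auto simp: ennreal_less_iff sum_nonneg)
    show "\<forall>x. x \<bullet> (Sigma_hat f Df Y est m \<omega> *v x) \<le> ?E / (\<delta> * c) * (norm x)\<^sup>2"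
    proof
      fix x
      have "(\<Sum>t\<in>{1..int m}. (?d t \<bullet> x)\<^sup>2 / f ?\<theta> (obs_past Y t \<omega>)) \<le> (\<Sum>t\<in>{1..int m}. (norm (?d t))\<^sup>2 * ((norm x)\<^sup>2 / c))"
      proof (rule sum_mono)
        fix t
        have "(?d t \<bullet> x)\<^sup>2 \<le> (norm (?d t) * norm x)\<^sup>2"
          by (metis Cauchy_Schwarz_ineq2 abs_ge_zero power2_abs power_mono)
        then have "(?d t \<bullet> x)\<^sup>2 / f ?\<theta> (obs_past Y t \<omega>) \<le> (norm (?d t) * norm x)\<^sup>2 / c"
          using f_ge[OF \<theta> obs_past_nonneg] c_pos by (intro frac_le) auto
        then show "(?d t \<bullet> x)\<^sup>2 / f ?\<theta> (obs_past Y t \<omega>) \<le> (norm (?d t))\<^sup>2 * ((norm x)\<^sup>2 / c)"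
          by (simp add: power_mult_distrib)
      qed
      also have "\<dots> = (\<Sum>t\<in>{1..int m}. (norm (?d t))\<^sup>2) * ((norm x)\<^sup>2 / c)"
        by (rule sum_distrib_right[symmetric])
      also have "\<dots> \<le> real m * ?E / \<delta> * ((norm x)\<^sup>2 / c)"
        using S c_pos by (intro mult_right_mono) auto
      finally have "1 / real m * (\<Sum>t\<in>{1..int m}. (?d t \<bullet> x)\<^sup>2 / f ?\<theta> (obs_past Y t \<omega>))
          \<le> 1 / real m * (real m * ?E / \<delta> * ((norm x)\<^sup>2 / c))" by (intro mult_left_mono) auto
      also have "\<dots> = ?E / (\<delta> * c) * (norm x)\<^sup>2" using m by simp
      finally show "x \<bullet> (Sigma_hat f Df Y est m \<omega> *v x) \<le> ?E / (\<delta> * c) * (norm x)\<^sup>2"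
        unfolding Sigma_hat_form .
    qed
  qed
qed

lemma pos_semidef_Sigma_hat:
  assumes "est {1..int m} \<omega> \<in> \<Theta>"
  shows "pos_semidef (Sigma_hat f Df Y est m \<omega>)"
  unfolding pos_semidef_def transpose_Sigma_hat Sigma_hat_form
proof (intro conjI allI mult_nonneg_nonneg)
  fix x
  show "0 \<le> (\<Sum>t\<in>{1..int m}. (Df (est {1..int m} \<omega>) (obs_past Y t \<omega>) \<bullet> x)\<^sup>2 / f (est {1..int m} \<omega>) (obs_past Y t \<omega>))"
    by (intro sum_nonneg divide_nonneg_pos f_pos[OF assms obs_past_nonneg]) simp
qed simp_all

text \<open>Compactness is used for pairs of a parameter and a unit vector: finitely many patterns
  detect every direction at every parameter, wherever the estimator happens to be.\<close>

lemma whp_Sigma_hat_definite: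
  assumes var: "\<And>\<theta> v. \<theta> \<in> \<Theta> \<Longrightarrow> v \<noteq> 0 \<Longrightarrow> \<exists>y. finite {j. y j \<noteq> 0} \<and> Df \<theta> (\<lambda>j. real (y j :: nat)) \<bullet> v \<noteq> 0"
    and \<delta>: "0 < \<delta>" and B: "0 \<le> B"
  shows "\<exists>n0>0. \<forall>(M :: 'w measure) Y th m est. bounded_process \<Theta> f \<alpha> c C M Y th B \<longrightarrow> n0 \<le> real m \<longrightarrow>
      (\<forall>\<omega>\<in>space M. est {1..int m} \<omega> \<in> \<Theta>) \<longrightarrow>
      prob_space.whp M \<delta> (\<lambda>\<omega>. \<forall>x. x \<noteq> 0 \<longrightarrow> x \<bullet> (Sigma_hat f Df Y est m \<omega> *v x) \<noteq> 0)"
proof -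
  let ?K = "\<Theta> \<times> (sphere 0 1 :: (real^'d) set)"
  let ?g = "\<lambda>y p. \<bar>Df (fst p) (\<lambda>j. real (y j)) \<bullet> snd p\<bar>"
  have rs: "(\<lambda>j. real (y j)) \<in> nonneg_seqs" for y :: "nat \<Rightarrow> nat" by (simp add: nonneg_seqs_def)
  have K: "compact ?K" by (intro compact_Times compact_params) simp
  have cont: "continuous_on ?K (?g y)" for y :: "nat \<Rightarrow> nat"
    by (intro continuous_intros continuous_on_compose2[OF Df_continuous[OF rs, of y]]) auto
  have pos: "\<exists>y\<in>{y. finite {j. y j \<noteq> (0::nat)}}. 0 < ?g y p" if "p \<in> ?K" for p
  proof -
    have "fst p \<in> \<Theta>" "snd p \<noteq> 0" using that by auto
    from var[OF this] show ?thesis by auto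
  qed
  obtain P \<kappa> where P: "finite P" "P \<subseteq> {y. finite {j. y j \<noteq> (0::nat)}}" "0 < \<kappa>"
    "\<And>p. p \<in> ?K \<Longrightarrow> \<exists>y\<in>P. \<kappa> \<le> ?g y p"
    by (rule compact_finite_separation[OF K cont pos]) blast+
  define \<epsilon> where "\<epsilon> = \<kappa> / 2"
  have \<epsilon>: "0 < \<epsilon>" "\<epsilon> < \<kappa>" using P by (auto simp: \<epsilon>_def)
  obtain k where k: "\<And>y j. y \<in> P \<Longrightarrow> k \<le> j \<Longrightarrow> y j = 0"
    using finite_supports_bounded[OF P(1)] P(2) by blast
  obtain N \<eta> n1 where N: "k \<le> N" and \<eta>: "0 < \<eta>" and n1: "0 < n1"
    and freq: "\<And>(M :: 'w measure) Y th a b. bounded_process \<Theta> f \<alpha> c C M Y th B \<Longrightarrow> n1 \<le> real_of_int (b - a + 1) \<Longrightarrow>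
      prob_space.whp M \<delta> (\<lambda>\<omega>. \<forall>y\<in>P. \<eta> * real_of_int (b - a + 1) \<le> (\<Sum>t\<in>{a..b}. of_bool (pattern_at \<beta> N \<epsilon> y Y t \<omega>)))"
    using pattern_frequency[where Nmin=k and \<beta>=\<beta> and \<delta>=\<delta>, OF \<beta>_nonneg \<beta>_summable P(1) \<epsilon>(1) \<delta> B] by auto
  show ?thesis
  proof (intro exI[of _ "n1 + (real N + 1) / \<eta>"] conjI allI impI)
    show "0 < n1 + (real N + 1) / \<eta>" using n1 \<eta> by (intro add_pos_nonneg) auto
    fix M :: "'w measure" and Y th m est
    assume bp: "bounded_process \<Theta> f \<alpha> c C M Y th B" and m: "n1 + (real N + 1) / \<eta> \<le> real m"
      and est: "\<forall>\<omega>\<in>space M. est {1..int m} \<omega> \<in> \<Theta>"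
    interpret bounded_process \<Theta> f \<alpha> c C M Y th B by (rule bp)
    have "0 \<le> (real N + 1) / \<eta>" using \<eta> by simp
    then have m1: "n1 \<le> real m" "(real N + 1) / \<eta> \<le> real m" using m n1 by linarith+
    then have m2: "real N + 1 \<le> \<eta> * real m" "0 < real m" using \<eta> n1 by (simp_all add: field_simps)
    have "whp \<delta> (\<lambda>\<omega>. \<forall>y\<in>P. \<eta> * real m \<le> (\<Sum>t\<in>{1..int m}. of_bool (pattern_at \<beta> N \<epsilon> y Y t \<omega>)))"
      using freq[OF bp, of "int m" 1] m1 by simp
    then show "whp \<delta> (\<lambda>\<omega>. \<forall>x. x \<noteq> 0 \<longrightarrow> x \<bullet> (Sigma_hat f Df Y est m \<omega> *v x) \<noteq> 0)"
    proof (rule whp_mono)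
      fix \<omega> assume \<omega>: "\<omega> \<in> space M"
        and ev: "\<forall>y\<in>P. \<eta> * real m \<le> (\<Sum>t\<in>{1..int m}. of_bool (pattern_at \<beta> N \<epsilon> y Y t \<omega>))"
      show "\<forall>x. x \<noteq> 0 \<longrightarrow> x \<bullet> (Sigma_hat f Df Y est m \<omega> *v x) \<noteq> 0"
      proof (intro allI impI)
        fix x :: "real^'d" assume x: "x \<noteq> 0"
        let ?\<theta> = "est {1..int m} \<omega>" and ?u = "(1 / norm x) *\<^sub>R x"
        let ?d = "\<lambda>t. Df ?\<theta> (obs_past Y t \<omega>)"
        have \<theta>: "?\<theta> \<in> \<Theta>" by (rule bspec[OF est \<omega>])
        have "(?\<theta>, ?u) \<in> ?K" using \<theta> x by simp
        from P(4)[OF this] obtain y where y: "y \<in> P" "\<kappa> \<le> \<bar>Df ?\<theta> (\<lambda>j. real (y j)) \<bullet> ?u\<bar>" by auto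
        \<comment> \<open>The summand \<open>(real N + 1) / \<eta>\<close> in the threshold forces
          more than \<open>N\<close> occurrences, so one lies beyond time \<open>N\<close>, where
          the observed past matches too. That single term makes the sum positive.\<close>
        have "\<exists>t\<in>{1..int m}. int N < t \<and> pattern_at \<beta> N \<epsilon> y Y t \<omega>"
        proof (rule ccontr)
          assume "\<not> ?thesis"
          then have "{1..int m} \<inter> {t. pattern_at \<beta> N \<epsilon> y Y t \<omega>} \<subseteq> {1..int N}" by auto
          then have "card ({1..int m} \<inter> {t. pattern_at \<beta> N \<epsilon> y Y t \<omega>}) \<le> card {1..int N}"
            by (intro card_mono) auto
          then have "(\<Sum>t\<in>{1..int m}. of_bool (pattern_at \<beta> N \<epsilon> y Y t \<omega>)) \<le> real N"
            by (simp add: sum_of_bool_eq)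
          with ev y m2 show False by fastforce
        qed
        then obtain t where t: "t \<in> {1..int m}" "int N < t" "pattern_at \<beta> N \<epsilon> y Y t \<omega>" by blast
        have "y j = 0" if "N \<le> j" for j using k[OF y(1)] N that by simp
        from Df_lipschitz[OF \<theta> obs_past_nonneg rs] pattern_at_close(2)[OF t(3) this \<beta>_nonneg t(2)]
        have "ennreal (norm1 (?d t - Df ?\<theta> (\<lambda>j. real (y j)))) \<le> ennreal \<epsilon>" by (rule order_trans)
        then have "norm1 (?d t - Df ?\<theta> (\<lambda>j. real (y j))) \<le> \<epsilon>"
          using \<epsilon> by (simp add: ennreal_le_iff)
        then have "norm (?d t - Df ?\<theta> (\<lambda>j. real (y j))) \<le> \<epsilon>"
          by (rule order_trans[OF norm_le_norm1])
        moreover have "\<bar>(?d t - Df ?\<theta> (\<lambda>j. real (y j))) \<bullet> ?u\<bar> \<le> norm (?d t - Df ?\<theta> (\<lambda>j. real (y j))) * norm ?u"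
          by (rule Cauchy_Schwarz_ineq2)
        moreover have "norm ?u = 1" using x by simp
        ultimately have "\<bar>?d t \<bullet> ?u - Df ?\<theta> (\<lambda>j. real (y j)) \<bullet> ?u\<bar> \<le> \<epsilon>"
          by (simp only: inner_diff_left mult_1_right)
        then have "?d t \<bullet> ?u \<noteq> 0" using y(2) \<epsilon> by linarith
        then have nz: "0 < (?d t \<bullet> x)\<^sup>2 / f ?\<theta> (obs_past Y t \<omega>)"
          using f_pos[OF \<theta> obs_past_nonneg] by (auto intro!: divide_pos_pos)
        have "0 < (\<Sum>t\<in>{1..int m}. (?d t \<bullet> x)\<^sup>2 / f ?\<theta> (obs_past Y t \<omega>))"
          using t(1) nz f_pos[OF \<theta> obs_past_nonneg] by (intro sum_pos2[of _ t]) (auto intro!: divide_nonneg_pos)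
        then show "x \<bullet> (Sigma_hat f Df Y est m \<omega> *v x) \<noteq> 0"
          unfolding Sigma_hat_form using m2 by simp
      qed
    qed simp
  qed
qed

end

subsection \<open>Detection of the change\<close>

lemma (in prob_space) prob_ge_of_whp:
  assumes "whp \<delta> P" "{\<omega> \<in> space M. P \<omega>} \<in> events"
  shows "1 - \<delta> \<le> prob {\<omega> \<in> space M. P \<omega>}"
proof -
  obtain E where E: "E \<in> events" "prob E \<le> \<delta>" "\<forall>\<omega>\<in>space M - E. P \<omega>"
    using assms(1) unfolding whp_def by blast
  have "1 - \<delta> \<le> prob (space M - E)" using E by (simp add: prob_compl)
  also have "\<dots> \<le> prob {\<omega> \<in> space M. P \<omega>}" using E assms(2) by (intro finite_measure_mono) auto
  finally show ?thesis .
qed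

text \<open>Decodes an observed past from a list, an element of a countable type, so that
  measurability can be checked for each list separately.\<close>

definition seq_of_list :: "nat list \<Rightarrow> nat \<Rightarrow> real" where
  "seq_of_list xs j = (if j < length xs then real (xs ! j) else 0)"

context count_process
begin

lemma measurable_map:
  assumes "\<And>j. j \<in> set js \<Longrightarrow> g j \<in> measurable M (count_space UNIV)"
  shows "(\<lambda>\<omega>. map (\<lambda>j. g j \<omega>) js) \<in> measurable M (count_space (UNIV :: nat list set))"
  using assms
proof (induction js)
  case (Cons j js)
  have L: "(\<lambda>\<omega>. map (\<lambda>j. g j \<omega>) js) \<in> measurable M (count_space UNIV)"
    by (rule Cons.IH) (rule Cons.prems, simp)
  have "(\<lambda>\<omega>. n # map (\<lambda>j. g j \<omega>) js) \<in> measurable M (count_space UNIV)" for n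
    using measurable_compose[OF L, of "(#) n" "count_space UNIV"] by simp
  from measurable_compose_countable[OF this Cons.prems[of j]]
  show ?case by simp
qed simp

text \<open>The observed past takes countably many values, so continuity in the parameter suffices for joint
  measurability.\<close>

lemma measurable_at_obs_past:
  fixes h :: "'p::euclidean_space \<Rightarrow> (nat \<Rightarrow> real) \<Rightarrow> 'b::euclidean_space"
  assumes h: "\<And>y. y \<in> nonneg_seqs \<Longrightarrow> continuous_on \<Theta> (\<lambda>\<theta>. h \<theta> y)"
    and e: "e \<in> borel_measurable M" "\<And>\<omega>. \<omega> \<in> space M \<Longrightarrow> e \<omega> \<in> \<Theta>"
  shows "(\<lambda>\<omega>. h (e \<omega>) (obs_past Y t \<omega>)) \<in> borel_measurable M"
proof -
  let ?L = "\<lambda>\<omega>. map (\<lambda>j. Y (t - 1 - int j) \<omega>) [0..<nat (t - 1)]"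
  have L: "?L \<in> measurable M (count_space UNIV)" by (rule measurable_map) simp
  have eq: "obs_past Y t \<omega> = seq_of_list (?L \<omega>)" for \<omega>
    by (auto simp: fun_eq_iff obs_past_def seq_of_list_def)
  have "e \<in> measurable M (restrict_space borel \<Theta>)"
    using e by (intro measurable_restrict_space2) auto
  moreover have "(\<lambda>\<theta>. h \<theta> (seq_of_list l)) \<in> borel_measurable (restrict_space borel \<Theta>)" for l
    by (intro borel_measurable_continuous_on_restrict h) (simp add: nonneg_seqs_def seq_of_list_def)
  ultimately have "(\<lambda>\<omega>. h (e \<omega>) (seq_of_list l)) \<in> borel_measurable M" for l
    by (rule measurable_compose)
  then have "(\<lambda>\<omega>. h (e \<omega>) (seq_of_list (?L \<omega>))) \<in> borel_measurable M"
    by (rule measurable_compose_countable[OF _ L])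
  then show ?thesis by (simp only: eq)
qed

end

lemma (in intensity_gradient) detector_measurable:
  assumes "count_process M Y"
    and est: "est {1..int m} \<in> borel_measurable M" "est {l..k} \<in> borel_measurable M"
      "\<And>\<omega>. \<omega> \<in> space M \<Longrightarrow> est {1..int m} \<omega> \<in> \<Theta>"
  shows "detector f Df Y est m k l \<in> borel_measurable M"
proof -
  interpret count_process M Y by (rule assms)
  note [measurable] = est(1,2)
  have [measurable]: "(\<lambda>\<omega>. f (est {1..int m} \<omega>) (obs_past Y t \<omega>)) \<in> borel_measurable M" for t
    by (rule measurable_at_obs_past[OF f_continuous est(1,3)])
  have [measurable]: "(\<lambda>\<omega>. Df (est {1..int m} \<omega>) (obs_past Y t \<omega>)) \<in> borel_measurable M" for t
    by (rule measurable_at_obs_past[OF Df_continuous est(1,3)])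
  have [measurable]: "outer \<in> borel_measurable (borel :: (real^'d) measure)"
    unfolding outer_def[abs_def] by (intro borel_measurable_continuous_onI continuous_intros)
  have "Sigma_hat f Df Y est m \<in> borel_measurable M"
    unfolding Sigma_hat_eq[abs_def] by measurable
  then have "Sigma_hat f Df Y est m \<in> measurable M (restrict_space borel {A. pos_semidef A})"
    by (intro measurable_restrict_space2 Pi_I CollectI pos_semidef_Sigma_hat est(3))
  from measurable_compose[OF this matrix_inv_sqrt_measurable]
  have [measurable]: "(\<lambda>\<omega>. matrix_inv_sqrt (Sigma_hat f Df Y est m \<omega>)) \<in> borel_measurable M" .
  have [measurable]: "(norm1 :: real^'d \<Rightarrow> real) \<in> borel_measurable borel"
    unfolding norm1_def[abs_def] by measurable
  have cont: "continuous_on UNIV (\<lambda>p :: (real^'d^'d) \<times> (real^'d). fst p *v snd p)"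
    unfolding matrix_vector_mult_def by (intro continuous_intros)
  have [measurable]: "(\<lambda>\<omega>. matrix_inv_sqrt (Sigma_hat f Df Y est m \<omega>) *v (est {l..k} \<omega> - est {1..int m} \<omega>)) \<in> borel_measurable M"
    using borel_measurable_continuous_Pair[of "\<lambda>\<omega>. matrix_inv_sqrt (Sigma_hat f Df Y est m \<omega>)" M
        "\<lambda>\<omega>. est {l..k} \<omega> - est {1..int m} \<omega>" "(*v)"] cont by simp
  show ?thesis unfolding detector_def[abs_def] by measurable
qed

section \<open>Consequences of the model assumptions\<close>

lemma assumption_A_zero_bounded:
  assumes "assumption_A \<Theta> g \<alpha>"
  obtains C where "0 \<le> C" "\<And>\<theta>. \<theta> \<in> \<Theta> \<Longrightarrow> norm1 (g \<theta> (\<lambda>_. 0)) \<le> C"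
proof
  let ?s = "sup_norm1 \<Theta> (\<lambda>\<theta>. g \<theta> (\<lambda>_. 0))"
  show "0 \<le> enn2real ?s" by simp
  fix \<theta> assume "\<theta> \<in> \<Theta>"
  then have "ennreal (norm1 (g \<theta> (\<lambda>_. 0))) \<le> ?s" unfolding sup_norm1_def by (rule SUP_upper)
  also have "\<dots> = ennreal (enn2real ?s)" using assms by (simp add: assumption_A_def)
  finally show "norm1 (g \<theta> (\<lambda>_. 0)) \<le> enn2real ?s" by (simp add: ennreal_le_iff)
qed

lemma assumption_A_lipschitz:
  assumes "assumption_A \<Theta> g \<alpha>" "\<theta> \<in> \<Theta>" "y \<in> nonneg_seqs" "y' \<in> nonneg_seqs"
  shows "ennreal (norm1 (g \<theta> y - g \<theta> y')) \<le> (\<Sum>j. ennreal (\<alpha> j * \<bar>y j - y' j\<bar>))"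
proof -
  have "ennreal (norm1 (g \<theta> y - g \<theta> y')) \<le> sup_norm1 \<Theta> (\<lambda>\<theta>. g \<theta> y - g \<theta> y')"
    unfolding sup_norm1_def using assms(2) by (rule SUP_upper)
  also have "\<dots> \<le> (\<Sum>j. ennreal (\<alpha> j * \<bar>y j - y' j\<bar>))" using assms by (simp add: assumption_A_def)
  finally show ?thesis .
qed

text \<open>A function that is Lipschitz for the weighted distance is determined by its values at finitely supported
  sequences, among the sequences at finite distance from 0.\<close>

lemma zero_of_finite_support:
  fixes h :: "(nat \<Rightarrow> real) \<Rightarrow> real" and y :: "nat \<Rightarrow> nat"
  assumes \<beta>: "\<And>j. 0 \<le> \<beta> j" and K: "0 \<le> K"
    and lip: "\<And>y y'. y \<in> nonneg_seqs \<Longrightarrow> y' \<in> nonneg_seqs \<Longrightarrow>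
      ennreal \<bar>h y - h y'\<bar> \<le> ennreal K * (\<Sum>j. ennreal (\<beta> j * \<bar>y j - y' j\<bar>))"
    and zero: "\<And>y. finite {j. y j \<noteq> 0} \<Longrightarrow> h (\<lambda>j. real (y j :: nat)) = 0"
    and fin: "(\<Sum>j. ennreal (\<beta> j * real (y j))) < \<infinity>"
  shows "h (\<lambda>j. real (y j)) = 0"
proof -
  have nn: "0 \<le> \<beta> j * real (y j)" for j using \<beta> by simp
  have s: "summable (\<lambda>j. \<beta> j * real (y j))" by (rule ennreal_suminf_eqI[OF fin nn])
  have "\<bar>h (\<lambda>j. real (y j))\<bar> \<le> 0 + e" if e: "0 < e" for e
  proof -
    have "0 < e / (K + 1)" using e K by simp
    from suminf_exist_split[OF this s] obtain N where
      N: "norm (\<Sum>j. \<beta> (j + N) * real (y (j + N))) < e / (K + 1)" by blast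
    define y' where "y' j = (if j < N then y j else 0)" for j
    have "{j. y' j \<noteq> 0} \<subseteq> {..<N}" by (auto simp: y'_def split: if_splits)
    then have z: "h (\<lambda>j. real (y' j)) = 0" by (intro zero) (rule finite_subset, auto)
    have "ennreal \<bar>h (\<lambda>j. real (y j)) - h (\<lambda>j. real (y' j))\<bar> \<le> ennreal K * (\<Sum>j. ennreal (\<beta> j * \<bar>real (y j) - real (y' j)\<bar>))"
      by (rule lip) (simp_all add: nonneg_seqs_def)
    also have "(\<Sum>j. ennreal (\<beta> j * \<bar>real (y j) - real (y' j)\<bar>)) = (\<Sum>j. ennreal (\<beta> (j + N) * \<bar>real (y (j + N)) - real (y' (j + N))\<bar>))"
      by (rule suminf_tail_ennreal) (simp add: y'_def)
    also have "\<dots> = (\<Sum>j. ennreal (\<beta> (j + N) * real (y (j + N))))" by (simp add: y'_def)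
    also have "\<dots> = ennreal (\<Sum>j. \<beta> (j + N) * real (y (j + N)))"
      using summable_ignore_initial_segment[OF s, of N] by (intro suminf_ennreal2 nn) simp
    also have "ennreal K * \<dots> \<le> ennreal K * ennreal (e / (K + 1))"
      using N by (intro mult_left_mono ennreal_leI) auto
    also have "\<dots> = ennreal (K * (e / (K + 1)))" by (rule ennreal_mult'[OF K, symmetric])
    finally have "\<bar>h (\<lambda>j. real (y j)) - h (\<lambda>j. real (y' j))\<bar> \<le> K * (e / (K + 1))"
      using K e by (subst (asm) ennreal_le_iff) auto
    also have "\<dots> \<le> e" using K e by (simp add: field_simps)
    finally show ?thesis by (simp add: z)
  qed
  then have "\<bar>h (\<lambda>j. real (y j))\<bar> \<le> 0" by (rule field_le_epsilon)
  then show ?thesis by simp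
qed

text \<open>The weighted past has finite mean, hence is almost surely finite, and
  \<open>zero_of_finite_support\<close> applies pathwise. Used contrapositively: an identity of the
  process that fails almost surely already fails at some finitely supported sequence.\<close>

lemma (in bounded_process) AE_zero_of_finite_support:
  fixes h :: "(nat \<Rightarrow> real) \<Rightarrow> real"
  assumes \<beta>: "\<And>j. 0 \<le> \<beta> j" "summable \<beta>" and K: "0 \<le> K"
    and lip: "\<And>y y'. y \<in> nonneg_seqs \<Longrightarrow> y' \<in> nonneg_seqs \<Longrightarrow>
      ennreal \<bar>h y - h y'\<bar> \<le> ennreal K * (\<Sum>j. ennreal (\<beta> j * \<bar>y j - y' j\<bar>))"
    and zero: "\<And>y. finite {j. y j \<noteq> 0} \<Longrightarrow> h (\<lambda>j. real (y j :: nat)) = 0"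
  shows "AE \<omega> in M. h (past Y t \<omega>) = 0"
proof -
  have "AE \<omega> in M. weighted_past \<beta> Y t \<omega> \<noteq> \<infinity>"
  proof (rule nn_integral_PInf_AE)
    show "weighted_past \<beta> Y t \<in> borel_measurable M"
      by (rule history_measurable[OF weighted_past_measurable[OF order_refl]])
    show "(\<integral>\<^sup>+\<omega>. weighted_past \<beta> Y t \<omega> \<partial>M) \<noteq> \<infinity>"
      using nn_integral_weighted_past_bounded[OF \<beta>, of t] by (auto simp: top_unique)
  qed
  then show ?thesis
  proof (rule AE_mp, intro AE_I2 impI)
    fix \<omega> assume "weighted_past \<beta> Y t \<omega> \<noteq> \<infinity>"
    then have "(\<Sum>j. ennreal (\<beta> j * real (Y (t - 1 - int j) \<omega>))) < \<infinity>"
      by (simp add: weighted_past_def less_top)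
    from zero_of_finite_support[where h=h, OF \<beta>(1) K lip zero this]
    show "h (past Y t \<omega>) = 0" by (simp add: past_def[abs_def])
  qed
qed

lemma stationary_upto_nn_integral:
  fixes Y :: "int \<Rightarrow> 'w \<Rightarrow> nat" and g :: "nat \<Rightarrow> ennreal"
  assumes st: "stationary_upto M Y k" and Y: "\<And>t. Y t \<in> measurable M (count_space UNIV)" and u: "u \<le> k"
  shows "(\<integral>\<^sup>+\<omega>. g (Y u \<omega>) \<partial>M) = (\<integral>\<^sup>+\<omega>. g (Y k \<omega>) \<partial>M)"
proof -
  let ?N = "\<Pi>\<^sub>M t\<in>{..k}. count_space UNIV :: nat measure"
  have m: "(\<lambda>\<omega>. \<lambda>t\<in>{..k}. Y (t - h) \<omega>) \<in> measurable M ?N" for h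
    using Y by (intro measurable_restrict)
  have G: "(\<lambda>x. g (x k)) \<in> borel_measurable ?N"
    by (rule measurable_compose[OF measurable_component_singleton]) auto
  have D: "(\<integral>\<^sup>+\<omega>. g (Y (k - h) \<omega>) \<partial>M) = (\<integral>\<^sup>+x. g (x k) \<partial>distr M ?N (\<lambda>\<omega>. \<lambda>t\<in>{..k}. Y (t - h) \<omega>))" for h
    using nn_integral_distr[OF m, of "\<lambda>x. g (x k)" h] G by simp
  have "(\<integral>\<^sup>+\<omega>. g (Y u \<omega>) \<partial>M) = (\<integral>\<^sup>+x. g (x k) \<partial>distr M ?N (\<lambda>\<omega>. \<lambda>t\<in>{..k}. Y (t - (k - u)) \<omega>))"
    using D[of "k - u"] by simp
  also have "distr M ?N (\<lambda>\<omega>. \<lambda>t\<in>{..k}. Y (t - (k - u)) \<omega>) = distr M ?N (\<lambda>\<omega>. \<lambda>t\<in>{..k}. Y t \<omega>)"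
    using st u unfolding stationary_upto_def by simp
  also have "(\<integral>\<^sup>+x. g (x k) \<partial>distr M ?N (\<lambda>\<omega>. \<lambda>t\<in>{..k}. Y t \<omega>)) = (\<integral>\<^sup>+\<omega>. g (Y k \<omega>) \<partial>M)"
    using D[of 0] by simp
  finally show ?thesis .
qed

lemma monitor_time_finite_iff:
  "monitor_time f Df Y est b v T m \<omega> < \<infinity> \<longleftrightarrow> (\<exists>k. int m < k \<and> (T = \<infinity> \<or> k < \<lfloor>real_of_ereal T * real m\<rfloor> + 1) \<and>
     (\<exists>l\<in>{int m - v m..k - v m}. detector f Df Y est m k l \<omega> > b (of_int (k - l) / real m)))"
  unfolding monitor_time_def INF_less_iff by auto

lemma detector_ge:
  fixes Df :: "real^'d \<Rightarrow> (nat \<Rightarrow> real) \<Rightarrow> real^'d"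
  assumes psd: "pos_semidef (Sigma_hat f Df Y est m \<omega>)"
    and pd: "\<And>x. x \<noteq> 0 \<Longrightarrow> x \<bullet> (Sigma_hat f Df Y est m \<omega> *v x) \<noteq> 0"
    and K: "\<And>x. x \<bullet> (Sigma_hat f Df Y est m \<omega> *v x) \<le> K * (norm x)\<^sup>2" "0 < K"
    and d: "0 \<le> d" "d \<le> norm (est {l..k} \<omega> - est {1..int m} \<omega>)"
    and q: "0 \<le> q" "q \<le> of_int (k - l) / of_int k"
  shows "sqrt (real m) * q * (d / sqrt K) \<le> detector f Df Y est m k l \<omega>"
proof -
  let ?x = "est {l..k} \<omega> - est {1..int m} \<omega>" and ?A = "matrix_inv_sqrt (Sigma_hat f Df Y est m \<omega>)"
  have "d\<^sup>2 \<le> (norm ?x)\<^sup>2" using d by (intro power_mono) auto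
  also have "\<dots> \<le> K * (norm (?A *v ?x))\<^sup>2" by (rule norm_matrix_inv_sqrt_ge[OF psd pd K(1)])
  finally have "sqrt (d\<^sup>2) \<le> sqrt (K * (norm (?A *v ?x))\<^sup>2)" by (rule real_sqrt_le_mono)
  then have "d \<le> sqrt K * norm (?A *v ?x)" using d by (simp add: real_sqrt_mult)
  then have "d / sqrt K \<le> norm (?A *v ?x)" using K by (simp add: field_simps)
  also have "\<dots> \<le> norm1 (?A *v ?x)" by (rule norm_le_norm1)
  finally have "d / sqrt K \<le> norm1 (?A *v ?x)" .
  moreover have "0 \<le> real_of_int (k - l) / real_of_int k" using q by linarith
  ultimately show ?thesis
    unfolding detector_def using q d K by (intro mult_mono mult_nonneg_nonneg) simp_all
qed

theorem corollary4p1: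
  fixes \<Theta> :: "(real^'d) set"
    and f :: "real^'d \<Rightarrow> (nat \<Rightarrow> real) \<Rightarrow> real"
    and Df :: "real^'d \<Rightarrow> (nat \<Rightarrow> real) \<Rightarrow> real^'d"
    and D2f :: "real^'d \<Rightarrow> (nat \<Rightarrow> real) \<Rightarrow> real^'d^'d"
    and \<alpha>0 \<alpha>1 \<alpha>2 :: "nat \<Rightarrow> real" and \<gamma> :: real
    and \<theta>0 \<theta>1 :: "real^'d"
    and T :: ereal and Tstar :: real and kstar :: "nat \<Rightarrow> int"
    and b :: "real \<Rightarrow> real" and v :: "nat \<Rightarrow> int"
    and M :: "nat \<Rightarrow> 'w measure"
    and Y :: "nat \<Rightarrow> int \<Rightarrow> 'w \<Rightarrow> nat"
    and est :: "nat \<Rightarrow> int set \<Rightarrow> 'w \<Rightarrow> real^'d"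
  assumes "compact \<Theta>" and "intensity_family \<Theta> f" and "C2_on \<Theta> f Df D2f"
    and "assumption_A \<Theta> f \<alpha>0" and "suminf \<alpha>0 < 1"
    and "assumption_A \<Theta> Df \<alpha>1" and "assumption_A \<Theta> D2f \<alpha>2"
    and "\<gamma> > 3 / 2"
    and "\<alpha>0 \<in> O(\<lambda>j. real (Suc j) powr (- \<gamma>))"
    and "\<alpha>1 \<in> O(\<lambda>j. real (Suc j) powr (- \<gamma>))"
    and "\<alpha>2 \<in> O(\<lambda>j. real (Suc j) powr (- \<gamma>))"
    and "assumption_D \<Theta> f"
    and "assumption_B b"
    and "filterlim v at_top sequentially"
    and "(\<lambda>m. of_int (v m) / sqrt (real m)) \<longlonglongrightarrow> 0"
    and "T > 1" and "1 < Tstar" and "ereal Tstar < T"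
    and "\<And>m. kstar m = \<lfloor>Tstar * real m\<rfloor>"
    and "\<theta>0 \<noteq> \<theta>1" and "\<theta>0 \<in> interior \<Theta>" and "\<theta>1 \<in> interior \<Theta>"
    and "\<And>m. m \<ge> 1 \<Longrightarrow> prob_space (M m)"
    and "\<And>m t. m \<ge> 1 \<Longrightarrow> Y m t \<in> measurable (M m) (count_space UNIV)"
    and "\<And>m. m \<ge> 1 \<Longrightarrow>
           poisson_given_past (M m) (Y m) (change_intensity f \<theta>0 \<theta>1 (kstar m) (Y m))"
    and "\<And>m. m \<ge> 1 \<Longrightarrow> stationary_upto (M m) (Y m) (kstar m)"
    and "\<And>m t. m \<ge> 1 \<Longrightarrow> t \<le> kstar m \<Longrightarrow> integrable (M m) (\<lambda>\<omega>. real (Y m t \<omega>))"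
    and "\<And>m. m \<ge> 1 \<Longrightarrow> assumption_Id \<Theta> f (M m) (Y m) (kstar m)"
    and "\<And>m. m \<ge> 1 \<Longrightarrow> assumption_Var \<Theta> Df (M m) (Y m) (kstar m)"
    and "\<And>m. m \<ge> 1 \<Longrightarrow> is_MLE \<Theta> f (M m) (Y m) (est m)"
  shows "(\<lambda>m. measure (M m)
            {\<omega> \<in> space (M m). monitor_time f Df (Y m) (est m) b v T m \<omega> < \<infinity>}) \<longlonglongrightarrow> 1"
proof -
  note compact = assms(1) and family = assms(2) and C2 = assms(3) and A0 = assms(4) and \<alpha>0_lt = assms(5)
    and A1 = assms(6) and D = assms(12) and b = assms(13) and v = assms(14) and v_small = assms(15)
    and T = assms(16) and Tstar = assms(17,18) and kstar = assms(19) and neq = assms(20)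
    and interior = assms(21,22) and prob = assms(23) and Y_meas = assms(24) and cond = assms(25)
    and stat = assms(26) and integ = assms(27) and Id = assms(28) and Var = assms(29) and mle = assms(30)
  have \<theta>: "\<theta>0 \<in> \<Theta>" "\<theta>1 \<in> \<Theta>" using interior interior_subset by auto
  obtain c where c: "0 < c" "\<And>y \<theta>. y \<in> nonneg_seqs \<Longrightarrow> \<theta> \<in> \<Theta> \<Longrightarrow> c \<le> f \<theta> y"
    using D unfolding assumption_D_def by blast
  obtain C where C: "0 \<le> C" "\<And>\<theta>. \<theta> \<in> \<Theta> \<Longrightarrow> norm1 (f \<theta> (\<lambda>_. 0)) \<le> C"
    using assumption_A_zero_bounded[OF A0] by blast
  obtain D0 where D0: "0 \<le> D0" "\<And>\<theta>. \<theta> \<in> \<Theta> \<Longrightarrow> norm1 (Df \<theta> (\<lambda>_. 0)) \<le> D0"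
    using assumption_A_zero_bounded[OF A1] by blast
  have \<alpha>0: "\<And>j. 0 \<le> \<alpha>0 j" "summable \<alpha>0" and \<alpha>1: "\<And>j. 0 \<le> \<alpha>1 j" "summable \<alpha>1"
    using A0 A1 by (auto simp: assumption_A_def)
  interpret intensity_gradient \<Theta> f \<alpha>0 c C Df \<alpha>1 D0
  proof (intro intensity_gradient.intro intensity.intro intensity_gradient_axioms.intro)
    fix y :: "nat \<Rightarrow> real" assume y: "y \<in> nonneg_seqs"
    show "continuous_on \<Theta> (\<lambda>\<theta>. f \<theta> y)" "continuous_on \<Theta> (\<lambda>\<theta>. Df \<theta> y)"
      using C2 y unfolding C2_on_def continuous_on_eq_continuous_within
      by (blast intro: has_derivative_continuous)+
  next
    fix \<theta> assume "\<theta> \<in> \<Theta>"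
    then show "f \<theta> (\<lambda>_. 0) \<le> C" using C(2)[of \<theta>] by (simp add: norm1_real)
  next
    fix \<theta> y y' assume "\<theta> \<in> \<Theta>" "y \<in> nonneg_seqs" "y' \<in> nonneg_seqs"
    from assumption_A_lipschitz[OF A0 this] assumption_A_lipschitz[OF A1 this]
    show "ennreal \<bar>f \<theta> y - f \<theta> y'\<bar> \<le> (\<Sum>j. ennreal (\<alpha>0 j * \<bar>y j - y' j\<bar>))"
      "ennreal (norm1 (Df \<theta> y - Df \<theta> y')) \<le> (\<Sum>j. ennreal (\<alpha>1 j * \<bar>y j - y' j\<bar>))"
      by (simp_all add: norm1_real)
  qed (use compact family c C D0 \<alpha>0 \<alpha>1 \<alpha>0_lt in \<open>auto simp: intensity_family_def\<close>)
  define th where "th m t = (if t \<le> kstar m then \<theta>0 else \<theta>1)" for m t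
  have ip: "intensity_process \<Theta> f \<alpha>0 c C (M m) (Y m) (th m)" if m: "1 \<le> m" for m
  proof -
    interpret prob_space "M m" by (rule prob[OF m])
    interpret count_process "M m" "Y m" by unfold_locales (rule Y_meas[OF m])
    have "change_intensity f \<theta>0 \<theta>1 (kstar m) (Y m) = (\<lambda>t \<omega>. f (th m t) (past (Y m) t \<omega>))"
      by (auto simp: fun_eq_iff change_intensity_def th_def)
    with cond[OF m] \<theta> show ?thesis
      by unfold_locales (auto simp: th_def)
  qed
  define B1 where "B1 = C / (1 - suminf \<alpha>0)"
  \<comment> \<open>The constants of \<open>mean_bounded\<close> and
    \<open>second_moment_bounded\<close>; they involve only \<open>C\<close> and
    \<open>suminf \<alpha>0\<close>, so that one \<open>B\<close> serves all
    \<open>m\<close>.\<close>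
  define B where "B = (C\<^sup>2 / (1 - suminf \<alpha>0) + B1) / (1 - suminf \<alpha>0)"
  have B1: "0 \<le> B1" and B: "0 \<le> B" using C \<alpha>0_lt by (auto simp: B1_def B_def)
  have bp: "bounded_process \<Theta> f \<alpha>0 c C (M m) (Y m) (th m) B" if m: "1 \<le> m" for m
  proof -
    interpret intensity_process \<Theta> f \<alpha>0 c C "M m" "Y m" "th m" by (rule ip[OF m])
    let ?k = "kstar m"
    have "(\<integral>\<^sup>+\<omega>. ennreal (real (Y m ?k \<omega>)) \<partial>M m) < \<infinity>"
      using integ[OF m order_refl] by (simp add: integrable_iff_bounded)
    moreover have "(\<integral>\<^sup>+\<omega>. ennreal (real (Y m u \<omega>)) \<partial>M m) = (\<integral>\<^sup>+\<omega>. ennreal (real (Y m ?k \<omega>)) \<partial>M m)" if "u \<le> ?k" for u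
      by (rule stationary_upto_nn_integral[OF stat[OF m] Y_meas[OF m] that, of "\<lambda>n. ennreal (real n)"])
    ultimately have "(\<integral>\<^sup>+\<omega>. ennreal (real (Y m t \<omega>)) \<partial>M m) \<le> ennreal B1" for t
      unfolding B1_def by (rule mean_bounded)
    from second_moment_bounded[OF this B1] B show ?thesis
      by unfold_locales (auto simp: B_def)
  qed
  \<comment> \<open>Separation at finitely supported sequences is a property of \<open>f\<close> and
    \<open>Df\<close> alone; the process with \<open>m = 1\<close> suffices to derive it for every
    \<open>m\<close>.\<close>
  interpret P1: bounded_process \<Theta> f \<alpha>0 c C "M 1" "Y 1" "th 1" B by (rule bp) simp
  have id: "\<exists>y. finite {j. y j \<noteq> 0} \<and> f \<theta> (\<lambda>j. real (y j)) \<noteq> f \<theta>' (\<lambda>j. real (y j :: nat))"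
    if t: "\<theta>' \<in> \<Theta>" "\<theta> \<in> \<Theta>" "\<theta> \<noteq> \<theta>'" for \<theta> \<theta>'
  proof (rule ccontr)
    assume no: "\<not> ?thesis"
    have "AE \<omega> in M 1. f \<theta> (past (Y 1) (kstar 1 + 1) \<omega>) - f \<theta>' (past (Y 1) (kstar 1 + 1) \<omega>) = 0"
    proof (rule P1.AE_zero_of_finite_support[where h="\<lambda>y. f \<theta> y - f \<theta>' y" and K=2, OF \<alpha>0])
      fix y y' :: "nat \<Rightarrow> real" assume y: "y \<in> nonneg_seqs" "y' \<in> nonneg_seqs"
      have "ennreal \<bar>f \<theta> y - f \<theta>' y - (f \<theta> y' - f \<theta>' y')\<bar> \<le> ennreal (\<bar>f \<theta> y - f \<theta> y'\<bar> + \<bar>f \<theta>' y - f \<theta>' y'\<bar>)"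
        by (intro ennreal_leI) linarith
      also have "\<dots> \<le> (\<Sum>j. ennreal (\<alpha>0 j * \<bar>y j - y' j\<bar>)) + (\<Sum>j. ennreal (\<alpha>0 j * \<bar>y j - y' j\<bar>))"
        by (subst ennreal_plus) (auto intro: add_mono f_lipschitz t y)
      also have "\<dots> = ennreal 2 * (\<Sum>j. ennreal (\<alpha>0 j * \<bar>y j - y' j\<bar>))"
        by (simp add: mult_2)
      finally show "ennreal \<bar>f \<theta> y - f \<theta>' y - (f \<theta> y' - f \<theta>' y')\<bar> \<le> ennreal 2 * (\<Sum>j. ennreal (\<alpha>0 j * \<bar>y j - y' j\<bar>))" .
    qed (use no in auto)
    then have "\<exists>t>kstar 1. AE \<omega> in M 1. f \<theta> (past (Y 1) t \<omega>) = f \<theta>' (past (Y 1) t \<omega>)"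
      by (intro exI[of _ "kstar 1 + 1"]) simp
    with Id[of 1] t show False unfolding assumption_Id_def by auto
  qed
  have var: "\<exists>y. finite {j. y j \<noteq> 0} \<and> Df \<theta> (\<lambda>j. real (y j :: nat)) \<bullet> w \<noteq> 0"
    if t: "\<theta> \<in> \<Theta>" "w \<noteq> 0" for \<theta> w
  proof (rule ccontr)
    assume no: "\<not> ?thesis"
    have "AE \<omega> in M 1. Df \<theta> (past (Y 1) (kstar 1 + 1) \<omega>) \<bullet> w = 0"
    proof (rule P1.AE_zero_of_finite_support[where h="\<lambda>y. Df \<theta> y \<bullet> w" and K="norm w", OF \<alpha>1])
      fix y y' :: "nat \<Rightarrow> real" assume y: "y \<in> nonneg_seqs" "y' \<in> nonneg_seqs"
      have "\<bar>Df \<theta> y \<bullet> w - Df \<theta> y' \<bullet> w\<bar> \<le> norm (Df \<theta> y - Df \<theta> y') * norm w"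
        unfolding inner_diff_left[symmetric] by (rule Cauchy_Schwarz_ineq2)
      also have "\<dots> \<le> norm w * norm1 (Df \<theta> y - Df \<theta> y')"
        by (subst mult.commute) (intro mult_left_mono norm_le_norm1 norm_ge_zero)
      finally have "ennreal \<bar>Df \<theta> y \<bullet> w - Df \<theta> y' \<bullet> w\<bar> \<le> ennreal (norm w) * ennreal (norm1 (Df \<theta> y - Df \<theta> y'))"
        by (subst ennreal_mult'[symmetric]) (auto intro: ennreal_leI)
      also have "\<dots> \<le> ennreal (norm w) * (\<Sum>j. ennreal (\<alpha>1 j * \<bar>y j - y' j\<bar>))"
        by (intro mult_left_mono Df_lipschitz t y) simp
      finally show "ennreal \<bar>Df \<theta> y \<bullet> w - Df \<theta> y' \<bullet> w\<bar> \<le> ennreal (norm w) * (\<Sum>j. ennreal (\<alpha>1 j * \<bar>y j - y' j\<bar>))" .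
    qed (use no in auto)
    moreover have "Df \<theta> y \<bullet> w = (\<Sum>i\<in>UNIV. w $ i * Df \<theta> y $ i)" for y
      by (simp add: inner_vec_def mult.commute)
    ultimately have AE0: "AE \<omega> in M 1. (\<Sum>i\<in>UNIV. w $ i * Df \<theta> (past (Y 1) (kstar 1 + 1) \<omega>) $ i) = 0" by simp
    have "\<forall>t>kstar 1. \<forall>u. (AE \<omega> in M 1. (\<Sum>i\<in>UNIV. u $ i * Df \<theta> (past (Y 1) t \<omega>) $ i) = 0) \<longrightarrow> u = 0"
      using Var[OF order_refl] t(1) unfolding assumption_Var_def by blast
    then have "\<forall>u. (AE \<omega> in M 1. (\<Sum>i\<in>UNIV. u $ i * Df \<theta> (past (Y 1) (kstar 1 + 1) \<omega>) $ i) = 0) \<longrightarrow> u = 0"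
      by (rule allE[of _ "kstar 1 + 1"]) simp
    then have "w = 0" using AE0 by blast
    with t(2) show False by simp
  qed
  \<comment> \<open>A real number strictly below \<open>T\<close>, also when \<open>T\<close> is
    infinite. The surplus \<open>\<kappa>\<close> over \<open>Tstar\<close> gives a window of length
    about \<open>\<kappa> * real m\<close> after the change that ends before the horizon.\<close>
  obtain z where z: "ereal Tstar < ereal z" "ereal z < T"
    using ereal_dense2[OF Tstar(2)] by blast
  define \<kappa> where "\<kappa> = z - Tstar"
  have \<kappa>: "0 < \<kappa>" using z by (simp add: \<kappa>_def)
  \<comment> \<open>With both estimators within a quarter of the distance from their targets, they
    remain \<open>2 * e\<close> apart.\<close>
  define e where "e = dist \<theta>0 \<theta>1 / 4"
  have e: "0 < e" using neq by (simp add: e_def)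
  \<comment> \<open>The lower bound for the factor \<open>(k - l) / k\<close> of the detector, from
    \<open>k - l \<ge> \<kappa> / 2 * m\<close> and \<open>k \<le> z * m\<close>.\<close>
  define q where "q = \<kappa> / (2 * z)"
  have z_pos: "0 < z" using z Tstar by simp
  have q: "0 < q" using \<kappa> z_pos by (simp add: q_def)
  let ?mon = "\<lambda>m. {\<omega> \<in> space (M m). monitor_time f Df (Y m) (est m) b v T m \<omega> < \<infinity>}"
  have main: "\<forall>\<^sub>F m in sequentially. 1 - \<delta> \<le> measure (M m) (?mon m)" if \<delta>: "0 < \<delta>" for \<delta>
  proof -
    have \<delta>4: "0 < \<delta> / 4" using \<delta> by simp
    obtain n0 :: real where n0: "\<forall>(M :: 'w measure) Y th a b est. bounded_process \<Theta> f \<alpha>0 c C M Y th B \<longrightarrow>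
      (\<forall>t\<in>{a..b}. th t = \<theta>0) \<longrightarrow> 1 \<le> a \<longrightarrow> n0 \<le> real_of_int (b - a + 1) \<longrightarrow>
      (\<forall>\<omega>\<in>space M. is_arg_max (log_lik f Y \<omega> {a..b}) (\<lambda>\<theta>. \<theta> \<in> \<Theta>) (est \<omega>)) \<longrightarrow>
      prob_space.whp M (\<delta> / 4) (\<lambda>\<omega>. dist (est \<omega>) \<theta>0 < e)"
      by (rule exE[OF mle_consistent[OF _ \<theta>(1) e \<delta>4 B]]) (rule id[OF \<theta>(1)], assumption+, elim conjE, rule that)
    obtain n1 :: real where n1: "\<forall>(M :: 'w measure) Y th a b est. bounded_process \<Theta> f \<alpha>0 c C M Y th B \<longrightarrow>
      (\<forall>t\<in>{a..b}. th t = \<theta>1) \<longrightarrow> 1 \<le> a \<longrightarrow> n1 \<le> real_of_int (b - a + 1) \<longrightarrow>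
      (\<forall>\<omega>\<in>space M. is_arg_max (log_lik f Y \<omega> {a..b}) (\<lambda>\<theta>. \<theta> \<in> \<Theta>) (est \<omega>)) \<longrightarrow>
      prob_space.whp M (\<delta> / 4) (\<lambda>\<omega>. dist (est \<omega>) \<theta>1 < e)"
      by (rule exE[OF mle_consistent[OF _ \<theta>(2) e \<delta>4 B]]) (rule id[OF \<theta>(2)], assumption+, elim conjE, rule that)
    obtain n2 :: real where n2: "\<forall>(M :: 'w measure) Y th m est. bounded_process \<Theta> f \<alpha>0 c C M Y th B \<longrightarrow> n2 \<le> real m \<longrightarrow>
      (\<forall>\<omega>\<in>space M. est {1..int m} \<omega> \<in> \<Theta>) \<longrightarrow>
      prob_space.whp M (\<delta> / 4) (\<lambda>\<omega>. \<forall>x. x \<noteq> 0 \<longrightarrow> x \<bullet> (Sigma_hat f Df Y est m \<omega> *v x) \<noteq> 0)"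
      by (rule exE[OF whp_Sigma_hat_definite[OF _ \<delta>4 B]]) (rule var, assumption+, elim conjE, rule that)
    define K where "K = (2 * D0\<^sup>2 + 2 * (suminf \<alpha>1 + 1) * suminf \<alpha>1 * B + 1) / (\<delta> / 4 * c)"
    have K: "0 < K"
      unfolding K_def using suminf_\<beta>_nonneg B \<delta> c by (intro divide_pos_pos add_nonneg_pos add_nonneg_nonneg mult_nonneg_nonneg mult_pos_pos) auto
    have "\<forall>\<^sub>F m in sequentially. real_of_int (v m) / sqrt (real m) < 1"
      using v_small by (rule order_tendstoD) simp
    moreover have "\<forall>\<^sub>F m in sequentially. 1 \<le> v m"
      using v unfolding filterlim_at_top by blast
    moreover have "\<forall>\<^sub>F m in sequentially. 1 \<le> m" by (rule eventually_ge_at_top)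
    moreover have "\<forall>\<^sub>F m in sequentially. sqrt (real m) + 2 \<le> \<kappa> * real m"
      using \<kappa> by real_asymp
    moreover have "\<forall>\<^sub>F m in sequentially. sqrt (real m) + 1 \<le> real m"
      by real_asymp
    moreover have "\<forall>\<^sub>F m in sequentially. max n0 n2 \<le> real m"
      by real_asymp
    moreover have "\<forall>\<^sub>F m in sequentially. max n1 0 + 1 \<le> \<kappa> * real m"
      using \<kappa> by real_asymp
    moreover have "\<forall>\<^sub>F m in sequentially. 4 \<le> \<kappa> * real m"
      using \<kappa> by real_asymp
    moreover have "\<forall>\<^sub>F m in sequentially. b (\<kappa> / 2) < sqrt (real m) * q * (2 * e / sqrt K)"
    proof -
      have "\<forall>\<^sub>F m in sequentially. x < sqrt (real m) * r" if "0 < r" for x r :: real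
        using that by real_asymp
      from this[of "q * (2 * e / sqrt K)"] show ?thesis
        using q e K by (simp add: mult.assoc)
    qed
    ultimately show ?thesis
    proof eventually_elim
      case (elim m)
      note m = elim(3)
      interpret bounded_process \<Theta> f \<alpha>0 c C "M m" "Y m" "th m" B by (rule bp[OF m])
      have m_pos: "0 < real m" using m by simp
      have v_lt: "real_of_int (v m) < sqrt (real m)" using elim(1) m_pos by (simp add: divide_less_eq)
      have est_meas: "est m S \<in> borel_measurable (M m)" and est_max: "\<And>\<omega>. \<omega> \<in> space (M m) \<Longrightarrow> is_arg_max (log_lik f (Y m) \<omega> S) (\<lambda>\<theta>. \<theta> \<in> \<Theta>) (est m S \<omega>)"
        if "finite S" "S \<subseteq> {1..}" for S
        using mle[OF m] that unfolding is_MLE_def by blast+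
      have est_in: "est m {1..int m} \<omega> \<in> \<Theta>" if "\<omega> \<in> space (M m)" for \<omega>
        using est_max[of "{1..int m}" \<omega>] that by (auto simp: is_arg_max_def)
      \<comment> \<open>The window consists of the first \<open>p\<close> times after the change, so
        the second estimator sees only data generated with \<open>\<theta>1\<close>. That
        \<open>l\<close> is an admissible starting point follows from
        \<open>int m \<le> kstar m\<close>, \<open>1 \<le> v m\<close> and
        \<open>v m + 1 \<le> p\<close>.\<close>
      define p where "p = \<lfloor>\<kappa> * real m\<rfloor>"
      define l where "l = kstar m + 1"
      define k where "k = kstar m + p"
      have p: "\<kappa> * real m - 1 < of_int p" "of_int p \<le> \<kappa> * real m" unfolding p_def by linarith+
      have ks: "int m \<le> kstar m" "of_int (kstar m) \<le> Tstar * real m"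
      proof -
        have "1 * real m \<le> Tstar * real m" using Tstar by (intro mult_right_mono) auto
        then show "int m \<le> kstar m" unfolding kstar by (simp add: le_floor_iff)
        show "of_int (kstar m) \<le> Tstar * real m" unfolding kstar by simp
      qed
      have vp: "v m + 1 \<le> p" using v_lt elim(4) p by linarith
      \<comment> \<open>Every window considered by the monitoring scheme then starts at a positive
        time, where \<open>is_MLE\<close> guarantees a measurable estimator; this is needed for the
        measurability of the alarm event.\<close>
      have mv: "1 \<le> int m - v m" using v_lt elim(5) by linarith
      have k_le: "real_of_int k \<le> z * real m"
        using ks(2) p(2) by (simp add: k_def \<kappa>_def algebra_simps)
      have k_T: "int m < k" "T = \<infinity> \<or> k < \<lfloor>real_of_ereal T * real m\<rfloor> + 1"
      proof -
        show "int m < k" using ks(1) vp elim(2) by (simp add: k_def)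
        show "T = \<infinity> \<or> k < \<lfloor>real_of_ereal T * real m\<rfloor> + 1"
        proof (cases T)
          case (real r)
          then have "z * real m \<le> r * real m" using z by (intro mult_right_mono) auto
          then have "k \<le> \<lfloor>r * real m\<rfloor>" using k_le by (simp add: le_floor_iff)
          then show ?thesis using real by simp
        qed (use T in auto)
      qed
      have l_in: "l \<in> {int m - v m..k - v m}" using ks(1) vp elim(2) by (simp add: l_def k_def)
      have kl: "real_of_int (k - l) = of_int p - 1" by (simp add: k_def l_def)
      \<comment> \<open>The boundary is non-increasing and \<open>(k - l) / m\<close> stays above
        \<open>\<kappa> / 2\<close>, so a detector growing like \<open>sqrt m\<close> faces a
        constant.\<close>
      have b_le: "b (of_int (k - l) / real m) \<le> b (\<kappa> / 2)"
      proof -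
        have "\<kappa> / 2 * real m \<le> of_int (k - l)" using p elim(8) unfolding kl by linarith
        then have "\<kappa> / 2 \<le> of_int (k - l) / real m" using m_pos by (simp add: le_divide_eq)
        moreover have "b y \<le> b x" if "0 < x" "x \<le> y" for x y
          using b that unfolding assumption_B_def monotone_on_def by auto
        ultimately show ?thesis using \<kappa> by simp
      qed
      have q_le: "q \<le> of_int (k - l) / of_int k"
      proof -
        have k_pos: "0 < real_of_int k" using k_T(1) m by simp
        have "q * of_int k \<le> q * (z * real m)" using k_le q by (intro mult_left_mono) auto
        also have "\<dots> = \<kappa> / 2 * real m" using z_pos by (simp add: q_def)
        also have "\<dots> \<le> of_int (k - l)" using p elim(8) unfolding kl by linarith
        finally show ?thesis using k_pos by (simp add: le_divide_eq)
      qed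
      have W0: "whp (\<delta> / 4) (\<lambda>\<omega>. dist (est m {1..int m} \<omega>) \<theta>0 < e)"
        by (rule n0[rule_format, OF bp[OF m], where a=1 and b="int m"]) (use ks elim(6) est_max in \<open>auto simp: th_def\<close>)
      have W1: "whp (\<delta> / 4) (\<lambda>\<omega>. dist (est m {l..k} \<omega>) \<theta>1 < e)"
      proof (rule n1[rule_format, OF bp[OF m]])
        show "th m t = \<theta>1" if "t \<in> {l..k}" for t using that by (simp add: th_def l_def)
        show "1 \<le> l" using ks(1) m by (simp add: l_def)
        show "n1 \<le> real_of_int (k - l + 1)" using p(1) elim(7) by (simp add: k_def l_def)
        show "is_arg_max (log_lik f (Y m) \<omega> {l..k}) (\<lambda>\<theta>. \<theta> \<in> \<Theta>) (est m {l..k} \<omega>)" if "\<omega> \<in> space (M m)" for \<omega>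
          using that ks(1) m by (intro est_max) (auto simp: l_def)
      qed
      have W2: "whp (\<delta> / 4) (\<lambda>\<omega>. \<forall>x. x \<noteq> 0 \<longrightarrow> x \<bullet> (Sigma_hat f Df (Y m) (est m) m \<omega> *v x) \<noteq> 0)"
        by (rule n2[rule_format, OF bp[OF m]]) (use elim(6) est_in in auto)
      have W3: "whp (\<delta> / 4) (\<lambda>\<omega>. \<forall>x. x \<bullet> (Sigma_hat f Df (Y m) (est m) m \<omega> *v x) \<le> K * (norm x)\<^sup>2)"
        unfolding K_def by (rule whp_Sigma_hat_bounded[OF bp[OF m] \<delta>4]) (use m est_in in auto)
      have "whp \<delta> (\<lambda>\<omega>. monitor_time f Df (Y m) (est m) b v T m \<omega> < \<infinity>)"
      proof (rule whp_mono[OF whp_conj[OF W0 whp_conj[OF W1 whp_conj[OF W2 W3]]]])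
        fix \<omega> assume \<omega>: "\<omega> \<in> space (M m)"
        assume ev: "dist (est m {1..int m} \<omega>) \<theta>0 < e \<and> dist (est m {l..k} \<omega>) \<theta>1 < e \<and>
          (\<forall>x. x \<noteq> 0 \<longrightarrow> x \<bullet> (Sigma_hat f Df (Y m) (est m) m \<omega> *v x) \<noteq> 0) \<and>
          (\<forall>x. x \<bullet> (Sigma_hat f Df (Y m) (est m) m \<omega> *v x) \<le> K * (norm x)\<^sup>2)"
        have "dist \<theta>0 \<theta>1 \<le> dist (est m {1..int m} \<omega>) \<theta>0 + dist (est m {l..k} \<omega>) (est m {1..int m} \<omega>) + dist (est m {l..k} \<omega>) \<theta>1"
          by metric
        then have "2 * e \<le> norm (est m {l..k} \<omega> - est m {1..int m} \<omega>)"
          using ev unfolding dist_norm[symmetric] e_def by linarith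
        then have "sqrt (real m) * q * (2 * e / sqrt K) \<le> detector f Df (Y m) (est m) m k l \<omega>"
          using ev K q q_le e pos_semidef_Sigma_hat[of "est m" m \<omega> "Y m", OF est_in[OF \<omega>]]
          by (intro detector_ge) auto
        with elim(9) b_le have "b (of_int (k - l) / real m) < detector f Df (Y m) (est m) m k l \<omega>" by linarith
        then show "monitor_time f Df (Y m) (est m) b v T m \<omega> < \<infinity>"
          unfolding monitor_time_finite_iff using k_T l_in by blast
      qed simp
      moreover have "?mon m \<in> sets (M m)"
      proof -
        let ?A = "{k. int m < k \<and> (T = \<infinity> \<or> k < \<lfloor>real_of_ereal T * real m\<rfloor> + 1)}"
        have "?mon m = (\<Union>k\<in>?A. \<Union>l\<in>{int m - v m..k - v m}.
            {\<omega> \<in> space (M m). b (of_int (k - l) / real m) < detector f Df (Y m) (est m) m k l \<omega>})"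
          unfolding monitor_time_finite_iff by blast
        also have "\<dots> \<in> sets (M m)"
        proof (rule sets.countable_UN''[OF countableI_type])
          fix k
          show "(\<Union>l\<in>{int m - v m..k - v m}.
            {\<omega> \<in> space (M m). b (of_int (k - l) / real m) < detector f Df (Y m) (est m) m k l \<omega>}) \<in> sets (M m)"
          proof (rule sets.finite_UN)
            fix l assume l: "l \<in> {int m - v m..k - v m}"
            have [measurable]: "detector f Df (Y m) (est m) m k l \<in> borel_measurable (M m)"
            proof (rule detector_measurable)
              show "count_process (M m) (Y m)" by (rule count_process_axioms)
              show "est m {l..k} \<in> borel_measurable (M m)" using l mv by (intro est_meas) auto
            qed (use est_meas est_in in auto)
            show "{\<omega> \<in> space (M m). b (of_int (k - l) / real m) < detector f Df (Y m) (est m) m k l \<omega>} \<in> sets (M m)"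
              by measurable
          qed simp
        qed
        finally show ?thesis .
      qed
      ultimately show ?case by (rule prob_ge_of_whp)
    qed
  qed
  show ?thesis
  proof (rule order_tendstoI)
    fix a :: real assume "a < 1"
    then have "0 < (1 - a) / 2" by simp
    from main[OF this] show "\<forall>\<^sub>F m in sequentially. a < measure (M m) (?mon m)"
      by eventually_elim (use \<open>a < 1\<close> in \<open>simp add: field_simps\<close>)
  next
    fix a :: real assume "1 < a"
    have "\<forall>\<^sub>F m in sequentially. (1::nat) \<le> m" by (rule eventually_ge_at_top)
    then show "\<forall>\<^sub>F m in sequentially. measure (M m) (?mon m) < a"
    proof eventually_elim
      case (elim m)
      then show ?case using prob_space.prob_le_1[OF prob[OF elim], of "?mon m"] \<open>1 < a\<close> by linarith
    qed
  qed
qed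

end
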